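(* For all integers $N\ge 2$, the free orthogonal group $O^+_N$ is topologically generated by its quantum subgroups $O_N$ and $T^+_N=\widehat{\mathbb{Z}_2^{*N}}$: $$O^+_N=\langle O_N,\ T^+_N\rangle.$$
   Context: A CQG algebra is a complex Hopf $*$-algebra $\mathcal{A}$ that is cosemisimple and whose unique unital (left and right) integral $h:\mathcal{A}\to\mathbb{C}$ is positive, i.e. $h(x^*x)\ge 0$ for all $x\in\mathcal{A}$. The category of compact quantum groups is the category dual to that of CQG algebras; $\mathcal{O}(G)$ denotes the CQG algebra attached to a compact quantum group $G$. For an ordinary compact group $G$, $\mathcal{O}(G)$ is the algebra of (complex-valued) representative functions. A quantum subgroup $H\le G$ means a quotient Hopf $*$-algebra $\mathcal{O}(G)\to\mathcal{O}(H)$. Topological generation: a family $G_i\le G$, $i\in I$, of quantum subgroups topologically generates $G$, written $G=\langle G_i,\ i\in I\rangle$, if the quotient maps $\mathcal{O}(G)\to\mathcal{O}(G_i)$, $i\in I$, do not all factor through one and the same proper quotient Hopf $*$-algebra of $\mathcal{O}(G)$. For a discrete group $\Gamma$, $\widehat{\Gamma}$ denotes the compact quantum group with $\mathcal{O}(\widehat{\Gamma})=\mathbb{C}\Gamma$, the group algebra with every $\gamma\in\Gamma$ unitary, $\Delta(\gamma)=\gamma\otimes\gamma$ and $\varepsilon(\gamma)=1$. Free orthogonal group: for $N\ge 2$, $O^+_N$ is the compact quantum group whose CQG algebra $\mathcal{O}(O^+_N)$ is generated as a $*$-algebra by self-adjoint elements $u_{ij}=u_{ij}^*$, $1\le i,j\le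 N$, subject to the relations that the matrix $u=(u_{ij})_{i,j}\in M_N(\mathcal{O}(O^+_N))$ (which equals $\overline{u}=(u_{ij}^* )_{i,j}$) is unitary, with $\Delta(u_{ij})=\sum_k u_{ik}\otimes u_{kj}$ and $\varepsilon(u_{ij})=\delta_{ij}$. The classical real orthogonal group $O_N$ is a quantum subgroup of $O^+_N$ by sending $u_{ij}$ to the $(i,j)$ coordinate function on $O_N$. The quantum group $T^+_N:=\widehat{\mathbb{Z}_2^{*N}}$, the dual of the free product of $N$ copies of $\mathbb{Z}_2=\mathbb{Z}/2\mathbb{Z}$ with order-two generators $g_1,\dots,g_N$, is a quantum subgroup of $O^+_N$ via $u_{ij}\mapsto\delta_{ij}g_i$. *)

theory Defs
  imports
    "HOL-Analysis.Analysis"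
    "HOL-Library.Poly_Mapping"
    "HOL-Algebra.QuotRing"
    "HOL-Algebra.Module"
    "HOL-Algebra.Elementary_Groups"
begin

section \<open>Complex star-algebras\<close>

record 'a star_algebra = "(complex, 'a) module" +
  star :: "'a \<Rightarrow> 'a"

definition complex_alg :: "complex star_algebra" where
  "complex_alg = \<lparr>carrier = UNIV, monoid.mult = (*), one = 1, zero = 0, add = (+),
     smult = (*), star = cnj\<rparr>"

locale star_algebra = Module.module complex_alg A + ring A for A (structure) +
  assumes smult_mult_left: "\<lbrakk>x \<in> carrier A; y \<in> carrier A\<rbrakk> \<Longrightarrow> (c \<odot> x) \<otimes> y = c \<odot> (x \<otimes> y)"
    and smult_mult_right: "\<lbrakk>x \<in> carrier A; y \<in> carrier A\<rbrakk> \<Longrightarrow> x \<otimes> (c \<odot> y) = c \<odot> (x \<otimes> y)"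
    and star_closed: "x \<in> carrier A \<Longrightarrow> star A x \<in> carrier A"
    and star_star: "x \<in> carrier A \<Longrightarrow> star A (star A x) = x"
    and star_add: "\<lbrakk>x \<in> carrier A; y \<in> carrier A\<rbrakk> \<Longrightarrow> star A (x \<oplus> y) = star A x \<oplus> star A y"
    and star_smult: "x \<in> carrier A \<Longrightarrow> star A (c \<odot> x) = cnj c \<odot> star A x"
    and star_mult: "\<lbrakk>x \<in> carrier A; y \<in> carrier A\<rbrakk> \<Longrightarrow> star A (x \<otimes> y) = star A y \<otimes> star A x"

definition star_alg_hom ::
  "('a, 'x) star_algebra_scheme \<Rightarrow> ('b, 'y) star_algebra_scheme \<Rightarrow> ('a \<Rightarrow> 'b) set" where
  "star_alg_hom A B = {f \<in> ring_hom A B. \<forall>x \<in> carrier A.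
     (\<forall>c. f (c \<odot>\<^bsub>A\<^esub> x) = c \<odot>\<^bsub>B\<^esub> f x) \<and> f (star A x) = star B (f x)}"

text \<open>
  The star-algebra of a monoid \<open>M\<close> with an anti-multiplicative involution \<open>\<tau>\<close>: finite formal
  linear combinations of elements of \<open>M\<close>, with the product extended bilinearly and \<open>\<tau>\<close> extended
  conjugate-linearly.
\<close>

definition monoid_algebra ::
  "('m, 'x) monoid_scheme \<Rightarrow> ('m \<Rightarrow> 'm) \<Rightarrow> ('m \<Rightarrow>\<^sub>0 complex) star_algebra" where
  "monoid_algebra M \<tau> =
     \<lparr>carrier = {f. Poly_Mapping.keys f \<subseteq> carrier M},
      monoid.mult = (\<lambda>f g. \<Sum>p \<in> Poly_Mapping.keys f. \<Sum>q \<in> Poly_Mapping.keys g.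
        Poly_Mapping.single (p \<otimes>\<^bsub>M\<^esub> q) (Poly_Mapping.lookup f p * Poly_Mapping.lookup g q)),
      one = Poly_Mapping.single \<one>\<^bsub>M\<^esub> 1,
      zero = 0,
      add = (+),
      smult = (\<lambda>c f. Poly_Mapping.map ((*) c) f),
      star = (\<lambda>f. \<Sum>p \<in> Poly_Mapping.keys f.
        Poly_Mapping.single (\<tau> p) (cnj (Poly_Mapping.lookup f p)))\<rparr>"

text \<open>Only meaningful for two-sided ideals stable under the involution, as all those used below.\<close>

definition quot_algebra :: "('a, 'x) star_algebra_scheme \<Rightarrow> 'a set \<Rightarrow> 'a set star_algebra" where
  "quot_algebra A I =
     \<lparr>carrier = carrier (A Quot I),
      monoid.mult = monoid.mult (A Quot I),
      one = one (A Quot I),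
      zero = zero (A Quot I),
      add = add (A Quot I),
      smult = (\<lambda>c X. \<Union>x\<in>X. I +>\<^bsub>A\<^esub> (c \<odot>\<^bsub>A\<^esub> x)),
      star = (\<lambda>X. \<Union>x\<in>X. I +>\<^bsub>A\<^esub> star A x)\<rparr>"


section \<open>Tensor products\<close>

text \<open>
  The algebraic tensor product over the complex numbers is the free vector space on
  \<open>carrier A \<times> carrier B\<close> modulo the bilinearity relations. This free vector space is the monoid
  algebra of the product of the multiplicative monoids of \<open>A\<close> and \<open>B\<close>; multiplying a bilinearity
  relation by a basis element gives a bilinearity relation again, so the linear span of these
  relations is the two-sided ideal they generate, and the quotient carries the usual product
  \<open>(a \<otimes> b)(a' \<otimes> b') = aa' \<otimes> bb'\<close> and involution.
\<close>

definition formal_tensor ::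
  "('a, 'x) star_algebra_scheme \<Rightarrow> ('b, 'y) star_algebra_scheme \<Rightarrow> ('a \<times> 'b \<Rightarrow>\<^sub>0 complex) star_algebra"
  where
  "formal_tensor A B = monoid_algebra (A \<times>\<times> B) (\<lambda>(a, b). (star A a, star B b))"

definition tensor_rels ::
  "('a, 'x) star_algebra_scheme \<Rightarrow> ('b, 'y) star_algebra_scheme \<Rightarrow> ('a \<times> 'b \<Rightarrow>\<^sub>0 complex) set"
  where
  "tensor_rels A B =
     {Poly_Mapping.single (a \<oplus>\<^bsub>A\<^esub> a', b) 1 - Poly_Mapping.single (a, b) 1
        - Poly_Mapping.single (a', b) 1 | a a' b. a \<in> carrier A \<and> a' \<in> carrier A \<and> b \<in> carrier B} \<union>
     {Poly_Mapping.single (a, b \<oplus>\<^bsub>B\<^esub> b') 1 - Poly_Mapping.single (a, b) 1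
        - Poly_Mapping.single (a, b') 1 | a b b'. a \<in> carrier A \<and> b \<in> carrier B \<and> b' \<in> carrier B} \<union>
     {Poly_Mapping.single (c \<odot>\<^bsub>A\<^esub> a, b) 1 - Poly_Mapping.single (a, b) c | c a b.
        a \<in> carrier A \<and> b \<in> carrier B} \<union>
     {Poly_Mapping.single (a, c \<odot>\<^bsub>B\<^esub> b) 1 - Poly_Mapping.single (a, b) c | c a b.
        a \<in> carrier A \<and> b \<in> carrier B}"

type_synonym ('a, 'b) tensor = "('a \<times> 'b \<Rightarrow>\<^sub>0 complex) set"

definition tensor_algebra ::
  "('a, 'x) star_algebra_scheme \<Rightarrow> ('b, 'y) star_algebra_scheme \<Rightarrow> ('a, 'b) tensor star_algebra"
  where
  "tensor_algebra A B =
     quot_algebra (formal_tensor A B) (Idl\<^bsub>formal_tensor A B\<^esub> (tensor_rels A B))"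

definition pure_tensor ::
  "('a, 'x) star_algebra_scheme \<Rightarrow> ('b, 'y) star_algebra_scheme \<Rightarrow> 'a \<Rightarrow> 'b \<Rightarrow> ('a, 'b) tensor" where
  "pure_tensor A B a b =
     (Idl\<^bsub>formal_tensor A B\<^esub> (tensor_rels A B)) +>\<^bsub>formal_tensor A B\<^esub> Poly_Mapping.single (a, b) 1"

text \<open>
  The linear map on a tensor product induced by a bilinear map \<open>\<beta>\<close> with values in \<open>C\<close>, evaluated
  on representatives (the value does not depend on the representative).
\<close>

definition tensor_lift ::
  "('c, 'z) star_algebra_scheme \<Rightarrow> ('a \<Rightarrow> 'b \<Rightarrow> 'c) \<Rightarrow> ('a, 'b) tensor \<Rightarrow> 'c" where
  "tensor_lift C \<beta> t = the_elem
     ((\<lambda>f. \<Oplus>\<^bsub>C\<^esub>p \<in> Poly_Mapping.keys f. Poly_Mapping.lookup f p \<odot>\<^bsub>C\<^esub> \<beta> (fst p) (snd p)) ` t)"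


section \<open>Hopf star-algebras and their quotients\<close>

record 'a hopf_star_algebra = "'a star_algebra" +
  comult :: "'a \<Rightarrow> ('a, 'a) tensor"
  counit :: "'a \<Rightarrow> complex"

definition with_coalgebra ::
  "'a star_algebra \<Rightarrow> ('a \<Rightarrow> ('a, 'a) tensor) \<Rightarrow> ('a \<Rightarrow> complex) \<Rightarrow> 'a hopf_star_algebra" where
  "with_coalgebra A \<Delta> \<epsilon> = star_algebra.extend A (hopf_star_algebra.fields \<Delta> \<epsilon>)"

text \<open>
  The antipode is unique, and its compatibility with the involution and with morphisms is automatic,
  so only its existence is required.
\<close>

locale hopf_star_algebra = star_algebra A for A (structure) +
  assumes comult_hom: "comult A \<in> star_alg_hom A (tensor_algebra A A)"
    and counit_hom: "counit A \<in> star_alg_hom A complex_alg"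
    and coassoc: "x \<in> carrier A \<Longrightarrow>
      tensor_lift (tensor_algebra A (tensor_algebra A A))
        (\<lambda>a b. tensor_lift (tensor_algebra A (tensor_algebra A A))
           (\<lambda>a' a''. pure_tensor A (tensor_algebra A A) a' (pure_tensor A A a'' b)) (comult A a))
        (comult A x) =
      tensor_lift (tensor_algebra A (tensor_algebra A A))
        (\<lambda>a b. pure_tensor A (tensor_algebra A A) a (comult A b)) (comult A x)"
    and counit_left: "x \<in> carrier A \<Longrightarrow> tensor_lift A (\<lambda>a b. counit A a \<odot> b) (comult A x) = x"
    and counit_right: "x \<in> carrier A \<Longrightarrow> tensor_lift A (\<lambda>a b. counit A b \<odot> a) (comult A x) = x"
    and antipode: "\<exists>S \<in> carrier A \<rightarrow> carrier A.
      (\<forall>x \<in> carrier A. \<forall>y \<in> carrier A. S (x \<oplus> y) = S x \<oplus> S y) \<and>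
      (\<forall>c. \<forall>x \<in> carrier A. S (c \<odot> x) = c \<odot> S x) \<and>
      (\<forall>x \<in> carrier A. tensor_lift A (\<lambda>a b. S a \<otimes> b) (comult A x) = counit A x \<odot> \<one> \<and>
                       tensor_lift A (\<lambda>a b. a \<otimes> S b) (comult A x) = counit A x \<odot> \<one>)"

definition hopf_star_hom ::
  "('a, 'x) hopf_star_algebra_scheme \<Rightarrow> ('b, 'y) hopf_star_algebra_scheme \<Rightarrow> ('a \<Rightarrow> 'b) set" where
  "hopf_star_hom A B = {f \<in> star_alg_hom A B. \<forall>x \<in> carrier A.
     comult B (f x) =
       tensor_lift (tensor_algebra B B) (\<lambda>a a'. pure_tensor B B (f a) (f a')) (comult A x) \<and>
     counit B (f x) = counit A x}"

text \<open>\<open>q\<close> exhibits \<open>B\<close> as a quotient Hopf star-algebra of \<open>A\<close>; it is proper if \<open>q\<close> is not injective.\<close>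

definition hopf_star_quotient ::
  "('a, 'x) hopf_star_algebra_scheme \<Rightarrow> ('b, 'y) hopf_star_algebra_scheme \<Rightarrow> ('a \<Rightarrow> 'b) \<Rightarrow> bool" where
  "hopf_star_quotient A B q \<longleftrightarrow>
     hopf_star_algebra A \<and> hopf_star_algebra B \<and> q \<in> hopf_star_hom A B \<and> q ` carrier A = carrier B"

definition factors_through ::
  "('a, 'x) hopf_star_algebra_scheme \<Rightarrow> ('c, 'z) hopf_star_algebra_scheme \<Rightarrow> ('a \<Rightarrow> 'c) \<Rightarrow>
   ('b, 'y) hopf_star_algebra_scheme \<Rightarrow> ('a \<Rightarrow> 'b) \<Rightarrow> bool" where
  "factors_through A C \<pi> B q \<longleftrightarrow> (\<exists>p \<in> hopf_star_hom B C. \<forall>x \<in> carrier A. \<pi> x = p (q x))"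

text \<open>
  Topological generation of the compact quantum group dual to \<open>A\<close> by two quantum subgroups, given by
  quotient maps \<open>\<pi>1\<close> and \<open>\<pi>2\<close> of \<open>A\<close> onto \<open>C1\<close> and \<open>C2\<close>. The carrier of the intermediate
  quotient lives in the type \<open>'b\<close>; a statement with \<open>'b\<close> a free type variable is about all
  quotients (up to isomorphism, those with \<open>'b\<close> the type of sets over \<open>'a\<close> suffice).
\<close>

definition topologically_generated_by ::
  "'b itself \<Rightarrow> 'a hopf_star_algebra \<Rightarrow> 'c hopf_star_algebra \<Rightarrow> ('a \<Rightarrow> 'c) \<Rightarrow>
   'd hopf_star_algebra \<Rightarrow> ('a \<Rightarrow> 'd) \<Rightarrow> bool" where
  "topologically_generated_by _ A C1 \<pi>1 C2 \<pi>2 \<longleftrightarrow>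
     \<not> (\<exists>(B :: 'b hopf_star_algebra) q.
          hopf_star_quotient A B q \<and> \<not> inj_on q (carrier A) \<and>
          factors_through A C1 \<pi>1 B q \<and> factors_through A C2 \<pi>2 B q)"


section \<open>Star-algebras presented by self-adjoint generators\<close>

definition free_star_algebra :: "('s list \<Rightarrow>\<^sub>0 complex) star_algebra" where
  "free_star_algebra = monoid_algebra \<lparr>carrier = UNIV, monoid.mult = (@), one = []\<rparr> rev"

definition presented_algebra ::
  "('s list \<Rightarrow>\<^sub>0 complex) set \<Rightarrow> ('s list \<Rightarrow>\<^sub>0 complex) set star_algebra" where
  "presented_algebra R = quot_algebra free_star_algebra (Idl\<^bsub>free_star_algebra\<^esub> R)"

definition presented_gen :: "('s list \<Rightarrow>\<^sub>0 complex) set \<Rightarrow> 's \<Rightarrow> ('s list \<Rightarrow>\<^sub>0 complex) set" where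
  "presented_gen R s = (Idl\<^bsub>free_star_algebra\<^esub> R) +>\<^bsub>free_star_algebra\<^esub> Poly_Mapping.single [s] 1"

text \<open>
  The homomorphism from a presented algebra to \<open>B\<close> sending the generator \<open>s\<close> to \<open>\<phi> s\<close>, where the
  elements \<open>\<phi> s\<close> satisfy the defining relations.
\<close>

definition nc_eval ::
  "('b, 'y) star_algebra_scheme \<Rightarrow> ('s \<Rightarrow> 'b) \<Rightarrow> ('s list \<Rightarrow>\<^sub>0 complex) \<Rightarrow> 'b" where
  "nc_eval B \<phi> f = (\<Oplus>\<^bsub>B\<^esub>w \<in> Poly_Mapping.keys f.
     Poly_Mapping.lookup f w \<odot>\<^bsub>B\<^esub> foldr (\<lambda>s y. \<phi> s \<otimes>\<^bsub>B\<^esub> y) w \<one>\<^bsub>B\<^esub>)"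

definition presented_hom ::
  "('b, 'y) star_algebra_scheme \<Rightarrow> ('s \<Rightarrow> 'b) \<Rightarrow> ('s list \<Rightarrow>\<^sub>0 complex) set \<Rightarrow> 'b" where
  "presented_hom B \<phi> X = the_elem (nc_eval B \<phi> ` X)"


section \<open>The free orthogonal quantum group\<close>

text \<open>
  The generator \<open>u\<^sub>i\<^sub>j\<close> is the letter \<open>(i, j)\<close>; since \<open>u\<close> has self-adjoint entries, the relations are
  the entries of \<open>u u\<^sup>T = 1\<close> and \<open>u\<^sup>T u = 1\<close>.
\<close>

definition orth_rels :: "(('n::finite \<times> 'n) list \<Rightarrow>\<^sub>0 complex) set" where
  "orth_rels =
     {(\<Sum>k\<in>UNIV. Poly_Mapping.single [(i, k), (j, k)] 1)
        - Poly_Mapping.single [] (if i = j then 1 else 0) | i j. True} \<union>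
     {(\<Sum>k\<in>UNIV. Poly_Mapping.single [(k, i), (k, j)] 1)
        - Poly_Mapping.single [] (if i = j then 1 else 0) | i j. True}"

definition free_orth_alg :: "(('n::finite \<times> 'n) list \<Rightarrow>\<^sub>0 complex) set star_algebra" where
  "free_orth_alg = presented_algebra orth_rels"

definition free_orth_gen :: "'n::finite \<Rightarrow> 'n \<Rightarrow> (('n \<times> 'n) list \<Rightarrow>\<^sub>0 complex) set" where
  "free_orth_gen i j = presented_gen orth_rels (i, j)"

definition free_orthogonal :: "(('n::finite \<times> 'n) list \<Rightarrow>\<^sub>0 complex) set hopf_star_algebra" where
  "free_orthogonal = with_coalgebra free_orth_alg
     (presented_hom (tensor_algebra free_orth_alg free_orth_alg)
        (\<lambda>(i, j). \<Oplus>\<^bsub>tensor_algebra free_orth_alg free_orth_alg\<^esub>k\<in>UNIV.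
           pure_tensor free_orth_alg free_orth_alg (free_orth_gen i k) (free_orth_gen k j)))
     (presented_hom complex_alg (\<lambda>(i, j). if i = j then 1 else 0))"


section \<open>Representative functions on a compact group\<close>

text \<open>
  Functions on \<open>G\<close> are represented by total functions vanishing off \<open>carrier G\<close>. Such a function is
  representative if it is continuous and its translates span a finite-dimensional space.
\<close>

definition representative_functions ::
  "('g::topological_space, 'x) monoid_scheme \<Rightarrow> ('g \<Rightarrow> complex) set" where
  "representative_functions G =
     {f. (\<forall>x. x \<notin> carrier G \<longrightarrow> f x = 0) \<and> continuous_on (carrier G) f \<and>
         (\<exists>F :: ('g \<Rightarrow> complex) set. finite F \<and>
            (\<forall>g \<in> carrier G. \<exists>c. \<forall>x \<in> carrier G. f (g \<otimes>\<^bsub>G\<^esub> x) = (\<Sum>h\<in>F. c h * h x)))}"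

definition representative_alg ::
  "('g::topological_space, 'x) monoid_scheme \<Rightarrow> ('g \<Rightarrow> complex) star_algebra" where
  "representative_alg G =
     \<lparr>carrier = representative_functions G,
      monoid.mult = (\<lambda>f g x. f x * g x),
      one = (\<lambda>x. if x \<in> carrier G then 1 else 0),
      zero = (\<lambda>x. 0),
      add = (\<lambda>f g x. f x + g x),
      smult = (\<lambda>c f x. c * f x),
      star = (\<lambda>f x. cnj (f x))\<rparr>"

definition function_hopf_algebra ::
  "('g::topological_space, 'x) monoid_scheme \<Rightarrow> ('g \<Rightarrow> complex) hopf_star_algebra" where
  "function_hopf_algebra G = with_coalgebra (representative_alg G)
     (\<lambda>f. THE t. t \<in> carrier (tensor_algebra (representative_alg G) (representative_alg G)) \<and>
        (\<forall>x \<in> carrier G. \<forall>y \<in> carrier G.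
           tensor_lift complex_alg (\<lambda>a b. a x * b y) t = f (x \<otimes>\<^bsub>G\<^esub> y)))
     (\<lambda>f. f \<one>\<^bsub>G\<^esub>)"

definition orthogonal_group :: "(real^'n^'n) monoid" where
  "orthogonal_group = \<lparr>carrier = {Q. orthogonal_matrix Q}, monoid.mult = (**), one = mat 1\<rparr>"

definition orth_quotient_map ::
  "(('n::finite \<times> 'n) list \<Rightarrow>\<^sub>0 complex) set \<Rightarrow> (real^'n^'n \<Rightarrow> complex)" where
  "orth_quotient_map = presented_hom (function_hopf_algebra orthogonal_group)
     (\<lambda>(i, j). \<lambda>Q. if orthogonal_matrix Q then of_real (Q $ i $ j) else 0)"


section \<open>Duals of discrete groups and the dual of a free product of copies of Z/2\<close>

definition group_hopf_algebra ::
  "('g, 'x) monoid_scheme \<Rightarrow> ('g \<Rightarrow>\<^sub>0 complex) hopf_star_algebra" where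
  "group_hopf_algebra \<Gamma> =
     (let A = monoid_algebra \<Gamma> (m_inv \<Gamma>) in
      with_coalgebra A
        (\<lambda>f. \<Oplus>\<^bsub>tensor_algebra A A\<^esub>g \<in> Poly_Mapping.keys f. Poly_Mapping.lookup f g
           \<odot>\<^bsub>tensor_algebra A A\<^esub> pure_tensor A A (Poly_Mapping.single g 1) (Poly_Mapping.single g 1))
        (\<lambda>f. \<Sum>g \<in> Poly_Mapping.keys f. Poly_Mapping.lookup f g))"

text \<open>
  The free product of the groups \<open>G i\<close>, realised on reduced words: lists of nontrivial syllables
  \<open>(i, g)\<close> in which neighbouring syllables belong to different factors. \<open>fp_cons\<close> multiplies a
  reduced word by a nontrivial syllable on the left.
\<close>

fun fp_cons :: "('i \<Rightarrow> ('g, 'x) monoid_scheme) \<Rightarrow> 'i \<times> 'g \<Rightarrow> ('i \<times> 'g) list \<Rightarrow> ('i \<times> 'g) list" where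
  "fp_cons G (i, g) [] = [(i, g)]"
| "fp_cons G (i, g) ((j, h) # w) =
     (if i \<noteq> j then (i, g) # (j, h) # w
      else if g \<otimes>\<^bsub>G i\<^esub> h = \<one>\<^bsub>G i\<^esub> then w
      else (i, g \<otimes>\<^bsub>G i\<^esub> h) # w)"

definition free_product :: "('i \<Rightarrow> ('g, 'x) monoid_scheme) \<Rightarrow> ('i \<times> 'g) list monoid" where
  "free_product G =
     \<lparr>carrier = {w. (\<forall>(i, g) \<in> set w. g \<in> carrier (G i) \<and> g \<noteq> \<one>\<^bsub>G i\<^esub>) \<and> distinct_adj (map fst w)},
      monoid.mult = foldr (fp_cons G),
      one = []\<rparr>"

definition Z2_free_power :: "('n \<times> int) list monoid" where
  "Z2_free_power = free_product (\<lambda>_. integer_mod_group 2)"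

definition diag_quotient_map ::
  "(('n::finite \<times> 'n) list \<Rightarrow>\<^sub>0 complex) set \<Rightarrow> (('n \<times> int) list \<Rightarrow>\<^sub>0 complex)" where
  "diag_quotient_map = presented_hom (group_hopf_algebra Z2_free_power)
     (\<lambda>(i, j). if i = j then Poly_Mapping.single [(i, 1)] 1 else 0)"

end

theory Submission
  imports Defs
begin

text \<open>
  Let \<open>q\<close> be a quotient map of Hopf star-algebras out of \<open>O(O\<^sub>N\<^sup>+)\<close> through which the quotient maps
  onto \<open>O(O\<^sub>N)\<close> and onto the group algebra of the free product \<open>\<Gamma>\<close> of \<open>N\<close> groups of order two both
  factor. Pull the kernel of \<open>q\<close> back to a space \<open>null\<close> of noncommutative polynomials in the letters
  \<open>u\<^sub>i\<^sub>j\<close>; the claim is that \<open>null\<close> consists of consequences of the orthogonality relations.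

  Since \<open>q\<close> respects comultiplications, applying a linear functional of the quotient to one leg of
  the comultiplication maps \<open>null\<close> into itself (\<open>bilinear_convolution_null\<close>, \<open>translate_null\<close>). Because
  of the two factorizations, evaluation at any \<open>Q \<in> O\<^sub>N\<close> and the coefficient at any \<open>g \<in> \<Gamma>\<close> are such
  functionals. Read a monomial \<open>u\<close> with row indices \<open>I\<close> and column indices \<open>J\<close>, both words of length
  \<open>k\<close>, as the element \<open>e\<^sub>I \<otimes> e\<^sub>J\<close> of \<open>V\<^sup>k \<otimes> V\<^sup>k\<close>, where \<open>V\<^sup>k\<close> is the \<open>k\<close>-th tensor power of \<open>\<complex>\<^sup>N\<close>. Then
  \<open>null\<close> is invariant, in either factor, under \<open>Q \<otimes> \<dots> \<otimes> Q\<close> and under the projection onto the span of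
  those words \<open>i\<^sub>1 \<dots> i\<^sub>k\<close> whose product of generators of \<open>\<Gamma>\<close> is \<open>g\<close>.

  What remains is a statement about such invariant spaces (\<open>subset_relations\<close>), proved by induction on
  the degree. Modulo the relations and terms of lower degree, the top component of a polynomial can be
  taken orthogonal to everything that arises by inserting the invariant vector of \<open>V\<^sup>2\<close> at two
  adjacent places, in both factors. If \<open>I\<close> and \<open>J\<close> are reduced words of the top degree, projecting onto
  their values in \<open>\<Gamma>\<close> leaves a single monomial, because shorter words have shorter values; evaluating
  at an orthogonal matrix without zero entries shows that its coefficient vanishes. Finally
  \<open>invariant_subspace_zero\<close> says that in the space of tensors with vanishing adjacent contractions an
  invariant subspace is zero as soon as its members vanish on reduced words. Applied to each factor in
  turn, it kills the top component.

  That last result is the heart of the matter; it expresses that the top component of each tensor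
  power of the fundamental representation is already irreducible under the group generated by \<open>O\<^sub>N\<close>
  and the dual of \<open>\<Gamma>\<close>. Its proof is an induction on \<open>k\<close> which rests on \<open>gap_values_zero\<close>: invariance
  under infinitesimal rotations in coordinate planes, tested on reduced words of length \<open>k\<close>, determines
  the values of a tensor on the words with value of length \<open>k - 2\<close> up to one scalar sequence, and the
  vanishing of the contractions turns into a three-term recursion for this sequence, whose only
  solution is zero for \<open>N \<ge> 2\<close>.
\<close>

abbreviation "lookup \<equiv> Poly_Mapping.lookup"
abbreviation "single \<equiv> Poly_Mapping.single"
abbreviation "keys \<equiv> Poly_Mapping.keys"

section \<open>Reduced words\<close>

text \<open>
  A word over the index set stands for the product of the corresponding generators in the free product
  of groups of order two. The elements of this group are the words without equal neighbours, and
  \<open>gcons\<close> is left multiplication by a generator.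
\<close>

fun gcons :: "'a \<Rightarrow> 'a list \<Rightarrow> 'a list" where
  "gcons a [] = [a]"
| "gcons a (b # v) = (if a = b then v else a # b # v)"

definition reduce :: "'a list \<Rightarrow> 'a list" where
  "reduce w = foldr gcons w []"

lemma distinct_adj_gcons: "distinct_adj v \<Longrightarrow> distinct_adj (gcons a v)"
  by (cases v) (auto simp: distinct_adj_Cons)

lemma distinct_adj_foldr_gcons: "distinct_adj v \<Longrightarrow> distinct_adj (foldr gcons u v)"
  by (induction u) (auto intro: distinct_adj_gcons)

lemma distinct_adj_reduce [simp]: "distinct_adj (reduce w)"
  unfolding reduce_def by (rule distinct_adj_foldr_gcons) simp

lemma gcons_gcons: "distinct_adj v \<Longrightarrow> gcons a (gcons a v) = v"
  by (cases v; cases "tl v") (auto simp: distinct_adj_Cons)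

lemma gcons_Cons: "distinct_adj (a # v) \<Longrightarrow> gcons a v = a # v"
  by (cases v) (auto simp: distinct_adj_Cons)

lemma reduce_Nil [simp]: "reduce [] = []"
  by (simp add: reduce_def)

lemma reduce_Cons: "reduce (a # w) = gcons a (reduce w)"
  by (simp add: reduce_def)

lemma reduce_append: "reduce (u @ v) = foldr gcons u (reduce v)"
  by (simp add: reduce_def)

lemma reduce_distinct_adj: "distinct_adj w \<Longrightarrow> reduce w = w"
proof (induction w)
  case (Cons a w)
  then have "distinct_adj w" by (cases w) (auto simp: distinct_adj_Cons)
  then show ?case using Cons by (simp add: reduce_Cons gcons_Cons)
qed simp

lemma length_gcons: "length (gcons a v) \<le> Suc (length v)"
  by (cases v) auto

lemma length_reduce: "length (reduce w) \<le> length w"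
proof (induction w)
  case (Cons a w)
  then show ?case using length_gcons[of a "reduce w"] by (simp add: reduce_Cons)
qed simp

lemma foldr_gcons_gcons:
  assumes "distinct_adj v" "distinct_adj y"
  shows "foldr gcons (gcons a v) y = gcons a (foldr gcons v y)"
proof (cases v)
  case (Cons b v')
  then show ?thesis
    using assms distinct_adj_foldr_gcons[of y v'] by (auto simp: gcons_gcons)
qed auto

lemma foldr_gcons_reduce: "distinct_adj y \<Longrightarrow> foldr gcons (reduce u) y = foldr gcons u y"
  by (induction u) (auto simp: reduce_Cons foldr_gcons_gcons)

lemma reduce_append_cong:
  assumes "reduce v = reduce v'"
  shows "reduce (u @ v @ w) = reduce (u @ v' @ w)"
proof -
  have "foldr gcons v (reduce w) = foldr gcons v' (reduce w)"
    by (metis assms distinct_adj_reduce foldr_gcons_reduce)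
  then show ?thesis by (simp add: reduce_append)
qed

lemma reduce_rev_append: "reduce (rev u @ u @ w) = reduce w"
proof (induction u arbitrary: w)
  case (Cons a u)
  have "reduce ((a # a # u @ w)) = reduce (u @ w)"
    by (simp add: reduce_Cons gcons_gcons)
  then have "reduce (rev u @ (a # a # u @ w) @ []) = reduce (rev u @ (u @ w) @ [])"
    by (rule reduce_append_cong)
  then show ?case using Cons by simp
qed simp

lemma reduce_append_rev: "reduce (w @ u @ rev u) = reduce w"
  using reduce_append_cong[of "u @ rev u" "[]" w "[]"] reduce_rev_append[of "rev u" "[]"] by simp

text \<open>
  Cancellation in the free product: the reversed word is the inverse.
\<close>

lemma reduce_cancel:
  assumes "reduce (u @ x @ v) = reduce (u @ y @ v)"
  shows "reduce x = reduce y"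
proof -
  have "reduce (rev u @ (u @ x @ v) @ rev v) = reduce (rev u @ (u @ y @ v) @ rev v)"
    using assms by (rule reduce_append_cong)
  moreover have "reduce (rev u @ (u @ z @ v) @ rev v) = reduce z" for z
    using reduce_rev_append[of u "z @ v @ rev v"] reduce_append_rev[of z v] by simp
  ultimately show ?thesis by simp
qed

lemma reduce_insert_pair: "reduce (u @ [a, a] @ v) = reduce (u @ v)"
  using reduce_append_cong[of "[a, a]" "[]" u v] by (simp add: reduce_Cons)

text \<open>
  No word shorter than \<open>g\<close> has the value \<open>g\<close>, so projecting onto the value \<open>g\<close> kills all lower degrees
  and, in degree \<open>length g\<close>, keeps only the word \<open>g\<close>.
\<close>

lemma reduce_eq_same_length:
  assumes "reduce w = g" "length w \<le> length g"
  shows "w = g"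
  using assms
proof (induction w arbitrary: g)
  case (Cons a w)
  have l: "length (reduce w) \<le> length w" by (rule length_reduce)
  have g: "gcons a (reduce w) = g" using Cons.prems by (simp add: reduce_Cons)
  have "reduce w = w"
  proof (rule sym, rule Cons.IH)
    show "length w \<le> length (reduce w)"
      using Cons.prems(2) g length_gcons[of a "reduce w"] l by simp
  qed simp
  with g Cons.prems(2) show ?case
    by (cases "reduce w") (auto split: if_splits)
qed simp

section \<open>Values of tensors on words with one cancellation\<close>

text \<open>
  The action of the infinitesimal rotation in the plane of \<open>x\<close> and \<open>y\<close> on a tensor \<open>T\<close>: by the product
  rule, one letter at a time is changed from \<open>x\<close> to \<open>y\<close>, or from \<open>y\<close> to \<open>x\<close> with a sign.
\<close>

fun deriv_word :: "'a \<Rightarrow> 'a \<Rightarrow> ('a list \<Rightarrow> complex) \<Rightarrow> 'a list \<Rightarrow> complex" where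
  "deriv_word x y T [] = 0"
| "deriv_word x y T (a # w) =
     (if a = x then T (y # w) else 0) - (if a = y then T (x # w) else 0)
       + deriv_word x y (\<lambda>v. T (a # v)) w"

lemma deriv_word_append:
  "deriv_word x y T (u @ v) = deriv_word x y (\<lambda>u. T (u @ v)) u + deriv_word x y (\<lambda>v. T (u @ v)) v"
  by (induction u arbitrary: T) auto

lemma deriv_word_swap: "deriv_word x y T w = - deriv_word y x T w"
  by (induction w arbitrary: T) auto

lemma deriv_word_eq_0:
  "(\<And>v. length v = length w \<Longrightarrow> T v = 0) \<Longrightarrow> deriv_word x y T w = 0"
  by (induction w arbitrary: T) auto

text \<open>
  With \<open>y\<close> continued by zero to both sides of \<open>0..l\<close>, the recursion reads
  \<open>N y\<^sub>p + y\<^sub>p\<^sub>-\<^sub>1 + y\<^sub>p\<^sub>+\<^sub>1 = 0\<close>. For \<open>N \<ge> 2\<close> it makes the absolute values grow at least linearly from the left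
  end, which contradicts the boundary condition at the right end unless \<open>y\<^sub>0 = 0\<close>.
\<close>

lemma three_term_recursion_zero:
  fixes y :: "nat \<Rightarrow> complex"
  assumes N: "N \<ge> 2"
    and rec: "\<And>p. p \<le> l \<Longrightarrow>
      of_nat N * y p + (if p > 0 then y (p - 1) else 0) + (if p < l then y (Suc p) else 0) = 0"
  shows "p \<le> l \<Longrightarrow> y p = 0"
proof -
  have ge: "norm (of_nat N * y p) \<ge> 2 * norm (y p)" for p
    using N by (simp add: norm_mult mult_right_mono)
  have grow: "p < l \<Longrightarrow> norm (y (Suc p)) \<ge> norm (y p) + norm (y 0)" for p
  proof (induction p)
    case 0
    then have "y (Suc 0) = - (of_nat N * y 0)"
      using rec[of 0] by (simp add: eq_neg_iff_add_eq_0 add.commute)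
    then show ?case using ge[of 0] by simp
  next
    case (Suc p)
    have "y (Suc (Suc p)) = - (of_nat N * y (Suc p) + y p)"
      using rec[of "Suc p"] Suc.prems unfolding eq_neg_iff_add_eq_0 by (simp add: ac_simps)
    then have "norm (y (Suc (Suc p))) \<ge> norm (of_nat N * y (Suc p)) - norm (y p)"
      by (metis norm_diff_ineq norm_minus_cancel)
    then show ?case using ge[of "Suc p"] Suc.IH Suc.prems by simp
  qed
  have y0: "y 0 = 0"
  proof (cases l)
    case 0
    then show ?thesis using rec[of 0] N by simp
  next
    case (Suc k)
    have "of_nat N * y l = - y k"
      using rec[of l] Suc by (simp add: eq_neg_iff_add_eq_0)
    then have "2 * norm (y l) \<le> norm (y k)" using ge[of l] by simp
    moreover have "norm (y l) \<ge> norm (y k) + norm (y 0)" using grow[of k] Suc by simp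
    ultimately have "norm (y l) + norm (y 0) \<le> 0" by linarith
    then have "norm (y 0) \<le> 0" using norm_ge_zero[of "y l"] by linarith
    then show ?thesis by simp
  qed
  show "p \<le> l \<Longrightarrow> y p = 0"
  proof (induction p rule: less_induct)
    case (less p)
    show ?case
    proof (cases p)
      case 0
      then show ?thesis using y0 by simp
    next
      case (Suc k)
      then have "y k = 0" "k > 0 \<Longrightarrow> y (k - 1) = 0" using less by auto
      then show ?thesis using rec[of k] Suc less.prems by (auto split: if_splits)
    qed
  qed
qed

text \<open>
  A word of length \<open>length g + 2\<close> with value \<open>g\<close> arises from \<open>g\<close> by inserting a pair \<open>aa\<close> into one of its
  gaps; \<open>tau m a\<close> is the value of \<open>T\<close> on the word with the pair after the first \<open>m\<close> letters. Writing
  \<open>g\<^sub>m\<close> for the \<open>m\<close>-th letter, inserting \<open>g\<^sub>m\<close> before or after \<open>g\<^sub>m\<close> gives the same word; its value is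
  \<open>z m\<close>.

  Test the rotation in the plane of \<open>a\<close> and \<open>g\<^sub>m\<close> on the reduced word \<open>g\<^sub>1 \<dots> g\<^sub>m a g\<^sub>m g\<^sub>m\<^sub>+\<^sub>1 \<dots>\<close>. If \<open>a\<close>
  differs from \<open>g\<^sub>m\<close> and \<open>g\<^sub>m\<^sub>+\<^sub>1\<close>, changing a letter after the inserted pair \<open>a g\<^sub>m\<close> never yields the
  value \<open>g\<close>, by a length count, so that \<open>C m a - z m + tau m a = 0\<close>, where \<open>C m a\<close> collects the changes
  in the first \<open>m\<close> letters. For \<open>C\<close> there is a recursion in \<open>m\<close>, because \<open>g\<^sub>1 \<dots> g\<^sub>m a g\<^sub>m \<dots>\<close> with
  \<open>a = g\<^sub>m\<^sub>-\<^sub>1\<close> is the word of the same shape for \<open>m - 1\<close> and the letter \<open>g\<^sub>m\<close>. It follows by induction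
  that \<open>tau m a\<close> has the same value \<open>y m\<close> for all letters \<open>a\<close> different from both neighbours of the
  gap, and that \<open>z m = y (m - 1) + y m\<close>. The contraction over \<open>a\<close> then is the three-term recursion for
  \<open>y\<close>.
\<close>

lemma gap_values_zero:
  fixes T :: "'n::finite list \<Rightarrow> complex"
  assumes N: "CARD('n) \<ge> 2"
    and g: "distinct_adj g"
    and supp: "\<And>w. T w \<noteq> 0 \<Longrightarrow> reduce w = g"
    and deriv: "\<And>x y h. x \<noteq> y \<Longrightarrow> distinct_adj h \<Longrightarrow> length h = length g + 2 \<Longrightarrow> deriv_word x y T h = 0"
    and contr: "\<And>u v. u @ v = g \<Longrightarrow> (\<Sum>a\<in>UNIV. T (u @ [a, a] @ v)) = 0"
    and uv: "u @ v = g"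
  shows "T (u @ [a, a] @ v) = 0"
proof -
  define l where "l = length g"
  define L where "L m = g ! (m - 1)" for m
  define tau where "tau m a = T (take m g @ [a, a] @ drop m g)" for m a
  define z where "z m = tau m (L m)" for m
  define C where "C m a = deriv_word (L m) a (\<lambda>u. T (u @ a # L m # drop m g)) (take m g)" for m a
  obtain b where b: "g \<noteq> [] \<Longrightarrow> b \<noteq> L 1"
  proof -
    have "\<exists>b. b \<noteq> L 1"
    proof (rule ccontr)
      assume "\<not> ?thesis"
      then have "(UNIV :: 'n set) = {L 1}" by auto
      then have "CARD('n) = 1" by (metis card_1_singleton_iff One_nat_def)
      then show False using N by simp
    qed
    then show ?thesis using that by blast
  qed
  define y where "y = rec_nat (tau 0 b) (\<lambda>m r. z (Suc m) - r)"
  have y0: "y 0 = tau 0 b" and yS: "\<And>m. y (Suc m) = z (Suc m) - y m"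
    by (simp_all add: y_def)
  have dropL: "drop (m - 1) g = L m # drop m g" if "0 < m" "m \<le> l" for m
    using that unfolding L_def l_def by (metis Cons_nth_drop_Suc Suc_pred' Suc_le_lessD)
  have takeL: "take m g = take (m - 1) g @ [L m]" if "0 < m" "m \<le> l" for m
    using that unfolding L_def l_def
    by (metis Suc_pred' Suc_le_lessD take_Suc_conv_app_nth)
  have adj: "L m \<noteq> L (Suc m)" if "0 < m" "m < l" for m
    using g that unfolding L_def l_def distinct_adj_conv_nth by (metis Suc_pred' diff_Suc_1 Suc_eq_plus1)
  have z_alt: "tau (m - 1) (L m) = z m" if "0 < m" "m \<le> l" for m
    using takeL[OF that] dropL[OF that] by (simp add: tau_def z_def)
  have da_take: "distinct_adj (take m g)" and da_drop: "distinct_adj (drop m g)" for m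
    using g distinct_adj_append_iff[of "take m g" "drop m g"] by simp_all
  have da_take2: "distinct_adj (take m g @ [a])" if "m > 0 \<Longrightarrow> a \<noteq> L m" "m \<le> l" for m a
  proof (cases "m = 0")
    case False
    then have "last (take m g) = L m" using takeL that by simp
    then show ?thesis using da_take that False by (auto simp: distinct_adj_append_iff)
  qed simp
  have da_drop2: "distinct_adj (a # drop m g)" if "m < l \<Longrightarrow> a \<noteq> L (Suc m)" for m a
  proof (cases "m < l")
    case True
    then have "drop m g = L (Suc m) # drop (Suc m) g" using dropL[of "Suc m"] by simp
    then show ?thesis using da_drop[of m] that True by simp
  qed (simp add: l_def)
  \<comment> \<open>The value of the word is not \<open>g\<close>: otherwise \<open>u\<close> would have the value \<open>take m g @ [a, c]\<close>, a
    reduced word longer than \<open>u\<close>.\<close>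
  have left_zero: "T (u @ c # a # drop m g) = 0"
    if "length u \<le> m" "distinct_adj (take m g @ [a])" "a \<noteq> c" "m \<le> l" for u a c m
  proof (rule ccontr)
    assume "\<not> ?thesis"
    then have "reduce (u @ c # a # drop m g) = reduce (take m g @ drop m g)"
      using supp reduce_distinct_adj[OF g] by simp
    then have "reduce ([] @ (u @ [c, a]) @ drop m g) = reduce ([] @ take m g @ drop m g)" by simp
    then have "reduce (u @ [c, a]) = reduce (take m g)" by (rule reduce_cancel)
    then have "reduce ([] @ (u @ [c, a]) @ [a, c]) = reduce ([] @ take m g @ [a, c])"
      by (rule reduce_append_cong)
    moreover have "reduce ([] @ (u @ [c, a]) @ [a, c]) = reduce u"
      using reduce_append_rev[of u "[c, a]"] by simp
    moreover have "distinct_adj (take m g @ [a, c])"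
      using that by (auto simp: distinct_adj_append_iff)
    ultimately have "reduce u = take m g @ [a, c]" by (simp add: reduce_distinct_adj)
    then show False using length_reduce[of u] that by (simp add: l_def)
  qed
  have right_zero: "T (take m g @ c # a # v) = 0"
    if "length v \<le> length (drop m g)" "distinct_adj (c # drop m g)" "a \<noteq> c" for v a c m
  proof (rule ccontr)
    assume "\<not> ?thesis"
    then have "reduce (take m g @ c # a # v) = reduce (take m g @ drop m g)"
      using supp reduce_distinct_adj[OF g] by simp
    then have "reduce (take m g @ (c # a # v) @ []) = reduce (take m g @ drop m g @ [])" by simp
    then have "reduce (c # a # v) = reduce (drop m g)" by (rule reduce_cancel)
    then have "reduce ([a, c] @ (c # a # v) @ []) = reduce ([a, c] @ drop m g @ [])"
      by (rule reduce_append_cong)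
    moreover have "reduce ([a, c] @ (c # a # v) @ []) = reduce v"
      using reduce_rev_append[of "[c, a]" v] by simp
    moreover have "distinct_adj ([a, c] @ drop m g)"
      using that by (auto simp: distinct_adj_append_iff)
    ultimately have "reduce v = [a, c] @ drop m g" by (simp add: reduce_distinct_adj)
    then show False using length_reduce[of v] that by simp
  qed
  \<comment> \<open>Split off the last letter \<open>g\<^sub>m\<close> of the prefix: changing it gives \<open>tau (m - 1) a\<close>, and changes further
    left matter only if \<open>a = g\<^sub>m\<^sub>-\<^sub>1\<close>, where the sign comes from exchanging the two letters of the plane.\<close>
  have C_rec: "C m a = tau (m - 1) a - (if m > 1 \<and> a = L (m - 1) then C (m - 1) (L m) else 0)"
    if m: "0 < m" "m \<le> l" and a: "a \<noteq> L m" for m a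
  proof -
    let ?D = "deriv_word (L m) a (\<lambda>u. T (u @ L m # a # drop (m - 1) g)) (take (m - 1) g)"
    have "C m a = ?D + tau (m - 1) a"
      using a by (simp add: C_def takeL[OF m] deriv_word_append dropL[OF m, unfolded One_nat_def] tau_def)
    moreover have "?D = - (if m > 1 \<and> a = L (m - 1) then C (m - 1) (L m) else 0)"
    proof (cases "m > 1 \<and> a = L (m - 1)")
      case True
      then show ?thesis by (simp add: C_def deriv_word_swap[of "L m"])
    next
      case False
      have "?D = 0"
      proof (rule deriv_word_eq_0)
        fix w :: "'n list" assume "length w = length (take (m - 1) g)"
        then show "T (w @ L m # a # drop (m - 1) g) = 0"
          using left_zero[of w "m - 1" a "L m"] da_take2[of "m - 1" a] False a m by auto
      qed
      then show ?thesis using False by (simp only: if_False minus_zero)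
    qed
    ultimately show ?thesis by simp
  qed
  have turn: "C m a - z m + tau m a = 0"
    if m: "0 < m" "m \<le> l" and a: "a \<noteq> L m" "m < l \<Longrightarrow> a \<noteq> L (Suc m)" for m a
  proof -
    have "distinct_adj (take m g @ a # L m # drop m g)"
      using da_take2[of m a] a m da_drop2[of "m - 1" "L m"] da_drop[of "m - 1"] dropL[OF m]
      by (auto simp: distinct_adj_append_iff)
    then have "deriv_word (L m) a T (take m g @ a # L m # drop m g) = 0"
      using deriv[of "L m" a] a m by (auto simp: l_def)
    moreover have "deriv_word (L m) a (\<lambda>v. T (take m g @ a # L m # v)) (drop m g) = 0"
    proof (rule deriv_word_eq_0)
      fix v :: "'n list" assume "length v = length (drop m g)"
      then show "T (take m g @ a # L m # v) = 0"
        using right_zero[of v m a "L m"] da_drop2[of m a] a by auto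
    qed
    ultimately show ?thesis
      using a by (simp add: deriv_word_append C_def z_def tau_def algebra_simps)
  qed
  \<comment> \<open>The start of the induction, from the reduced word \<open>c d g\<^sub>1 g\<^sub>2 \<dots>\<close>; the choice of \<open>b\<close> in the
    definition of \<open>y 0\<close> is therefore immaterial.\<close>
  have swap0: "tau 0 c = tau 0 d" if "g \<noteq> [] \<Longrightarrow> c \<noteq> L 1" "g \<noteq> [] \<Longrightarrow> d \<noteq> L 1" for c d
  proof (cases "c = d")
    case False
    have da: "distinct_adj (c # g)" "distinct_adj (d # g)"
      using da_drop2[of 0 c] da_drop2[of 0 d] that by (auto simp: l_def)
    then have "deriv_word c d T ([c, d] @ g) = 0"
      using deriv[of c d "[c, d] @ g"] False by simp
    moreover have "deriv_word c d (\<lambda>v. T (c # d # v)) g = 0"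
    proof (rule deriv_word_eq_0)
      fix v :: "'n list" assume "length v = length g"
      then show "T (c # d # v) = 0" using right_zero[of v 0 c d] da False by auto
    qed
    ultimately show ?thesis using False by (simp add: tau_def)
  qed simp
  have main: "(\<forall>a. (m > 0 \<longrightarrow> a \<noteq> L m) \<longrightarrow> (m < l \<longrightarrow> a \<noteq> L (Suc m)) \<longrightarrow> tau m a = y m) \<and>
     (m > 0 \<longrightarrow> (\<forall>a. a \<noteq> L m \<longrightarrow> C m a = y (m - 1)))" if "m \<le> l" for m
    using that
  proof (induction m)
    case 0
    then show ?case using swap0 b y0 by (auto simp: l_def)
  next
    case (Suc m)
    have C: "C (Suc m) a = y m" if a: "a \<noteq> L (Suc m)" for a
    proof (cases "m > 0 \<and> a = L m")
      case True
      then have "C m (L (Suc m)) = y (m - 1)" using Suc adj[of m] by fastforce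
      then show ?thesis using C_rec[of "Suc m" a] Suc.prems True a yS[of "m - 1"] z_def by simp
    next
      case False
      then have "tau m a = y m" using Suc a by auto
      then show ?thesis using C_rec[of "Suc m" a] Suc.prems False a by auto
    qed
    have "tau (Suc m) a = y (Suc m)"
      if "a \<noteq> L (Suc m)" "Suc m < l \<Longrightarrow> a \<noteq> L (Suc (Suc m))" for a
      using turn[of "Suc m" a] that Suc.prems C[of a] yS[of m]
      by (simp add: diff_eq_eq add_eq_0_iff2)
    then show ?case using C by auto
  qed
  have tau_eq: "tau p a = y p + (if a = L p then if p > 0 then y (p - 1) else 0 else 0)
      + (if a = L (Suc p) then if p < l then y (Suc p) else 0 else 0)" if p: "p \<le> l" for p a
  proof -
    consider "p > 0" "a = L p" | "p < l" "a = L (Suc p)" "\<not> (p > 0 \<and> a = L p)"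
      | "p > 0 \<Longrightarrow> a \<noteq> L p" "p < l \<Longrightarrow> a \<noteq> L (Suc p)" by blast
    then show ?thesis
    proof cases
      case 1
      then show ?thesis using yS[of "p - 1"] adj[of p] z_def by auto
    next
      case 2
      then show ?thesis using yS[of p] z_alt[of "Suc p"] by auto
    next
      case 3
      then show ?thesis using main[OF p] by auto
    qed
  qed
  have y_zero: "p \<le> l \<Longrightarrow> y p = 0" for p
  proof (rule three_term_recursion_zero[OF N])
    fix p assume p: "p \<le> l"
    have "(\<Sum>a\<in>UNIV. tau p a) = 0"
      unfolding tau_def using contr[of "take p g" "drop p g"] by simp
    then show "of_nat CARD('n) * y p + (if p > 0 then y (p - 1) else 0)
        + (if p < l then y (Suc p) else 0) = 0"
      unfolding tau_eq[OF p] by (simp add: sum.distrib)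
  qed
  have "tau p a = 0" if "p \<le> l" for p a
    using that y_zero by (subst tau_eq) auto
  moreover have "u = take (length u) g" "v = drop (length u) g" "length u \<le> l"
    using uv by (auto simp: l_def)
  ultimately show ?thesis unfolding tau_def by metis
qed

section \<open>Orthogonal matrices acting on tensors\<close>

definition words :: "nat \<Rightarrow> 'a list set" where
  "words n = {w. length w = n}"

lemma finite_words [simp]: "finite (words n :: 'a::finite list set)"
  using finite_lists_length_eq[of "UNIV :: 'a set" n] by (simp add: words_def)

lemma in_words [simp]: "w \<in> words n \<longleftrightarrow> length w = n"
  by (simp add: words_def)

lemma words_0 [simp]: "words 0 = {[]}"
  by (auto simp: words_def)

lemma sum_words_Suc:
  fixes f :: "'a::finite list \<Rightarrow> 'b::comm_monoid_add"
  shows "(\<Sum>w\<in>words (Suc n). f w) = (\<Sum>a\<in>UNIV. \<Sum>w\<in>words n. f (a # w))"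
proof -
  have "words (Suc n) = (\<lambda>(a, w). a # w) ` (UNIV \<times> (words n :: 'a list set))"
    by (auto simp: words_def length_Suc_conv image_iff)
  moreover have "inj_on (\<lambda>(a, w). a # w) (UNIV \<times> (words n :: 'a list set))"
    by (auto simp: inj_on_def)
  ultimately show ?thesis
    by (simp add: sum.reindex sum.cartesian_product case_prod_unfold)
qed

text \<open>
  The matrix entry of \<open>M \<otimes> \<dots> \<otimes> M\<close> at two words of equal length.
\<close>

definition tensor_coeff :: "('a \<Rightarrow> 'a \<Rightarrow> complex) \<Rightarrow> 'a list \<Rightarrow> 'a list \<Rightarrow> complex" where
  "tensor_coeff M w v = prod_list (map2 M w v)"

lemma tensor_coeff_simps [simp]:
  "tensor_coeff M [] v = 1"
  "tensor_coeff M (a # w) (b # v) = M a b * tensor_coeff M w v"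
  by (simp_all add: tensor_coeff_def)

definition word_act :: "('a \<Rightarrow> 'a \<Rightarrow> complex) \<Rightarrow> ('a list \<Rightarrow> complex) \<Rightarrow> 'a list \<Rightarrow> complex" where
  "word_act M T w = (\<Sum>v\<in>words (length w). tensor_coeff M w v * T v)"

lemma word_act_Nil [simp]: "word_act M T [] = T []"
  by (simp add: word_act_def)

lemma word_act_Cons:
  fixes T :: "'a::finite list \<Rightarrow> complex"
  shows "word_act M T (a # w) = (\<Sum>b\<in>UNIV. M a b * word_act M (\<lambda>v. T (b # v)) w)"
  by (simp add: word_act_def sum_words_Suc sum_distrib_left mult.assoc)

lemma word_act_sum:
  "word_act M (\<lambda>v. \<Sum>i\<in>A. F i v) w = (\<Sum>i\<in>A. word_act M (F i) w)"
  unfolding word_act_def by (simp add: sum_distrib_left) (rule sum.swap)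

lemma word_act_cong:
  "(\<And>v. length v = length w \<Longrightarrow> T v = T' v) \<Longrightarrow> word_act M T w = word_act M T' w"
  unfolding word_act_def by (rule sum.cong) (auto simp: words_def)

lemma word_act_id:
  fixes T :: "'a::finite list \<Rightarrow> complex"
  assumes "\<And>a b. M a b = (if a = b then 1 else 0)"
  shows "word_act M T w = T w"
proof (induction w arbitrary: T)
  case (Cons a w)
  have "(\<Sum>b\<in>UNIV. M a b * T (b # w)) = (\<Sum>b\<in>UNIV. if a = b then T (b # w) else 0)"
    by (rule sum.cong) (auto simp: assms)
  then show ?case by (simp add: word_act_Cons Cons)
qed simp

text \<open>
  Orthonormality of the columns says that \<open>M \<otimes> M\<close> preserves the pairing with the sum of all
  \<open>e\<^sub>k \<otimes> e\<^sub>k\<close>, which is how two adjacent tensor factors are contracted.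
\<close>

lemma word_act_contraction:
  fixes T :: "'a::finite list \<Rightarrow> complex"
  assumes M: "\<And>a b. (\<Sum>k\<in>UNIV. M k a * M k b) = (if a = b then 1 else 0)"
    and T: "\<And>u' v'. length u' = length u \<Longrightarrow> length v' = length v \<Longrightarrow> (\<Sum>k\<in>UNIV. T (u' @ [k, k] @ v')) = 0"
  shows "(\<Sum>k\<in>UNIV. word_act M T (u @ [k, k] @ v)) = 0"
  using T
proof (induction u arbitrary: T)
  case Nil
  have "(\<Sum>k\<in>UNIV. word_act M T ([] @ [k, k] @ v))
      = (\<Sum>k\<in>UNIV. \<Sum>a\<in>UNIV. \<Sum>b\<in>UNIV. M k a * M k b * word_act M (\<lambda>v. T (a # b # v)) v)"
    by (simp add: word_act_Cons sum_distrib_left mult.assoc)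
  also have "\<dots> = (\<Sum>a\<in>UNIV. \<Sum>b\<in>UNIV. \<Sum>k\<in>UNIV. M k a * M k b * word_act M (\<lambda>v. T (a # b # v)) v)"
    by (subst sum.swap, rule sum.cong[OF refl], rule sum.swap)
  also have "\<dots> = (\<Sum>a\<in>UNIV. \<Sum>b\<in>UNIV. (if a = b then word_act M (\<lambda>v. T (a # b # v)) v else 0))"
    by (simp add: sum_distrib_right[symmetric] M mult_delta_left)
  also have "\<dots> = word_act M (\<lambda>v. \<Sum>a\<in>UNIV. T (a # a # v)) v"
    by (simp add: word_act_sum)
  also have "\<dots> = word_act M (\<lambda>v. 0) v"
    by (rule word_act_cong) (use Nil in \<open>simp\<close>)
  finally show ?case by (simp add: word_act_def)
next
  case (Cons c u)
  have "(\<Sum>k\<in>UNIV. word_act M T ((c # u) @ [k, k] @ v))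
      = (\<Sum>b\<in>UNIV. M c b * (\<Sum>k\<in>UNIV. word_act M (\<lambda>v. T (b # v)) (u @ [k, k] @ v)))"
    by (simp add: word_act_Cons sum_distrib_left) (rule sum.swap)
  also have "\<dots> = 0"
  proof (intro sum.neutral ballI)
    fix b
    have "(\<Sum>k\<in>UNIV. word_act M (\<lambda>v. T (b # v)) (u @ [k, k] @ v)) = 0"
      by (rule Cons.IH) (use Cons.prems[of "b # _"] in simp)
    then show "M c b * (\<Sum>k\<in>UNIV. word_act M (\<lambda>v. T (b # v)) (u @ [k, k] @ v)) = 0" by simp
  qed
  finally show ?case .
qed

abbreviation cmatrix :: "real^'n^'n \<Rightarrow> 'n \<Rightarrow> 'n \<Rightarrow> complex" where
  "cmatrix Q i j \<equiv> complex_of_real (Q $ i $ j)"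

lemma orthogonal_matrix_columns:
  fixes Q :: "real^'n^'n"
  assumes "orthogonal_matrix Q"
  shows "(\<Sum>k\<in>UNIV. cmatrix Q k a * cmatrix Q k b) = (if a = b then 1 else 0)"
proof -
  have "(transpose Q ** Q) $ a $ b = (mat 1 :: real^'n^'n) $ a $ b"
    using assms by (simp add: orthogonal_matrix)
  then have "(\<Sum>k\<in>UNIV. Q $ k $ a * Q $ k $ b) = (if a = b then 1 else 0)"
    by (simp add: matrix_matrix_mult_def transpose_def mat_def)
  then have "complex_of_real (\<Sum>k\<in>UNIV. Q $ k $ a * Q $ k $ b) = (if a = b then 1 else 0)"
    by simp
  then show ?thesis by simp
qed

definition plane_rotation :: "'n \<Rightarrow> 'n \<Rightarrow> real \<Rightarrow> real^'n^'n" where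
  "plane_rotation x y t = (\<chi> a b.
     if a = x then (if b = x then cos t else if b = y then sin t else 0)
     else if a = y then (if b = x then - sin t else if b = y then cos t else 0)
     else if a = b then 1 else 0)"

lemma orthogonal_plane_rotation:
  fixes x y :: "'n::finite"
  assumes "x \<noteq> y"
  shows "orthogonal_matrix (plane_rotation x y t)"
proof -
  let ?R = "plane_rotation x y t"
  have row: "(\<Sum>k\<in>UNIV. f k * ?R $ a $ k) = (if a = x then f x * cos t + f y * sin t
      else if a = y then f y * cos t - f x * sin t else f a)" for a and f :: "'n \<Rightarrow> real"
  proof -
    have "f k * ?R $ a $ k = (if a = x then (if k = x then f x * cos t else 0) + (if k = y then f y * sin t else 0)
      else if a = y then (if k = y then f y * cos t else 0) - (if k = x then f x * sin t else 0)
      else if k = a then f a else 0)" for k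
      using assms by (auto simp: plane_rotation_def)
    then show ?thesis by (simp add: sum.distrib sum_subtractf)
  qed
  have "?R ** transpose ?R = mat 1"
  proof (intro vec_eq_iff[THEN iffD2] allI)
    fix a b
    have "(?R ** transpose ?R) $ a $ b = (\<Sum>k\<in>UNIV. ?R $ a $ k * ?R $ b $ k)"
      by (simp add: matrix_matrix_mult_def transpose_def)
    also have "\<dots> = (mat 1 :: real^'n^'n) $ a $ b"
      unfolding row using assms sin_cos_squared_add3[of t]
      by (auto simp: plane_rotation_def mat_def algebra_simps)
    finally show "(?R ** transpose ?R) $ a $ b = (mat 1 :: real^'n^'n) $ a $ b" .
  qed
  then show ?thesis by (simp add: orthogonal_matrix_def matrix_left_right_inverse)
qed

lemma word_act_plane_rotation_derivative:
  fixes T :: "'n::finite list \<Rightarrow> complex"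
  assumes "x \<noteq> y"
  shows "((\<lambda>t. word_act (cmatrix (plane_rotation x y t)) T w) has_vector_derivative deriv_word x y T w) (at 0)"
proof (induction w arbitrary: T)
  case Nil
  show ?case by simp
next
  case (Cons a w)
  define d where "d b = (if a = x \<and> b = y then 1 else if a = y \<and> b = x then -1 else 0 :: complex)" for b
  have M: "((\<lambda>t. cmatrix (plane_rotation x y t) a b) has_vector_derivative d b) (at 0)" for b
  proof -
    have "((\<lambda>t. plane_rotation x y t $ a $ b) has_real_derivative Re (d b)) (at 0)"
      using assms unfolding plane_rotation_def d_def
      by (cases "a = x"; cases "a = y"; cases "b = x"; cases "b = y"; cases "a = b")
        (auto intro!: derivative_eq_intros)
    then have "((\<lambda>t. cmatrix (plane_rotation x y t) a b) has_vector_derivative of_real (Re (d b))) (at 0)"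
      by (intro has_vector_derivative_of_real) (simp add: has_real_derivative_iff_has_vector_derivative)
    moreover have "of_real (Re (d b)) = d b" by (simp add: d_def)
    ultimately show ?thesis by simp
  qed
  have M0: "cmatrix (plane_rotation x y 0) c b = (if c = b then 1 else 0)" for c b
    using assms by (simp add: plane_rotation_def)
  have "((\<lambda>t. word_act (cmatrix (plane_rotation x y t)) T (a # w)) has_vector_derivative
     (\<Sum>b\<in>UNIV. cmatrix (plane_rotation x y 0) a b * deriv_word x y (\<lambda>v. T (b # v)) w
        + d b * word_act (cmatrix (plane_rotation x y 0)) (\<lambda>v. T (b # v)) w)) (at 0)"
    unfolding word_act_Cons
    by (intro has_vector_derivative_sum has_vector_derivative_mult M Cons.IH)
  moreover have "(\<Sum>b\<in>UNIV. cmatrix (plane_rotation x y 0) a b * deriv_word x y (\<lambda>v. T (b # v)) w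
        + d b * word_act (cmatrix (plane_rotation x y 0)) (\<lambda>v. T (b # v)) w) = deriv_word x y T (a # w)"
  proof -
    have 1: "(\<Sum>b\<in>UNIV. (if a = b then 1 else 0) * deriv_word x y (\<lambda>v. T (b # v)) w)
       = deriv_word x y (\<lambda>v. T (a # v)) w"
      by (simp add: mult_delta_left)
    have "(\<Sum>b\<in>UNIV. d b * T (b # w)) = (\<Sum>b\<in>UNIV. (if b = y then if a = x then T (y # w) else 0 else 0)
       - (if b = x then if a = y then T (x # w) else 0 else 0))"
      using assms by (intro sum.cong) (auto simp: d_def)
    also have "\<dots> = (if a = x then T (y # w) else 0) - (if a = y then T (x # w) else 0)"
      by (simp add: sum_subtractf)
    finally show ?thesis
      unfolding sum.distrib using 1 by (simp add: word_act_id M0)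
  qed
  ultimately show ?case by simp
qed

text \<open>
  The hypothesis makes the function \<open>t \<mapsto> (R\<^sub>t \<otimes> \<dots> \<otimes> R\<^sub>t) T\<close>, evaluated at \<open>w\<close>, constant, where \<open>R\<^sub>t\<close> are
  the rotations in the plane of \<open>x\<close> and \<open>y\<close>; the conclusion is its derivative at \<open>t = 0\<close>.
\<close>

lemma deriv_word_zero:
  fixes T :: "'n::finite list \<Rightarrow> complex"
  assumes "x \<noteq> y" and "\<And>Q. orthogonal_matrix Q \<Longrightarrow> word_act (cmatrix Q) T w = 0"
  shows "deriv_word x y T w = 0"
proof -
  have "((\<lambda>t::real. 0 :: complex) has_vector_derivative deriv_word x y T w) (at 0)"
    using word_act_plane_rotation_derivative[OF assms(1), of T w]
      assms(2)[OF orthogonal_plane_rotation[OF assms(1)]] by simp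
  then show ?thesis using vector_derivative_unique_at has_vector_derivative_const by blast
qed

section \<open>Irreducibility of the top component\<close>

text \<open>
  The induction passes from \<open>U\<close> to the space \<open>L\<close> spanned by the slices \<open>T(a, -)\<close> of its members. It is
  invariant again, because the first tensor factor can be moved along with the others, and its members
  vanish on reduced words: if \<open>w\<close> is reduced but \<open>a # w\<close> is not, then \<open>a # w = a # a # v\<close> has a single
  cancellation, and the part of \<open>T\<close> on words with value \<open>v\<close>, which lies in \<open>U\<close>, vanishes there by
  \<open>gap_values_zero\<close>.
\<close>

lemma invariant_subspace_zero:
  fixes U :: "('n::finite list \<Rightarrow> complex) set"
  assumes N: "CARD('n) \<ge> 2"
    and cong: "\<And>S T. T \<in> U \<Longrightarrow> (\<And>w. length w = k \<Longrightarrow> S w = T w) \<Longrightarrow> S \<in> U"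
    and add: "\<And>S T. S \<in> U \<Longrightarrow> T \<in> U \<Longrightarrow> (\<lambda>w. S w + T w) \<in> U"
    and scale: "\<And>c T. T \<in> U \<Longrightarrow> (\<lambda>w. c * T w) \<in> U"
    and act: "\<And>Q T. orthogonal_matrix Q \<Longrightarrow> T \<in> U \<Longrightarrow> word_act (cmatrix Q) T \<in> U"
    and grade: "\<And>g T. T \<in> U \<Longrightarrow> (\<lambda>w. if reduce w = g then T w else 0) \<in> U"
    and contr: "\<And>T u v. T \<in> U \<Longrightarrow> length u + length v + 2 = k \<Longrightarrow> (\<Sum>a\<in>UNIV. T (u @ [a, a] @ v)) = 0"
    and top: "\<And>T w. T \<in> U \<Longrightarrow> length w = k \<Longrightarrow> distinct_adj w \<Longrightarrow> T w = 0"
    and T: "T \<in> U" and w: "length w = k"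
  shows "T w = 0"
  using cong add scale act grade contr top T w
proof (induction k arbitrary: U T w)
  case 0
  then show ?case by simp
next
  case (Suc k)
  note cong = Suc.prems(1) and add = Suc.prems(2) and scale = Suc.prems(3) and act = Suc.prems(4)
    and grade = Suc.prems(5) and contr = Suc.prems(6) and top = Suc.prems(7)
  have zero: "(\<lambda>w. 0) \<in> U" using scale[OF Suc.prems(8), of 0] by simp
  have sum_closed: "(\<lambda>w. \<Sum>i\<in>A. F i w) \<in> U" if "\<And>i. F i \<in> U" "finite A" for F and A :: "'n set"
    using that(2) by (induction A rule: finite_induct) (auto simp: zero intro!: add that(1))
  have near: "S (a # w) = 0" if S: "S \<in> U" and w: "length w = k" "distinct_adj w" for S a w
  proof (cases "distinct_adj (a # w)")
    case True
    then show ?thesis using top[OF S] w by simp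
  next
    case False
    then obtain v where v: "w = a # v" using w by (cases w) auto
    then have dv: "distinct_adj v" using w by (cases v) auto
    let ?S = "\<lambda>w. if reduce w = v then S w else 0"
    have S': "?S \<in> U" by (rule grade[OF S])
    have "?S ([] @ [a, a] @ v) = 0"
    proof (rule gap_values_zero[OF N dv])
      show "reduce w = v" if "?S w \<noteq> 0" for w
        using that by (auto split: if_splits)
      show "deriv_word x y ?S h = 0"
        if "x \<noteq> y" "distinct_adj h" "length h = length v + 2" for x y h
      proof (rule deriv_word_zero[OF that(1)])
        fix Q :: "real^'n^'n" assume "orthogonal_matrix Q"
        then show "word_act (cmatrix Q) ?S h = 0"
          using act[OF _ S'] top that(2,3) w v by auto
      qed
      show "(\<Sum>a\<in>UNIV. ?S (u @ [a, a] @ v')) = 0" if "u @ v' = v" for u v'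
        using contr[OF S', of u v'] that w v by auto
    qed simp
    then show ?thesis
      using reduce_insert_pair[of "[]" a v] reduce_distinct_adj[OF dv] v by simp
  qed
  define L where "L = {S. \<exists>F. (\<forall>a. F a \<in> U) \<and> (\<forall>w. length w = k \<longrightarrow> S w = (\<Sum>a\<in>UNIV. F a (a # w)))}"
  have LI: "S \<in> L" if "\<And>a. F a \<in> U" "\<And>w. length w = k \<Longrightarrow> S w = (\<Sum>a\<in>UNIV. F a (a # w))" for S F
    using that unfolding L_def by blast
  have L_zero: "S v = 0" if S: "S \<in> L" and v: "length v = k" for S v
  proof (rule Suc.IH[of L])
    show "S' \<in> L" if "S \<in> L" "\<And>w. length w = k \<Longrightarrow> S' w = S w" for S S'
      using that unfolding L_def by force
    show "(\<lambda>w. S w + S' w) \<in> L" if S: "S \<in> L" and S': "S' \<in> L" for S S'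
    proof -
      obtain F where F: "\<And>a. F a \<in> U" "\<And>w. length w = k \<Longrightarrow> S w = (\<Sum>a\<in>UNIV. F a (a # w))"
        using S unfolding L_def by blast
      obtain F' where F': "\<And>a. F' a \<in> U" "\<And>w. length w = k \<Longrightarrow> S' w = (\<Sum>a\<in>UNIV. F' a (a # w))"
        using S' unfolding L_def by blast
      show ?thesis
        by (rule LI[of "\<lambda>a w. F a w + F' a w"]) (auto intro: add F F' simp: F F' sum.distrib)
    qed
    show "(\<lambda>w. c * S w) \<in> L" if S: "S \<in> L" for c S
    proof -
      obtain F where F: "\<And>a. F a \<in> U" "\<And>w. length w = k \<Longrightarrow> S w = (\<Sum>a\<in>UNIV. F a (a # w))"
        using S unfolding L_def by blast
      show ?thesis
        by (rule LI[of "\<lambda>a w. c * F a w"]) (auto intro: scale F simp: F sum_distrib_left)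
    qed
    \<comment> \<open>Rotating only the last \<open>k\<close> factors amounts to rotating all of them and undoing this in the first
      factor, which is a linear combination of slices.\<close>
    show "word_act (cmatrix Q) S \<in> L" if Q: "orthogonal_matrix Q" and S: "S \<in> L" for Q S
    proof -
      obtain F where F: "\<And>a. F a \<in> U" "\<And>w. length w = k \<Longrightarrow> S w = (\<Sum>a\<in>UNIV. F a (a # w))"
        using S unfolding L_def by blast
      show ?thesis
      proof (rule LI[of "\<lambda>a w. \<Sum>b\<in>UNIV. cmatrix Q a b * word_act (cmatrix Q) (F b) w"])
        show "(\<lambda>w. \<Sum>b\<in>UNIV. cmatrix Q a b * word_act (cmatrix Q) (F b) w) \<in> U" for a
          by (intro sum_closed scale act Q F) simp
        fix w :: "'n list" assume w: "length w = k"
        let ?A = "\<lambda>b c. word_act (cmatrix Q) (\<lambda>v. F b (c # v)) w"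
        have "(\<Sum>a\<in>UNIV. \<Sum>b\<in>UNIV. cmatrix Q a b * word_act (cmatrix Q) (F b) (a # w))
          = (\<Sum>a\<in>UNIV. \<Sum>b\<in>UNIV. \<Sum>c\<in>UNIV. cmatrix Q a b * cmatrix Q a c * ?A b c)"
          by (simp add: word_act_Cons sum_distrib_left mult.assoc)
        also have "\<dots> = (\<Sum>b\<in>UNIV. \<Sum>c\<in>UNIV. \<Sum>a\<in>UNIV. cmatrix Q a b * cmatrix Q a c * ?A b c)"
          by (subst sum.swap, rule sum.cong[OF refl], rule sum.swap)
        also have "\<dots> = (\<Sum>b\<in>UNIV. \<Sum>c\<in>UNIV. (if b = c then ?A b c else 0))"
          by (simp add: sum_distrib_right[symmetric] orthogonal_matrix_columns[OF Q] mult_delta_left)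
        also have "\<dots> = word_act (cmatrix Q) S w"
          by (simp add: word_act_sum[symmetric])
            (rule word_act_cong, simp add: F w)
        finally show "word_act (cmatrix Q) S w
          = (\<Sum>a\<in>UNIV. \<Sum>b\<in>UNIV. cmatrix Q a b * word_act (cmatrix Q) (F b) (a # w))" by simp
      qed
    qed
    show "(\<lambda>w. if reduce w = g then S w else 0) \<in> L" if S: "S \<in> L" for g S
    proof -
      obtain F where F: "\<And>a. F a \<in> U" "\<And>w. length w = k \<Longrightarrow> S w = (\<Sum>a\<in>UNIV. F a (a # w))"
        using S unfolding L_def by blast
      have iff: "reduce (a # w) = reduce (a # g) \<longleftrightarrow> reduce w = reduce g" for a w
        using reduce_cancel[of "[a]" w "[]" g] by (auto simp: reduce_Cons)
      show ?thesis
      proof (cases "distinct_adj g")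
        case True
        then have "reduce g = g" by (rule reduce_distinct_adj)
        then show ?thesis
          by (intro LI[of "\<lambda>a w. if reduce w = reduce (a # g) then F a w else 0"] grade F)
            (auto simp: iff F)
      next
        case False
        then have "reduce w \<noteq> g" for w using distinct_adj_reduce by metis
        then show ?thesis by (intro LI[of "\<lambda>a w. 0"] zero) simp
      qed
    qed
    show "(\<Sum>a\<in>UNIV. S (u @ [a, a] @ v)) = 0" if S: "S \<in> L" and uv: "length u + length v + 2 = k" for S u v
    proof -
      obtain F where F: "\<And>a. F a \<in> U" "\<And>w. length w = k \<Longrightarrow> S w = (\<Sum>a\<in>UNIV. F a (a # w))"
        using S unfolding L_def by blast
      have "(\<Sum>a\<in>UNIV. S (u @ [a, a] @ v)) = (\<Sum>b\<in>UNIV. \<Sum>a\<in>UNIV. F b ((b # u) @ [a, a] @ v))"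
        using uv by (subst sum.swap) (simp add: F)
      also have "\<dots> = 0"
      proof (rule sum.neutral, rule ballI)
        show "(\<Sum>a\<in>UNIV. F b ((b # u) @ [a, a] @ v)) = 0" for b
          using contr[OF F(1), of "b # u" v] uv by simp
      qed
      finally show ?thesis .
    qed
    show "S w = 0" if S: "S \<in> L" and w: "length w = k" "distinct_adj w" for S w
    proof -
      obtain F where F: "\<And>a. F a \<in> U" "\<And>w. length w = k \<Longrightarrow> S w = (\<Sum>a\<in>UNIV. F a (a # w))"
        using S unfolding L_def by blast
      then show ?thesis using near[OF F(1) w] w by simp
    qed
  qed (use S v in auto)
  obtain a v where w: "w = a # v" "length v = k" using Suc.prems(9) by (cases w) auto
  have "(\<lambda>v. T (a # v)) \<in> L"
  proof (rule LI[of "\<lambda>b w. if b = a then T w else 0"])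
    show "(\<lambda>w. if b = a then T w else 0) \<in> U" for b
      by (cases "b = a") (simp_all add: Suc.prems(8) zero)
  qed simp
  then show ?case using L_zero w by blast
qed

section \<open>Orthogonal projection of finite linear combinations\<close>

abbreviation pm_scale :: "complex \<Rightarrow> ('k \<Rightarrow>\<^sub>0 complex) \<Rightarrow> 'k \<Rightarrow>\<^sub>0 complex" where
  "pm_scale c f \<equiv> Poly_Mapping.map ((*) c) f"

lemma lookup_pm_scale [simp]: "lookup (pm_scale c f) k = c * lookup f k"
  by (simp add: Poly_Mapping.map.rep_eq when_def)

global_interpretation pm: vector_space pm_scale
  by unfold_locales (auto intro!: poly_mapping_eqI simp: lookup_add algebra_simps)

text \<open>
  Gram-Schmidt: the projection onto the span of one more vector \<open>g\<close> uses the component \<open>h\<close> of \<open>g\<close>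
  orthogonal to the previous ones.
\<close>

lemma orthogonal_projection_span:
  fixes W :: "'k set" and G :: "('k \<Rightarrow>\<^sub>0 complex) set"
  assumes "finite W" "finite G" "\<And>g. g \<in> G \<Longrightarrow> keys g \<subseteq> W"
  shows "\<exists>s \<in> pm.span G. \<forall>g\<in>G. (\<Sum>w\<in>W. lookup (f - s) w * cnj (lookup g w)) = 0"
  using assms(2,3)
proof (induction G arbitrary: f rule: finite_induct)
  case empty
  then show ?case by (auto intro: pm.span_zero)
next
  case (insert g G)
  define ip where "ip f g = (\<Sum>w\<in>W. lookup f w * cnj (lookup g w))"
    for f g :: "'k \<Rightarrow>\<^sub>0 complex"
  have ip_diff: "ip (f - h) x = ip f x - ip h x" and ip_scale: "ip (pm_scale c f) x = c * ip f x"
    and ip_add: "ip f (x + y) = ip f x + ip f y" and ip_scale2: "ip f (pm_scale c x) = cnj c * ip f x"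
    and ip_zero: "ip f 0 = 0" and ip_cnj: "ip x f = cnj (ip f x)" for f h x y c
    by (simp_all add: ip_def lookup_minus lookup_add algebra_simps sum_subtractf sum.distrib sum_distrib_left)
  have ip_span: "ip f x = 0" if "x \<in> pm.span G" "\<forall>g\<in>G. ip f g = 0" for f x
    using that(1)
  proof (induction rule: pm.span_induct_alt)
    case base
    then show ?case by (simp add: ip_zero)
  next
    case (step c x y)
    then show ?case using that(2) by (simp add: ip_add ip_scale2)
  qed
  have IH: "\<exists>s \<in> pm.span G. \<forall>g\<in>G. ip (f - s) g = 0" for f
    unfolding ip_def using insert by simp
  obtain p where p: "p \<in> pm.span G" "\<forall>x\<in>G. ip (g - p) x = 0" using IH by blast
  obtain s where s: "s \<in> pm.span G" "\<forall>x\<in>G. ip (f - s) x = 0" using IH by blast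
  have sub: "pm.span G \<subseteq> pm.span (insert g G)" by (rule pm.span_mono) auto
  define h where "h = g - p"
  have g: "g = h + p" by (simp add: h_def)
  have "\<exists>s \<in> pm.span (insert g G). \<forall>x\<in>insert g G. ip (f - s) x = 0"
  proof (cases "ip h h = 0")
    case True
    have "keys p \<subseteq> W"
      using p(1)
    proof (induction rule: pm.span_induct_alt)
      case (step c x y)
      have "keys (pm_scale c x) \<subseteq> W"
        using insert.prems step by (force simp: in_keys_iff subset_iff)
      then show ?case using step Poly_Mapping.keys_add[of "pm_scale c x" y] by blast
    qed simp
    then have keys: "keys h \<subseteq> W"
      unfolding h_def using insert.prems keys_diff[of g p] by blast
    have "(\<Sum>w\<in>W. (cmod (lookup h w))\<^sup>2) = 0"
    proof -
      have "complex_of_real (\<Sum>w\<in>W. (cmod (lookup h w))\<^sup>2) = ip h h"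
        by (simp add: ip_def complex_norm_square del: of_real_power)
      then show ?thesis using True of_real_eq_0_iff by metis
    qed
    then have "\<forall>w\<in>W. lookup h w = 0"
      using assms(1) by (simp add: sum_nonneg_eq_0_iff)
    then have "h = 0" using keys by (intro poly_mapping_eqI) (auto simp: in_keys_iff)
    then have "g \<in> pm.span G" using p g by simp
    then have "ip (f - s) g = 0" using ip_span s by blast
    then show ?thesis using s sub by blast
  next
    case False
    define c where "c = ip (f - s) h / ip h h"
    have "g \<in> pm.span (insert g G)" by (rule pm.span_base) simp
    then have "s + pm_scale c h \<in> pm.span (insert g G)"
      unfolding h_def using s p sub by (intro pm.span_add pm.span_scale pm.span_diff) auto
    moreover have eq: "f - (s + pm_scale c h) = (f - s) - pm_scale c h" by simp
    have G0: "\<forall>x\<in>G. ip (f - (s + pm_scale c h)) x = 0"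
      unfolding eq ip_diff[of "f - s"] using s p by (simp add: ip_scale h_def)
    moreover have "ip (f - (s + pm_scale c h)) g = 0"
    proof -
      have "ip (f - (s + pm_scale c h)) h = 0"
        unfolding eq ip_diff[of "f - s"] using False by (simp add: ip_scale c_def)
      moreover have "ip (f - (s + pm_scale c h)) p = 0" using ip_span p(1) G0 by blast
      ultimately show ?thesis unfolding g by (simp add: ip_add)
    qed
    ultimately show ?thesis by blast
  qed
  then show ?case unfolding ip_def .
qed

section \<open>Translations of noncommutative polynomials\<close>

text \<open>
  The reflection in the hyperplane orthogonal to \<open>v\<close> works if no entry of \<open>v\<close> vanishes and no square of
  an entry is half of the squared norm. One entry is taken to be the square root of \<open>N\<close> and the others
  \<open>1\<close>: the squared norm \<open>2 N - 1\<close> then differs from \<open>2\<close> and from \<open>2 N\<close> for all \<open>N \<ge> 2\<close>, whereas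
  the choice of all entries equal fails for \<open>N = 2\<close>.
\<close>

lemma orthogonal_matrix_no_zero_entry:
  assumes "CARD('n::finite) \<ge> 2"
  obtains Q :: "real^'n^'n" where "orthogonal_matrix Q" "\<And>i j. Q $ i $ j \<noteq> 0"
proof -
  define m where "m = real CARD('n)"
  have m: "m \<ge> 2" using assms by (simp add: m_def)
  fix i0 :: 'n
  define v where "v i = (if i = i0 then sqrt m else 1)" for i
  define c where "c = 2 / (2 * m - 1)"
  have "2 * m - 1 \<noteq> 0" using m by simp
  then have c: "c * (2 * m - 1) = 2" unfolding c_def by (metis nonzero_divide_eq_eq)
  have "(\<Sum>k\<in>UNIV. v k * v k) = (\<Sum>k\<in>UNIV. 1 + (if k = i0 then m - 1 else 0))"
    using m by (intro sum.cong) (auto simp: v_def)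
  also have "\<dots> = 2 * m - 1" by (simp add: sum.distrib m_def)
  finally have vv: "(\<Sum>k\<in>UNIV. v k * v k) = 2 * m - 1" .
  define Q :: "real^'n^'n" where "Q = (\<chi> i j. (if i = j then 1 else 0) - c * v i * v j)"
  have "Q ** transpose Q = mat 1"
  proof (intro vec_eq_iff[THEN iffD2] allI)
    fix a b
    have "(Q ** transpose Q) $ a $ b = (\<Sum>k\<in>UNIV. Q $ a $ k * Q $ b $ k)"
      by (simp add: matrix_matrix_mult_def transpose_def)
    also have "\<dots> = (\<Sum>k\<in>UNIV. (if k = a then (if a = b then 1 else 0) - c * v a * v b else 0)
        - (if k = b then c * v a * v b else 0) + c * v a * v b * c * (v k * v k))"
      by (rule sum.cong) (auto simp: Q_def algebra_simps)
    also have "\<dots> = (if a = b then 1 else 0) - 2 * (c * v a * v b) + c * v a * v b * (c * (2 * m - 1))"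
      by (simp add: sum.distrib sum_subtractf sum_distrib_left[symmetric] vv)
    also have "\<dots> = (mat 1 :: real^'n^'n) $ a $ b"
      unfolding c by (simp add: mat_def)
    finally show "(Q ** transpose Q) $ a $ b = (mat 1 :: real^'n^'n) $ a $ b" .
  qed
  then have "orthogonal_matrix Q" by (simp add: orthogonal_matrix_def matrix_left_right_inverse)
  moreover have "Q $ i $ j \<noteq> 0" for i j
  proof (cases "i = j")
    case True
    have "c * (v i * v i) \<noteq> 1"
    proof
      assume "c * (v i * v i) = 1"
      then have "2 * (v i * v i) = 2 * m - 1" using m by (simp add: c_def field_simps)
      then show False using m by (auto simp: v_def split: if_splits)
    qed
    then show ?thesis using True by (simp add: Q_def)
  next
    case False
    then show ?thesis using m by (auto simp: Q_def c_def v_def)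
  qed
  ultimately show ?thesis using that by blast
qed

text \<open>
  A monomial is a list of letters \<open>(i, j)\<close>, that is, a zipped pair of a row word and a column word. The
  comultiplication sends the monomial with words \<open>I, J\<close> to the sum over all words \<open>K\<close> of the monomials
  with words \<open>I, K\<close> and \<open>K, J\<close>. \<open>translate_left \<phi>\<close> applies the functional \<open>\<phi>\<close> to the first leg and
  \<open>translate_right \<phi>\<close> to the second.
\<close>

definition translate_left :: "('n::finite list \<Rightarrow> 'n list \<Rightarrow> complex) \<Rightarrow>
    (('n \<times> 'n) list \<Rightarrow>\<^sub>0 complex) \<Rightarrow> ('n \<times> 'n) list \<Rightarrow>\<^sub>0 complex" where
  "translate_left \<phi> f = (\<Sum>w\<in>keys f. \<Sum>K\<in>words (length w).
     single (zip K (map snd w)) (lookup f w * \<phi> (map fst w) K))"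

definition translate_right :: "('n::finite list \<Rightarrow> 'n list \<Rightarrow> complex) \<Rightarrow>
    (('n \<times> 'n) list \<Rightarrow>\<^sub>0 complex) \<Rightarrow> ('n \<times> 'n) list \<Rightarrow>\<^sub>0 complex" where
  "translate_right \<phi> f = (\<Sum>w\<in>keys f. \<Sum>K\<in>words (length w).
     single (zip (map fst w) K) (lookup f w * \<phi> K (map snd w)))"

lemma zip_eq_zip_iff:
  assumes "length a = length b" "length c = length d"
  shows "zip a b = zip c d \<longleftrightarrow> a = c \<and> b = d"
  using assms by (metis map_fst_zip map_snd_zip)

lemma lookup_translate_left:
  assumes "length K = length J"
  shows "lookup (translate_left \<phi> f) (zip K J)
    = (\<Sum>I\<in>words (length J). \<phi> I K * lookup f (zip I J))"
proof -
  let ?g = "\<lambda>w. \<phi> (map fst w) K * lookup f w"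
  let ?W = "(\<lambda>I. zip I J) ` words (length J)"
  have W: "w \<in> ?W \<longleftrightarrow> map snd w = J" for w
  proof
    assume "map snd w = J"
    then have "w = zip (map fst w) J" "map fst w \<in> words (length J)"
      by (auto simp: zip_map_fst_snd words_def)
    then show "w \<in> ?W" by blast
  qed (auto simp: words_def)
  have "lookup (translate_left \<phi> f) (zip K J) = (\<Sum>w\<in>keys f. \<Sum>K'\<in>words (length w).
     if K' = K then if map snd w = J then ?g w else 0 else 0)"
    unfolding translate_left_def lookup_sum lookup_single
    using assms by (intro sum.cong) (auto simp: when_def words_def zip_eq_zip_iff)
  also have "\<dots> = (\<Sum>w\<in>keys f. if map snd w = J then ?g w else 0)"
    using assms by (intro sum.cong) auto
  also have "\<dots> = (\<Sum>w\<in>keys f \<inter> ?W. ?g w)"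
    by (simp add: sum.inter_restrict[symmetric] W[symmetric])
  also have "\<dots> = (\<Sum>w\<in>?W. ?g w)"
    by (rule sum.mono_neutral_left) (auto simp: in_keys_iff)
  also have "\<dots> = (\<Sum>I\<in>words (length J). \<phi> I K * lookup f (zip I J))"
    by (subst sum.reindex) (auto simp: inj_on_def words_def zip_eq_zip_iff)
  finally show ?thesis .
qed

lemma lookup_translate_right:
  assumes "length K = length I"
  shows "lookup (translate_right \<phi> f) (zip I K)
    = (\<Sum>J\<in>words (length I). \<phi> K J * lookup f (zip I J))"
proof -
  let ?g = "\<lambda>w. \<phi> K (map snd w) * lookup f w"
  let ?W = "(\<lambda>J. zip I J) ` words (length I)"
  have W: "w \<in> ?W \<longleftrightarrow> map fst w = I" for w
  proof
    assume "map fst w = I"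
    then have "w = zip I (map snd w)" "map snd w \<in> words (length I)"
      by (auto simp: zip_map_fst_snd words_def)
    then show "w \<in> ?W" by blast
  qed (auto simp: words_def)
  have "lookup (translate_right \<phi> f) (zip I K) = (\<Sum>w\<in>keys f. \<Sum>K'\<in>words (length w).
     if K' = K then if map fst w = I then ?g w else 0 else 0)"
    unfolding translate_right_def lookup_sum lookup_single
    using assms by (intro sum.cong) (auto simp: when_def words_def zip_eq_zip_iff)
  also have "\<dots> = (\<Sum>w\<in>keys f. if map fst w = I then ?g w else 0)"
    using assms by (intro sum.cong) auto
  also have "\<dots> = (\<Sum>w\<in>keys f \<inter> ?W. ?g w)"
    by (simp add: sum.inter_restrict[symmetric] W[symmetric])
  also have "\<dots> = (\<Sum>w\<in>?W. ?g w)"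
    by (rule sum.mono_neutral_left) (auto simp: in_keys_iff)
  also have "\<dots> = (\<Sum>J\<in>words (length I). \<phi> K J * lookup f (zip I J))"
    by (subst sum.reindex) (auto simp: inj_on_def words_def zip_eq_zip_iff)
  finally show ?thesis .
qed

text \<open>
  The coefficient at \<open>g\<close> of the image of a monomial in the group algebra of the free product.
\<close>

definition graded_delta :: "'n list \<Rightarrow> 'n list \<Rightarrow> 'n list \<Rightarrow> complex" where
  "graded_delta g I K = (if I = K \<and> reduce I = g then 1 else 0)"

text \<open>
  Vanishing contractions of adjacent letters are required of the component of degree \<open>n\<close> only, since
  lower components are dealt with by induction.
\<close>

definition harmonic :: "nat \<Rightarrow> (('n::finite \<times> 'n) list \<Rightarrow>\<^sub>0 complex) \<Rightarrow> bool" where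
  "harmonic n f \<longleftrightarrow> (\<forall>w. n < length w \<longrightarrow> lookup f w = 0) \<and>
     (\<forall>u v J. length u + length v + 2 = n \<longrightarrow> length J = n \<longrightarrow>
        (\<Sum>k\<in>UNIV. lookup f (zip (u @ [k, k] @ v) J)) = 0) \<and>
     (\<forall>u v I. length u + length v + 2 = n \<longrightarrow> length I = n \<longrightarrow>
        (\<Sum>k\<in>UNIV. lookup f (zip I (u @ [k, k] @ v))) = 0)"

lemma tensor_coeff_transpose:
  "tensor_coeff (cmatrix Q) w v = tensor_coeff (cmatrix (transpose Q)) v w"
  by (induction w v rule: list_induct2') (auto simp: tensor_coeff_def transpose_def)

lemma lookup_translate_left_matrix:
  assumes "length K = length J"
  shows "lookup (translate_left (tensor_coeff (cmatrix (transpose Q))) f) (zip K J)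
    = word_act (cmatrix Q) (\<lambda>I. lookup f (zip I J)) K"
  by (simp add: lookup_translate_left[OF assms] word_act_def assms tensor_coeff_transpose[of Q K])

lemma lookup_translate_right_matrix:
  assumes "length I = length K"
  shows "lookup (translate_right (tensor_coeff (cmatrix Q)) f) (zip I K)
    = word_act (cmatrix Q) (\<lambda>J. lookup f (zip I J)) K"
  using assms by (simp add: lookup_translate_right word_act_def)

lemma lookup_translate_left_graded:
  assumes "length K = length J"
  shows "lookup (translate_left (graded_delta g) f) (zip K J)
    = (if reduce K = g then lookup f (zip K J) else 0)"
proof -
  have "(\<Sum>I\<in>words (length J). graded_delta g I K * lookup f (zip I J))
    = (\<Sum>I\<in>words (length J). if I = K then if reduce K = g then lookup f (zip K J) else 0 else 0)"
    by (rule sum.cong) (auto simp: graded_delta_def)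
  then show ?thesis using assms by (simp add: lookup_translate_left)
qed

lemma lookup_translate_right_graded:
  assumes "length I = length K"
  shows "lookup (translate_right (graded_delta g) f) (zip I K)
    = (if reduce K = g then lookup f (zip I K) else 0)"
proof -
  have "(\<Sum>J\<in>words (length I). graded_delta g K J * lookup f (zip I J))
    = (\<Sum>J\<in>words (length I). if J = K then if reduce K = g then lookup f (zip I K) else 0 else 0)"
    by (rule sum.cong) (auto simp: graded_delta_def)
  then show ?thesis using assms by (simp add: lookup_translate_right)
qed

lemma lookup_translate_long:
  assumes "\<And>w. n < length w \<Longrightarrow> lookup f w = 0" "n < length w"
  shows "lookup (translate_left \<phi> f) w = 0"
    and "lookup (translate_right \<phi> f) w = 0"
  using lookup_translate_left[of "map fst w" "map snd w" \<phi> f]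
    lookup_translate_right[of "map snd w" "map fst w" \<phi> f] assms
  by (simp_all add: zip_map_fst_snd)

text \<open>
  In the row words the contractions are preserved because the matrix is orthogonal, in the column words
  because the translation does not act there.
\<close>

lemma harmonic_translate_left_matrix:
  assumes Q: "orthogonal_matrix Q" and f: "harmonic n f"
  shows "harmonic n (translate_left (tensor_coeff (cmatrix (transpose Q))) f)"
  unfolding harmonic_def
proof (intro conjI allI impI)
  show "lookup (translate_left (tensor_coeff (cmatrix (transpose Q))) f) w = 0"
    if "n < length w" for w
    using f that unfolding harmonic_def by (intro lookup_translate_long[of n]) auto
next
  fix u v J :: "'a list" assume l: "length u + length v + 2 = n" "length J = n"
  have "(\<Sum>k\<in>UNIV. word_act (cmatrix Q) (\<lambda>I. lookup f (zip I J)) (u @ [k, k] @ v)) = 0"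
    using f l orthogonal_matrix_columns[OF Q] unfolding harmonic_def
    by (intro word_act_contraction) auto
  then show "(\<Sum>k\<in>UNIV. lookup (translate_left (tensor_coeff (cmatrix (transpose Q))) f)
      (zip (u @ [k, k] @ v) J)) = 0"
    using l by (simp add: lookup_translate_left_matrix)
next
  fix u v K :: "'a list" assume l: "length u + length v + 2 = n" "length K = n"
  have "(\<Sum>k\<in>UNIV. word_act (cmatrix Q) (\<lambda>I. lookup f (zip I (u @ [k, k] @ v))) K)
     = word_act (cmatrix Q) (\<lambda>I. \<Sum>k\<in>UNIV. lookup f (zip I (u @ [k, k] @ v))) K"
    by (simp add: word_act_sum)
  also have "\<dots> = word_act (cmatrix Q) (\<lambda>I. 0) K"
    using f l unfolding harmonic_def by (intro word_act_cong) auto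
  also have "\<dots> = 0" by (simp add: word_act_def)
  finally show "(\<Sum>k\<in>UNIV. lookup (translate_left (tensor_coeff (cmatrix (transpose Q))) f)
      (zip K (u @ [k, k] @ v))) = 0"
    using l by (simp add: lookup_translate_left_matrix)
qed

lemma harmonic_translate_right_matrix:
  assumes Q: "orthogonal_matrix Q" and f: "harmonic n f"
  shows "harmonic n (translate_right (tensor_coeff (cmatrix Q)) f)"
  unfolding harmonic_def
proof (intro conjI allI impI)
  show "lookup (translate_right (tensor_coeff (cmatrix Q)) f) w = 0"
    if "n < length w" for w
    using f that unfolding harmonic_def by (intro lookup_translate_long[of n]) auto
next
  fix u v I :: "'a list" assume l: "length u + length v + 2 = n" "length I = n"
  have "(\<Sum>k\<in>UNIV. word_act (cmatrix Q) (\<lambda>J. lookup f (zip I J)) (u @ [k, k] @ v)) = 0"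
    using f l orthogonal_matrix_columns[OF Q] unfolding harmonic_def
    by (intro word_act_contraction) auto
  then show "(\<Sum>k\<in>UNIV. lookup (translate_right (tensor_coeff (cmatrix Q)) f)
      (zip I (u @ [k, k] @ v))) = 0"
    using l by (simp add: lookup_translate_right_matrix)
next
  fix u v K :: "'a list" assume l: "length u + length v + 2 = n" "length K = n"
  have "(\<Sum>k\<in>UNIV. word_act (cmatrix Q) (\<lambda>J. lookup f (zip (u @ [k, k] @ v) J)) K)
     = word_act (cmatrix Q) (\<lambda>J. \<Sum>k\<in>UNIV. lookup f (zip (u @ [k, k] @ v) J)) K"
    by (simp add: word_act_sum)
  also have "\<dots> = word_act (cmatrix Q) (\<lambda>J. 0) K"
    using f l unfolding harmonic_def by (intro word_act_cong) auto
  also have "\<dots> = 0" by (simp add: word_act_def)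
  finally show "(\<Sum>k\<in>UNIV. lookup (translate_right (tensor_coeff (cmatrix Q)) f)
      (zip (u @ [k, k] @ v) K)) = 0"
    using l by (simp add: lookup_translate_right_matrix)
qed

lemma harmonic_translate_graded:
  assumes f: "harmonic n f"
  shows "harmonic n (translate_left (graded_delta g) f)"
    and "harmonic n (translate_right (graded_delta g) f)"
proof -
  have long: "lookup f w = 0" if "n < length w" for w
    using f that unfolding harmonic_def by blast
  have red: "reduce (u @ k # k # v) = reduce (u @ v)" for u v :: "'a list" and k
    using reduce_insert_pair[of u k v] by simp
  have d: "(\<Sum>k\<in>UNIV. if P then h k else 0) = (if P then \<Sum>k\<in>UNIV. h k else 0)" for P and h :: "'a \<Rightarrow> complex"
    by simp
  show "harmonic n (translate_left (graded_delta g) f)"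
    unfolding harmonic_def
    using f by (auto simp: lookup_translate_left_graded lookup_translate_long[OF long] red harmonic_def d)
  show "harmonic n (translate_right (graded_delta g) f)"
    unfolding harmonic_def
    using f by (auto simp: lookup_translate_right_graded lookup_translate_long[OF long] red harmonic_def d)
qed

lemma harmonic_add: "harmonic n f \<Longrightarrow> harmonic n g \<Longrightarrow> harmonic n (f + g)"
  by (simp add: harmonic_def lookup_add sum.distrib)

lemma harmonic_scale: "harmonic n f \<Longrightarrow> harmonic n (pm_scale c f)"
  by (simp add: harmonic_def sum_distrib_left[symmetric])

section \<open>Translation-invariant spaces of polynomials\<close>

text \<open>
  \<open>invariant_subspace_zero\<close> for the tensors obtained from the members of a space \<open>V\<close> by fixing some of
  their indices; only their values on words of length \<open>n\<close> matter.
\<close>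

lemma invariant_slices_zero:
  fixes V :: "'f set" and sl :: "'f \<Rightarrow> 'n::finite list \<Rightarrow> complex"
  assumes card: "CARD('n) \<ge> 2"
    and add: "\<And>f f'. f \<in> V \<Longrightarrow> f' \<in> V \<Longrightarrow> \<exists>h\<in>V. \<forall>w. length w = n \<longrightarrow> sl h w = sl f w + sl f' w"
    and scale: "\<And>c f. f \<in> V \<Longrightarrow> \<exists>h\<in>V. \<forall>w. length w = n \<longrightarrow> sl h w = c * sl f w"
    and act: "\<And>Q f. orthogonal_matrix Q \<Longrightarrow> f \<in> V \<Longrightarrow>
      \<exists>h\<in>V. \<forall>w. length w = n \<longrightarrow> sl h w = word_act (cmatrix Q) (sl f) w"
    and grade: "\<And>g f. f \<in> V \<Longrightarrow> \<exists>h\<in>V. \<forall>w. length w = n \<longrightarrow> sl h w = (if reduce w = g then sl f w else 0)"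
    and contr: "\<And>f u v. f \<in> V \<Longrightarrow> length u + length v + 2 = n \<Longrightarrow> (\<Sum>a\<in>UNIV. sl f (u @ [a, a] @ v)) = 0"
    and top: "\<And>f w. f \<in> V \<Longrightarrow> length w = n \<Longrightarrow> distinct_adj w \<Longrightarrow> sl f w = 0"
    and f: "f \<in> V" and w: "length w = n"
  shows "sl f w = 0"
proof -
  let ?U = "{T. \<exists>f\<in>V. \<forall>w. length w = n \<longrightarrow> T w = sl f w}"
  have UI: "T \<in> ?U" if "h \<in> V" "\<And>w. length w = n \<Longrightarrow> T w = sl h w" for T h
    using that by blast
  show ?thesis
  proof (rule invariant_subspace_zero[OF card, where U = ?U and k = n and T = "sl f" and w = w])
    show "S \<in> ?U" if T: "T \<in> ?U" and S: "\<And>w. length w = n \<Longrightarrow> S w = T w" for S T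
    proof -
      obtain f where "f \<in> V" "\<forall>w. length w = n \<longrightarrow> T w = sl f w" using T by blast
      then show ?thesis by (intro UI[of f]) (simp_all add: S)
    qed
    show "(\<lambda>w. S w + T w) \<in> ?U" if S: "S \<in> ?U" and T: "T \<in> ?U" for S T
    proof -
      obtain f where f: "f \<in> V" "\<forall>w. length w = n \<longrightarrow> S w = sl f w" using S by blast
      obtain f' where f': "f' \<in> V" "\<forall>w. length w = n \<longrightarrow> T w = sl f' w" using T by blast
      obtain h where "h \<in> V" "\<forall>w. length w = n \<longrightarrow> sl h w = sl f w + sl f' w"
        using add[OF f(1) f'(1)] by blast
      then show ?thesis using f f' by (intro UI[of h]) simp_all
    qed
    show "(\<lambda>w. c * T w) \<in> ?U" if T: "T \<in> ?U" for c T
    proof -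
      obtain f where f: "f \<in> V" "\<forall>w. length w = n \<longrightarrow> T w = sl f w" using T by blast
      obtain h where "h \<in> V" "\<forall>w. length w = n \<longrightarrow> sl h w = c * sl f w"
        using scale[OF f(1)] by blast
      then show ?thesis using f by (intro UI[of h]) simp_all
    qed
    show "word_act (cmatrix Q) T \<in> ?U" if Q: "orthogonal_matrix Q" and T: "T \<in> ?U" for Q T
    proof -
      obtain f where f: "f \<in> V" "\<forall>w. length w = n \<longrightarrow> T w = sl f w" using T by blast
      obtain h where h: "h \<in> V" "\<forall>w. length w = n \<longrightarrow> sl h w = word_act (cmatrix Q) (sl f) w"
        using act[OF Q f(1)] by blast
      have "word_act (cmatrix Q) T w = sl h w" if "length w = n" for w
        using f h that by (simp add: word_act_cong[of w T "sl f"])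
      then show ?thesis by (intro UI[OF h(1)])
    qed
    show "(\<lambda>w. if reduce w = g then T w else 0) \<in> ?U" if T: "T \<in> ?U" for g T
    proof -
      obtain f where f: "f \<in> V" "\<forall>w. length w = n \<longrightarrow> T w = sl f w" using T by blast
      obtain h where h: "h \<in> V" "\<forall>w. length w = n \<longrightarrow> sl h w = (if reduce w = g then sl f w else 0)"
        using grade[OF f(1)] by blast
      then show ?thesis using f by (intro UI[of h]) simp_all
    qed
    show "(\<Sum>a\<in>UNIV. T (u @ [a, a] @ v)) = 0" if T: "T \<in> ?U" and l: "length u + length v + 2 = n" for T u v
    proof -
      obtain f where "f \<in> V" "\<forall>w. length w = n \<longrightarrow> T w = sl f w" using T by blast
      then show ?thesis using contr[of f u v] l by simp
    qed
    show "T w = 0" if T: "T \<in> ?U" and w: "length w = n" "distinct_adj w" for T w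
    proof -
      obtain f where "f \<in> V" "\<forall>w. length w = n \<longrightarrow> T w = sl f w" using T by blast
      then show ?thesis using top[of f w] w by simp
    qed
    show "sl f \<in> ?U" by (rule UI[OF f]) simp
  qed (rule w)
qed

text \<open>
  The properties of the kernel of a quotient map of \<open>O(O\<^sub>N\<^sup>+)\<close> through which both given quotient maps
  factor, without reference to Hopf algebras.
\<close>

locale translation_invariant =
  fixes N :: "(('n::finite \<times> 'n) list \<Rightarrow>\<^sub>0 complex) set"
  assumes card: "CARD('n) \<ge> 2"
    and subspace: "pm.subspace N"
    and left_matrix: "\<And>Q f. orthogonal_matrix Q \<Longrightarrow> f \<in> N \<Longrightarrow> translate_left (tensor_coeff (cmatrix Q)) f \<in> N"
    and right_matrix: "\<And>Q f. orthogonal_matrix Q \<Longrightarrow> f \<in> N \<Longrightarrow> translate_right (tensor_coeff (cmatrix Q)) f \<in> N"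
    and left_graded: "\<And>g f. f \<in> N \<Longrightarrow> translate_left (graded_delta g) f \<in> N"
    and right_graded: "\<And>g f. f \<in> N \<Longrightarrow> translate_right (graded_delta g) f \<in> N"
    and eval: "\<And>Q f. orthogonal_matrix Q \<Longrightarrow> f \<in> N \<Longrightarrow>
      (\<Sum>w\<in>keys f. lookup f w * tensor_coeff (cmatrix Q) (map fst w) (map snd w)) = 0"
begin

lemma reduced_coefficient_zero:
  assumes f: "f \<in> N" "harmonic n f"
    and w: "distinct_adj w" "length w = n" and w': "distinct_adj w'" "length w' = n"
  shows "lookup f (zip w w') = 0"
proof -
  obtain Q :: "real^'n^'n" where Q: "orthogonal_matrix Q" "\<And>i j. Q $ i $ j \<noteq> 0"
    using orthogonal_matrix_no_zero_entry[OF card] by blast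
  define c where "c = lookup f (zip w w')"
  define h where "h = translate_right (graded_delta w') (translate_left (graded_delta w) f)"
  have h: "h \<in> N" unfolding h_def by (intro right_graded left_graded f)
  have "h = single (zip w w') c"
  proof (rule poly_mapping_eqI)
    fix v :: "('n \<times> 'n) list"
    obtain I J where v: "v = zip I J" "length I = length J"
      by (metis length_map zip_map_fst_snd)
    have "lookup h v = (if reduce I = w \<and> reduce J = w' then lookup f v else 0)"
      unfolding h_def using v
      by (simp add: lookup_translate_right_graded lookup_translate_left_graded)
    also have "\<dots> = lookup (single (zip w w') c) v"
    proof (cases "v = zip w w'")
      case True
      then have "I = w" "J = w'" using v w w' by (auto simp: zip_eq_zip_iff)
      then show ?thesis using True w w' by (simp add: reduce_distinct_adj c_def)
    next
      case False
      have "lookup f v = 0" if r: "reduce I = w" "reduce J = w'"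
      proof (rule ccontr)
        assume "lookup f v \<noteq> 0"
        then have "length v \<le> n" using f unfolding harmonic_def by (meson not_le_imp_less)
        then have "I = w" "J = w'"
          using reduce_eq_same_length[OF r(1)] reduce_eq_same_length[OF r(2)] w w' v by auto
        then show False using False v by simp
      qed
      then show ?thesis using False by (auto simp: lookup_single when_def)
    qed
    finally show "lookup h v = lookup (single (zip w w') c) v" .
  qed
  then have "c * tensor_coeff (cmatrix Q) w w' = 0"
    using eval[OF Q(1) h] w w' by (cases "c = 0") auto
  moreover have "tensor_coeff (cmatrix Q) w w' \<noteq> 0"
    using Q(2) by (induction w w' rule: list_induct2') (auto simp: tensor_coeff_def)
  ultimately show ?thesis by (simp add: c_def)
qed

text \<open>
  \<open>invariant_slices_zero\<close> is applied twice. For a fixed reduced row word \<open>I\<close>, the coefficients as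
  functions of the column word vanish on reduced words, hence everywhere; therefore, for any fixed
  column word, the coefficients as functions of the row word vanish on reduced words, hence everywhere.
\<close>

lemma harmonic_top_zero:
  assumes f: "f \<in> N" "harmonic n f" and w: "length w = n"
  shows "lookup f w = 0"
proof -
  define V where "V = {f \<in> N. harmonic n f}"
  have V_add: "f + g \<in> V" if "f \<in> V" "g \<in> V" for f g
    using that subspace harmonic_add unfolding V_def pm.subspace_def by blast
  have V_scale: "pm_scale c f \<in> V" if "f \<in> V" for f c
    using that subspace harmonic_scale unfolding V_def pm.subspace_def by blast
  have V_left: "translate_left (tensor_coeff (cmatrix (transpose Q))) f \<in> V"
    and V_right: "translate_right (tensor_coeff (cmatrix Q)) f \<in> V"
    if "orthogonal_matrix Q" "f \<in> V" for Q f
    using that left_matrix[of "transpose Q"] right_matrix[of Q]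
      harmonic_translate_left_matrix harmonic_translate_right_matrix
    unfolding V_def by (auto simp: orthogonal_matrix_transpose)
  have V_graded: "translate_left (graded_delta g) f \<in> V" "translate_right (graded_delta g) f \<in> V"
    if "f \<in> V" for g f
    using that left_graded right_graded harmonic_translate_graded unfolding V_def by auto
  have half: "lookup f (zip I J) = 0"
    if f: "f \<in> V" and I: "length I = n" "distinct_adj I" and J: "length J = n" for f I J
  proof (rule invariant_slices_zero[OF card, where V = V and n = n and sl = "\<lambda>f J. lookup f (zip I J)"])
    show "\<exists>h\<in>V. \<forall>J. length J = n \<longrightarrow> lookup h (zip I J) = lookup f (zip I J) + lookup f' (zip I J)"
      if "f \<in> V" "f' \<in> V" for f f'
      using V_add[OF that] by (intro bexI[of _ "f + f'"]) (simp_all add: lookup_add)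
    show "\<exists>h\<in>V. \<forall>J. length J = n \<longrightarrow> lookup h (zip I J) = c * lookup f (zip I J)" if "f \<in> V" for c f
      using V_scale[OF that] by (intro bexI[of _ "pm_scale c f"]) simp_all
    show "\<exists>h\<in>V. \<forall>J. length J = n \<longrightarrow> lookup h (zip I J) = word_act (cmatrix Q) (\<lambda>J. lookup f (zip I J)) J"
      if "orthogonal_matrix Q" "f \<in> V" for Q f
      using V_right[OF that] I by (intro bexI) (simp_all add: lookup_translate_right_matrix)
    show "\<exists>h\<in>V. \<forall>J. length J = n \<longrightarrow> lookup h (zip I J) = (if reduce J = g then lookup f (zip I J) else 0)"
      if "f \<in> V" for g f
      using V_graded(2)[OF that, of g] I by (intro bexI) (simp_all add: lookup_translate_right_graded)
    show "(\<Sum>a\<in>UNIV. lookup f (zip I (u @ [a, a] @ v))) = 0"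
      if "f \<in> V" "length u + length v + 2 = n" for f u v
      using that I unfolding V_def harmonic_def by blast
    show "lookup f (zip I w) = 0" if "f \<in> V" "length w = n" "distinct_adj w" for f w
      using that I unfolding V_def by (intro reduced_coefficient_zero) auto
  qed (rule f, rule J)
  define J where "J = map snd w"
  have J: "length J = n" using w by (simp add: J_def)
  have "lookup f (zip (map fst w) J) = 0"
  proof (rule invariant_slices_zero[OF card, where V = V and n = n and sl = "\<lambda>f I. lookup f (zip I J)"])
    show "\<exists>h\<in>V. \<forall>I. length I = n \<longrightarrow> lookup h (zip I J) = lookup f (zip I J) + lookup f' (zip I J)"
      if "f \<in> V" "f' \<in> V" for f f'
      using V_add[OF that] by (intro bexI[of _ "f + f'"]) (simp_all add: lookup_add)
    show "\<exists>h\<in>V. \<forall>I. length I = n \<longrightarrow> lookup h (zip I J) = c * lookup f (zip I J)" if "f \<in> V" for c f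
      using V_scale[OF that] by (intro bexI[of _ "pm_scale c f"]) simp_all
    show "\<exists>h\<in>V. \<forall>I. length I = n \<longrightarrow> lookup h (zip I J) = word_act (cmatrix Q) (\<lambda>I. lookup f (zip I J)) I"
      if "orthogonal_matrix Q" "f \<in> V" for Q f
      using V_left[OF that] J by (intro bexI) (simp_all add: lookup_translate_left_matrix)
    show "\<exists>h\<in>V. \<forall>I. length I = n \<longrightarrow> lookup h (zip I J) = (if reduce I = g then lookup f (zip I J) else 0)"
      if "f \<in> V" for g f
      using V_graded(1)[OF that, of g] J by (intro bexI) (simp_all add: lookup_translate_left_graded)
    show "(\<Sum>a\<in>UNIV. lookup f (zip (u @ [a, a] @ v) J)) = 0"
      if "f \<in> V" "length u + length v + 2 = n" for f u v
      using that J unfolding V_def harmonic_def by blast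
    show "lookup f (zip w J) = 0" if "f \<in> V" "length w = n" "distinct_adj w" for f w
      by (rule half[OF that(1,2,3) J])
    show "f \<in> V" using f by (simp add: V_def)
  qed (simp add: w)
  then show ?thesis by (simp add: J_def zip_map_fst_snd)
qed

text \<open>
  Let \<open>G\<close> consist of the left hand sides of the relations of degree \<open>n\<close>, in all contexts. Subtracting
  from a polynomial of degree \<open>n\<close> the projection of its top component to the span of \<open>G\<close> makes it
  harmonic, and modulo the relations the part subtracted has lower degree. Since harmonic elements of
  \<open>N\<close> have zero top component, every element of \<open>N\<close> has lower degree modulo the relations.
\<close>

lemma subset_relations:
  assumes I: "pm.subspace I" "I \<subseteq> N"
    and rows: "\<And>u v i j. (\<Sum>k\<in>UNIV. single (u @ [(i, k), (j, k)] @ v) 1)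
       - single (u @ v) (if i = j then 1 else 0) \<in> I"
    and cols: "\<And>u v i j. (\<Sum>k\<in>UNIV. single (u @ [(k, i), (k, j)] @ v) 1)
       - single (u @ v) (if i = j then 1 else 0) \<in> I"
  shows "N \<subseteq> I"
proof -
  have harm: "\<exists>f' \<in> N. harmonic n f' \<and> f - f' \<in> I"
    if f: "f \<in> N" "\<And>w. n < length w \<Longrightarrow> lookup f w = 0" for n f
  proof -
    define cgen :: "'n list \<times> 'n list \<times> 'n list \<Rightarrow> ('n \<times> 'n) list \<Rightarrow>\<^sub>0 complex" where "cgen = (\<lambda>(u, v, J :: 'n list). \<Sum>k\<in>UNIV. single (zip (u @ [k, k] @ v) J) (1 :: complex))"
    define rgen :: "'n list \<times> 'n list \<times> 'n list \<Rightarrow> ('n \<times> 'n) list \<Rightarrow>\<^sub>0 complex" where "rgen = (\<lambda>(u, v, J :: 'n list). \<Sum>k\<in>UNIV. single (zip J (u @ [k, k] @ v)) (1 :: complex))"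
    define D where "D = {(u :: 'n list, v :: 'n list, J :: 'n list). length u + length v + 2 = n \<and> length J = n}"
    define G :: "(('n \<times> 'n) list \<Rightarrow>\<^sub>0 complex) set" where "G = cgen ` D \<union> rgen ` D"
    have "D \<subseteq> (\<Union>i\<le>n. words i) \<times> (\<Union>i\<le>n. words i) \<times> words n" by (auto simp: D_def)
    moreover have "finite ((\<Union>i\<le>n. words i :: 'n list set) \<times> (\<Union>i\<le>n. words i :: 'n list set) \<times> (words n :: 'n list set))"
      by (intro finite_cartesian_product finite_UN_I) simp_all
    ultimately have "finite D" by (rule finite_subset)
    then have finG: "finite G" by (simp add: G_def)
    have keysG: "keys g \<subseteq> words n" if g: "g \<in> G" for g
    proof -
      have sums: "keys (\<Sum>k\<in>UNIV. single (h k) (1 :: complex)) \<subseteq> words n"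
        if "\<And>k. length (h k) = n" for h :: "'n \<Rightarrow> ('n \<times> 'n) list"
      proof
        fix w assume "w \<in> keys (\<Sum>k\<in>UNIV. single (h k) (1 :: complex))"
        then obtain k where "w \<in> keys (single (h k) (1 :: complex))"
          using keys_sum[of "\<lambda>k. single (h k) (1 :: complex)" UNIV] by blast
        then show "w \<in> words n" using that by simp
      qed
      obtain u v J where l: "length u + length v + 2 = n" "length J = n"
        and gg: "g = cgen (u, v, J) \<or> g = rgen (u, v, J)"
        using g unfolding G_def D_def by auto
      then show ?thesis
        using sums[of "\<lambda>k. zip (u @ [k, k] @ v) J"] sums[of "\<lambda>k. zip J (u @ [k, k] @ v)"]
        unfolding cgen_def rgen_def by auto
    qed
    obtain s where s: "s \<in> pm.span G"
      and orth: "\<And>g. g \<in> G \<Longrightarrow> (\<Sum>w\<in>words n. lookup (f - s) w * cnj (lookup g w)) = 0"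
      using orthogonal_projection_span[OF finite_words finG keysG] by blast
    \<comment> \<open>Homogeneous elements of degree \<open>n\<close> that are congruent to elements of lower degree.\<close>
    define L where "L = {s. (\<forall>w. length w \<noteq> n \<longrightarrow> lookup s w = 0) \<and>
       (\<exists>s'. (\<forall>w. n \<le> length w \<longrightarrow> lookup s' w = 0) \<and> s - s' \<in> I)}"
    have subL: "pm.subspace L"
      unfolding pm.subspace_def
    proof (intro conjI ballI allI)
      show "0 \<in> L" using pm.subspace_0[OF I(1)] unfolding L_def by (auto intro!: exI[of _ 0])
    next
      fix x y assume "x \<in> L" "y \<in> L"
      then obtain x' y' where "x - x' \<in> I" "y - y' \<in> I"
        and z: "\<forall>w. n \<le> length w \<longrightarrow> lookup x' w = 0"
          "\<forall>w. n \<le> length w \<longrightarrow> lookup y' w = 0"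
          "\<forall>w. length w \<noteq> n \<longrightarrow> lookup x w = 0"
          "\<forall>w. length w \<noteq> n \<longrightarrow> lookup y w = 0"
        unfolding L_def by blast
      then have "(x + y) - (x' + y') \<in> I" using pm.subspace_add[OF I(1)] by (metis add_diff_add)
      then show "x + y \<in> L" using z unfolding L_def by (auto simp: lookup_add intro!: exI[of _ "x' + y'"])
    next
      fix c x assume "x \<in> L"
      then obtain x' where "x - x' \<in> I"
        and z: "\<forall>w. n \<le> length w \<longrightarrow> lookup x' w = 0"
          "\<forall>w. length w \<noteq> n \<longrightarrow> lookup x w = 0"
        unfolding L_def by blast
      then have "pm_scale c x - pm_scale c x' \<in> I"
        using pm.subspace_scale[OF I(1)] by (metis pm.scale_right_diff_distrib)
      then show "pm_scale c x \<in> L" using z unfolding L_def by (auto intro!: exI[of _ "pm_scale c x'"])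
    qed
    have GL: "G \<subseteq> L"
    proof
      fix g assume g: "g \<in> G"
      have long: "lookup g w = 0" if "length w \<noteq> n" for w
        using keysG[OF g] that by (auto simp: in_keys_iff)
      obtain u v J where l: "length u + length v + 2 = n" "length J = n"
        and gg: "g = cgen (u, v, J) \<or> g = rgen (u, v, J)"
        using g unfolding G_def D_def by auto
      define J1 where "J1 = take (length u) J"
      define J2 where "J2 = drop (length u + 2) J"
      obtain i j where J: "J = J1 @ [i, j] @ J2"
      proof -
        have "drop (length u) J = J ! length u # J ! Suc (length u) # J2"
          using l by (simp add: Cons_nth_drop_Suc J2_def)
        then show ?thesis using that[of "J ! length u" "J ! Suc (length u)"]
          by (metis J1_def append_take_drop_id append_Cons append_Nil)
      qed
      have l1: "length J1 = length u" "length J2 = length v" using l by (simp_all add: J1_def J2_def)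
      show "g \<in> L"
      proof (cases "g = cgen (u, v, J)")
        case True
        then have "g - single (zip u J1 @ zip v J2) (if i = j then 1 else 0) \<in> I"
          using cols[of "zip u J1" i j "zip v J2"] l1 by (simp add: cgen_def J)
        moreover have "lookup (single (zip u J1 @ zip v J2) (if i = j then 1 else 0 :: complex)) w = 0"
          if "n \<le> length w" for w
          using that l l1 by (auto simp: lookup_single when_def)
        ultimately show ?thesis using long unfolding L_def by blast
      next
        case False
        then have "g - single (zip J1 u @ zip J2 v) (if i = j then 1 else 0) \<in> I"
          using rows[of "zip J1 u" i j "zip J2 v"] l1 gg by (simp add: rgen_def J)
        moreover have "lookup (single (zip J1 u @ zip J2 v) (if i = j then 1 else 0 :: complex)) w = 0"
          if "n \<le> length w" for w
          using that l l1 by (auto simp: lookup_single when_def)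
        ultimately show ?thesis using long unfolding L_def by blast
      qed
    qed
    have "s \<in> L" using s pm.span_minimal[OF GL subL] by blast
    then obtain s' where s_top: "\<And>w. length w \<noteq> n \<Longrightarrow> lookup s w = 0"
      and s': "\<And>w. n \<le> length w \<Longrightarrow> lookup s' w = 0" "s - s' \<in> I"
      unfolding L_def by blast
    define f' where "f' = f - (s - s')"
    have "f' \<in> N"
      unfolding f'_def using pm.subspace_diff[OF subspace] f I s' by blast
    moreover have "f - f' \<in> I" using s' by (simp add: f'_def)
    moreover have "harmonic n f'"
      unfolding harmonic_def
    proof (intro conjI allI impI)
      show "lookup f' w = 0" if "n < length w" for w
        using that f s' s_top by (simp add: f'_def lookup_minus)
    next
      have top: "lookup f' w = lookup (f - s) w" if "length w = n" for w
        using that s' by (simp add: f'_def lookup_minus)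
      have pair: "(\<Sum>w\<in>words n. lookup (f - s) w * cnj (lookup
          (\<Sum>k\<in>UNIV. single (h k) (1 :: complex)) w)) = (\<Sum>k\<in>UNIV. lookup f' (h k))"
        if h: "\<And>k. length (h k) = n" for h :: "'n \<Rightarrow> ('n \<times> 'n) list"
      proof -
        have "lookup (f - s) w * cnj (lookup (\<Sum>k\<in>UNIV. single (h k) (1 :: complex)) w)
           = (\<Sum>k\<in>UNIV. if w = h k then lookup (f - s) (h k) else 0)" for w
          unfolding lookup_sum lookup_single cnj_sum sum_distrib_left
          by (rule sum.cong) (auto simp: when_def)
        then have "(\<Sum>w\<in>words n. lookup (f - s) w * cnj (lookup
          (\<Sum>k\<in>UNIV. single (h k) (1 :: complex)) w))
          = (\<Sum>k\<in>UNIV. \<Sum>w\<in>words n. if w = h k then lookup (f - s) (h k) else 0)"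
          by (simp only:) (rule sum.swap)
        then show ?thesis using h by (simp add: top)
      qed
      show "(\<Sum>k\<in>UNIV. lookup f' (zip (u @ [k, k] @ v) J)) = 0"
        if "length u + length v + 2 = n" "length J = n" for u v J
      proof -
        have "cgen (u, v, J) \<in> G" using that by (auto simp: G_def D_def)
        then show ?thesis
          using orth[of "cgen (u, v, J)"] pair[of "\<lambda>k. zip (u @ [k, k] @ v) J"] that
          by (simp add: cgen_def)
      qed
      show "(\<Sum>k\<in>UNIV. lookup f' (zip J (u @ [k, k] @ v))) = 0"
        if "length u + length v + 2 = n" "length J = n" for u v J
      proof -
        have "rgen (u, v, J) \<in> G" using that by (auto simp: G_def D_def)
        then show ?thesis
          using orth[of "rgen (u, v, J)"] pair[of "\<lambda>k. zip J (u @ [k, k] @ v)"] that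
          by (simp add: rgen_def)
      qed
    qed
    ultimately show ?thesis by blast
  qed
  have "f \<in> I" if "f \<in> N" "\<And>w. n \<le> length w \<Longrightarrow> lookup f w = 0" for n f
    using that
  proof (induction n arbitrary: f)
    case 0
    then have "f = 0" by (intro poly_mapping_eqI) simp
    then show ?case using pm.subspace_0[OF I(1)] by simp
  next
    case (Suc n)
    then obtain f' where f': "f' \<in> N" "harmonic n f'" "f - f' \<in> I"
      using harm[of f n] by auto
    have "f' \<in> I"
    proof (rule Suc.IH[OF f'(1)])
      show "lookup f' w = 0" if "n \<le> length w" for w
        using that f' harmonic_top_zero[OF f'(1,2), of w] unfolding harmonic_def
        by (cases "length w = n") auto
    qed
    then have "f' + (f - f') \<in> I" using pm.subspace_add[OF I(1)] f' by blast
    then show ?case by simp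
  qed
  moreover have "\<exists>n. \<forall>w. n \<le> length w \<longrightarrow> lookup f w = 0" for f :: "('n \<times> 'n) list \<Rightarrow>\<^sub>0 complex"
  proof -
    have "\<forall>w. Suc (Max (insert 0 (length ` keys f))) \<le> length w \<longrightarrow> lookup f w = 0"
    proof (intro allI impI)
      fix w :: "('n \<times> 'n) list" assume "Suc (Max (insert 0 (length ` keys f))) \<le> length w"
      moreover have "length w \<le> Max (insert 0 (length ` keys f))" if "w \<in> keys f"
        using that by (intro Max_ge) auto
      ultimately have "w \<notin> keys f" by (metis Suc_n_not_le_n le_trans)
      then show "lookup f w = 0" by (simp add: in_keys_iff)
    qed
    then show ?thesis by blast
  qed
  ultimately show ?thesis by blast
qed

end

section \<open>Complex algebras and linear extension\<close>

lemma poly_mapping_induct_keys [consumes 1, case_names zero single add]: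
  fixes f :: "'k \<Rightarrow>\<^sub>0 'c::comm_monoid_add"
  assumes "keys f \<subseteq> S"
    and zero: "P 0"
    and single: "\<And>k c. k \<in> S \<Longrightarrow> P (single k c)"
    and add: "\<And>f g. keys f \<subseteq> S \<Longrightarrow> keys g \<subseteq> S \<Longrightarrow> P f \<Longrightarrow> P g \<Longrightarrow> P (f + g)"
  shows "P f"
proof -
  have sum: "P (\<Sum>k\<in>T. single k (lookup f k)) \<and>
      keys (\<Sum>k\<in>T. single k (lookup f k)) \<subseteq> S"
    if "finite T" "T \<subseteq> S" for T
    using that
  proof (induction T rule: finite_induct)
    case (insert k T)
    then show ?case
      using add[of "single k (lookup f k)"] single[of k]
        Poly_Mapping.keys_add[of "single k (lookup f k)"
          "\<Sum>k\<in>T. single k (lookup f k)"]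
      by (auto split: if_splits)
  qed (simp add: zero)
  have "f = (\<Sum>k\<in>keys f. single k (lookup f k))"
  proof (rule poly_mapping_eqI)
    fix k
    show "lookup f k
      = lookup (\<Sum>k\<in>keys f. single k (lookup f k)) k"
      by (simp add: lookup_sum lookup_single when_def in_keys_iff)
  qed
  then show ?thesis using sum[of "keys f"] assms(1) by simp
qed

lemma keys_pm_scale: "keys (pm_scale c f) \<subseteq> keys f"
  by (auto simp: in_keys_iff)

lemma keys_add_subset:
  "keys f \<subseteq> S \<Longrightarrow> keys g \<subseteq> S \<Longrightarrow> keys (f + g) \<subseteq> S"
  using Poly_Mapping.keys_add[of f g] by blast

lemma keys_sum_subset:
  assumes "\<And>i. i \<in> A \<Longrightarrow> keys (F i) \<subseteq> S"
  shows "keys (\<Sum>i\<in>A. F i) \<subseteq> S"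
  using assms by (induction A rule: infinite_finite_induct) (simp_all add: keys_add_subset)

lemma keys_diff_subset:
  "keys f \<subseteq> S \<Longrightarrow> keys g \<subseteq> S \<Longrightarrow> keys (f - g) \<subseteq> S"
  for f :: "'k \<Rightarrow>\<^sub>0 'c::ab_group_add"
  using keys_diff[of f g] by blast

lemma pm_scale_single [simp]: "pm_scale c (single k d) = single k (c * d)"
  by (rule poly_mapping_eqI) (simp add: lookup_single when_def)

lemma complex_alg_simps [simp]:
  "carrier complex_alg = UNIV" "x \<otimes>\<^bsub>complex_alg\<^esub> y = x * y" "x \<oplus>\<^bsub>complex_alg\<^esub> y = x + y"
  "\<one>\<^bsub>complex_alg\<^esub> = 1" "\<zero>\<^bsub>complex_alg\<^esub> = 0" "c \<odot>\<^bsub>complex_alg\<^esub> x = c * x" "star complex_alg = cnj"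
  by (simp_all add: complex_alg_def)

lemma cring_complex_alg: "cring complex_alg"
proof (rule cringI)
  show "abelian_group complex_alg"
  proof (rule abelian_groupI)
    show "\<exists>y\<in>carrier complex_alg. y \<oplus>\<^bsub>complex_alg\<^esub> x = \<zero>\<^bsub>complex_alg\<^esub>" for x
      by (rule bexI[of _ "- x"]) simp_all
  qed simp_all
  show "comm_monoid complex_alg"
    by (rule comm_monoidI) simp_all
qed (simp add: distrib_right)

text \<open>
  A star-algebra without its involution. The quotients and tensor products below only enter through this
  part of their structure.
\<close>

locale complex_algebra = Module.module complex_alg A + ring A for A :: "('a, 'x) star_algebra_scheme" (structure) +
  assumes smult_mult_left: "\<lbrakk>x \<in> carrier A; y \<in> carrier A\<rbrakk> \<Longrightarrow> (c \<odot> x) \<otimes> y = c \<odot> (x \<otimes> y)"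
    and smult_mult_right: "\<lbrakk>x \<in> carrier A; y \<in> carrier A\<rbrakk> \<Longrightarrow> x \<otimes> (c \<odot> y) = c \<odot> (x \<otimes> y)"

lemma complex_algebraI:
  fixes A :: "('a, 'x) star_algebra_scheme" (structure)
  assumes "ring A"
    and "\<And>c x. x \<in> carrier A \<Longrightarrow> c \<odot> x \<in> carrier A"
    and "\<And>c d x. x \<in> carrier A \<Longrightarrow> (c + d) \<odot> x = c \<odot> x \<oplus> d \<odot> x"
    and "\<And>c x y. x \<in> carrier A \<Longrightarrow> y \<in> carrier A \<Longrightarrow> c \<odot> (x \<oplus> y) = c \<odot> x \<oplus> c \<odot> y"
    and "\<And>c d x. x \<in> carrier A \<Longrightarrow> (c * d) \<odot> x = c \<odot> (d \<odot> x)"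
    and "\<And>x. x \<in> carrier A \<Longrightarrow> 1 \<odot> x = x"
    and "\<And>c x y. x \<in> carrier A \<Longrightarrow> y \<in> carrier A \<Longrightarrow> (c \<odot> x) \<otimes> y = c \<odot> (x \<otimes> y)"
    and "\<And>c x y. x \<in> carrier A \<Longrightarrow> y \<in> carrier A \<Longrightarrow> x \<otimes> (c \<odot> y) = c \<odot> (x \<otimes> y)"
  shows "complex_algebra A"
proof -
  interpret ring A by fact
  interpret C: cring complex_alg by (rule cring_complex_alg)
  show ?thesis
    by unfold_locales (simp_all add: assms)
qed

lemma star_algebra_complex_algebra: "star_algebra A \<Longrightarrow> complex_algebra A"
  by (simp add: star_algebra_def star_algebra_axioms_def complex_algebra_def complex_algebra_axioms_def)

context complex_algebra
begin

lemma smult_closed' [simp, intro]: "x \<in> carrier A \<Longrightarrow> c \<odot> x \<in> carrier A"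
  by (rule smult_closed) simp

lemma smult_add_left: "x \<in> carrier A \<Longrightarrow> (c + d) \<odot> x = c \<odot> x \<oplus> d \<odot> x"
  using smult_l_distr[of c d x] by simp

lemma smult_add_right: "x \<in> carrier A \<Longrightarrow> y \<in> carrier A \<Longrightarrow> c \<odot> (x \<oplus> y) = c \<odot> x \<oplus> c \<odot> y"
  using smult_r_distr[of c x y] by simp

lemma smult_smult: "x \<in> carrier A \<Longrightarrow> (c * d) \<odot> x = c \<odot> (d \<odot> x)"
  using smult_assoc1[of c d x] by simp

lemma smult_1 [simp]: "x \<in> carrier A \<Longrightarrow> 1 \<odot> x = x"
  using smult_one[of x] by simp

lemma smult_0_left [simp]: "x \<in> carrier A \<Longrightarrow> 0 \<odot> x = \<zero>"
  using smult_l_null[of x] by simp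

lemma smult_0_right [simp]: "c \<odot> \<zero> = \<zero>"
  using smult_r_null[of c] by simp

lemma smult_minus_1: "x \<in> carrier A \<Longrightarrow> (-1) \<odot> x = \<ominus> x"
  using smult_add_left[of x "-1" 1] by (intro minus_equality[symmetric]) simp_all

lemmas smult_simps = smult_add_left smult_add_right smult_smult

lemma idealI':
  assumes "I \<subseteq> carrier A" "\<zero> \<in> I"
    and add: "\<And>x y. x \<in> I \<Longrightarrow> y \<in> I \<Longrightarrow> x \<oplus> y \<in> I"
    and l: "\<And>x y. x \<in> I \<Longrightarrow> y \<in> carrier A \<Longrightarrow> y \<otimes> x \<in> I"
    and r: "\<And>x y. x \<in> I \<Longrightarrow> y \<in> carrier A \<Longrightarrow> x \<otimes> y \<in> I"
  shows "ideal I A"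
proof (rule idealI)
  show "subgroup I (add_monoid A)"
  proof
    show "inv\<^bsub>add_monoid A\<^esub> x \<in> I" if "x \<in> I" for x
    proof -
      have "\<ominus> \<one> \<otimes> x = \<ominus> x" using that assms(1) by (simp add: l_minus subsetD)
      then show ?thesis using l[OF that, of "\<ominus> \<one>"] by (simp add: a_inv_def)
    qed
  qed (use assms in auto)
qed (use l r ring_axioms in auto)

lemma finsum_smult:
  "finite T \<Longrightarrow> h \<in> T \<rightarrow> carrier A \<Longrightarrow> c \<odot> (\<Oplus>i\<in>T. h i) = (\<Oplus>i\<in>T. c \<odot> h i)"
proof (induction T rule: finite_induct)
  case (insert i T)
  then have "h i \<in> carrier A" "h \<in> T \<rightarrow> carrier A" "(\<lambda>i. c \<odot> h i) \<in> T \<rightarrow> carrier A" by auto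
  then show ?case using insert by (simp add: smult_add_right)
qed simp

end

text \<open>
  The common form of \<open>nc_eval\<close> and of \<open>tensor_lift\<close> on representatives.
\<close>

definition lin_ext :: "('c, 'z) star_algebra_scheme \<Rightarrow> ('k \<Rightarrow> 'c) \<Rightarrow> ('k \<Rightarrow>\<^sub>0 complex) \<Rightarrow> 'c" where
  "lin_ext C \<beta> f = (\<Oplus>\<^bsub>C\<^esub>k\<in>keys f. lookup f k \<odot>\<^bsub>C\<^esub> \<beta> k)"

context complex_algebra
begin

text \<open>
  Additivity is proved by summing over a finite set that contains the supports of both summands.
\<close>

lemma lin_ext_superset:
  assumes "finite T" "keys f \<subseteq> T" "\<beta> \<in> T \<rightarrow> carrier A"
  shows "lin_ext A \<beta> f = (\<Oplus>k\<in>T. lookup f k \<odot> \<beta> k)"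
  unfolding lin_ext_def
proof (rule add.finprod_mono_neutral_cong_left)
  show "lookup f i \<odot> \<beta> i = \<zero>" if "i \<in> T - keys f" for i
    using that assms by (auto simp: in_keys_iff Pi_iff)
qed (use assms in auto)

lemma lin_ext_closed:
  "\<beta> \<in> keys f \<rightarrow> carrier A \<Longrightarrow> lin_ext A \<beta> f \<in> carrier A"
  unfolding lin_ext_def by (rule finsum_closed) auto

lemma lin_ext_0 [simp]: "lin_ext A \<beta> 0 = \<zero>"
  by (simp add: lin_ext_def)

lemma lin_ext_single:
  assumes "\<beta> k \<in> carrier A"
  shows "lin_ext A \<beta> (single k c) = c \<odot> \<beta> k"
  using lin_ext_superset[of "{k}" "single k c" \<beta>] assms by simp

lemma lin_ext_add:
  assumes "keys f \<subseteq> S" "keys g \<subseteq> S" "\<beta> \<in> S \<rightarrow> carrier A"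
  shows "lin_ext A \<beta> (f + g) = lin_ext A \<beta> f \<oplus> lin_ext A \<beta> g"
proof -
  let ?T = "keys f \<union> keys g"
  have \<beta>: "\<beta> \<in> ?T \<rightarrow> carrier A" using assms by auto
  have "lin_ext A \<beta> (f + g) = (\<Oplus>k\<in>?T. lookup (f + g) k \<odot> \<beta> k)"
    by (rule lin_ext_superset[OF _ Poly_Mapping.keys_add \<beta>]) simp
  also have "\<dots> = (\<Oplus>k\<in>?T. lookup f k \<odot> \<beta> k \<oplus> lookup g k \<odot> \<beta> k)"
  proof (rule finsum_cong'[OF refl])
    show "(\<lambda>k. lookup f k \<odot> \<beta> k \<oplus> lookup g k \<odot> \<beta> k) \<in> ?T \<rightarrow> carrier A"
      using \<beta> by blast
    show "lookup (f + g) k \<odot> \<beta> k = lookup f k \<odot> \<beta> k \<oplus> lookup g k \<odot> \<beta> k"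
      if "k \<in> ?T" for k
      using funcset_mem[OF \<beta> that] by (simp add: lookup_add smult_add_left)
  qed
  also have "\<dots> = lin_ext A \<beta> f \<oplus> lin_ext A \<beta> g"
    using \<beta> lin_ext_superset[of ?T f \<beta>] lin_ext_superset[of ?T g \<beta>]
    by (subst finsum_addf) (auto simp: Pi_iff)
  finally show ?thesis .
qed

lemma lin_ext_scale:
  assumes "\<beta> \<in> keys f \<rightarrow> carrier A"
  shows "lin_ext A \<beta> (pm_scale c f) = c \<odot> lin_ext A \<beta> f"
proof -
  have "lin_ext A \<beta> (pm_scale c f) = (\<Oplus>k\<in>keys f. lookup (pm_scale c f) k \<odot> \<beta> k)"
    by (rule lin_ext_superset[OF finite_keys keys_pm_scale assms])
  also have "\<dots> = (\<Oplus>k\<in>keys f. c \<odot> (lookup f k \<odot> \<beta> k))"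
    by (rule finsum_cong') (use assms in \<open>simp_all add: smult_smult Pi_iff\<close>)
  also have "\<dots> = c \<odot> lin_ext A \<beta> f"
    unfolding lin_ext_def by (rule finsum_smult[symmetric]) (use assms in auto)
  finally show ?thesis .
qed

lemma lin_ext_diff:
  assumes "keys f \<subseteq> S" "keys g \<subseteq> S" "\<beta> \<in> S \<rightarrow> carrier A"
  shows "lin_ext A \<beta> (f - g) = lin_ext A \<beta> f \<ominus> lin_ext A \<beta> g"
proof -
  have k: "keys (pm_scale (-1) g) \<subseteq> S" by (rule order_trans[OF keys_pm_scale assms(2)])
  have \<beta>: "\<beta> \<in> keys g \<rightarrow> carrier A" using assms by auto
  have "f - g = f + pm_scale (-1) g" by (rule poly_mapping_eqI) (simp add: lookup_add lookup_minus)
  then show ?thesis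
    using lin_ext_add[OF assms(1) k assms(3)] lin_ext_scale[OF \<beta>, of "-1"] lin_ext_closed[OF \<beta>]
    by (simp add: smult_minus_1 a_minus_def)
qed

lemma lin_ext_sum:
  assumes "finite T" "\<And>i. i \<in> T \<Longrightarrow> keys (F i) \<subseteq> S" "\<beta> \<in> S \<rightarrow> carrier A"
  shows "lin_ext A \<beta> (\<Sum>i\<in>T. F i) = (\<Oplus>i\<in>T. lin_ext A \<beta> (F i))"
  using assms(1,2)
proof (induction T rule: finite_induct)
  case (insert i T)
  have cl: "lin_ext A \<beta> (F j) \<in> carrier A" if "j \<in> insert i T" for j
    by (rule lin_ext_closed) (use insert.prems[OF that] assms(3) in blast)
  have "lin_ext A \<beta> (F i + (\<Sum>i\<in>T. F i)) = lin_ext A \<beta> (F i) \<oplus> lin_ext A \<beta> (\<Sum>i\<in>T. F i)"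
    by (rule lin_ext_add[OF _ keys_sum_subset assms(3)]) (use insert.prems in auto)
  then show ?case using insert cl by simp
qed simp

end

section \<open>Monoid algebras\<close>

lemma monoid_algebra_simps [simp]:
  "carrier (monoid_algebra M \<tau>) = {f. keys f \<subseteq> carrier M}"
  "\<one>\<^bsub>monoid_algebra M \<tau>\<^esub> = single \<one>\<^bsub>M\<^esub> 1"
  "\<zero>\<^bsub>monoid_algebra M \<tau>\<^esub> = 0"
  "f \<oplus>\<^bsub>monoid_algebra M \<tau>\<^esub> g = f + g"
  "c \<odot>\<^bsub>monoid_algebra M \<tau>\<^esub> f = pm_scale c f"
  by (simp_all add: monoid_algebra_def)

lemma monoid_algebra_mult_superset:
  assumes "finite S" "keys f \<subseteq> S" "finite T" "keys g \<subseteq> T"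
  shows "f \<otimes>\<^bsub>monoid_algebra M \<tau>\<^esub> g = (\<Sum>p\<in>S. \<Sum>q\<in>T.
     single (p \<otimes>\<^bsub>M\<^esub> q) (lookup f p * lookup g q))"
proof -
  have "f \<otimes>\<^bsub>monoid_algebra M \<tau>\<^esub> g = (\<Sum>p\<in>keys f. \<Sum>q\<in>T.
     single (p \<otimes>\<^bsub>M\<^esub> q) (lookup f p * lookup g q))"
    unfolding monoid_algebra_def monoid.simps
    by (intro sum.cong refl sum.mono_neutral_left) (use assms in \<open>auto simp: in_keys_iff\<close>)
  also have "\<dots> = (\<Sum>p\<in>S. \<Sum>q\<in>T.
     single (p \<otimes>\<^bsub>M\<^esub> q) (lookup f p * lookup g q))"
    using assms by (intro sum.mono_neutral_left) (auto simp: in_keys_iff)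
  finally show ?thesis .
qed

lemma monoid_algebra_mult_single [simp]:
  "single p c \<otimes>\<^bsub>monoid_algebra M \<tau>\<^esub> single q d
    = single (p \<otimes>\<^bsub>M\<^esub> q) (c * d)"
  using monoid_algebra_mult_superset[of "{p}" "single p c" "{q}" "single q d" M \<tau>]
  by simp

lemma monoid_algebra_distrib_left:
  "(f + f') \<otimes>\<^bsub>monoid_algebra M \<tau>\<^esub> g
    = f \<otimes>\<^bsub>monoid_algebra M \<tau>\<^esub> g + f' \<otimes>\<^bsub>monoid_algebra M \<tau>\<^esub> g"
proof -
  let ?S = "keys f \<union> keys f'" and ?T = "keys g"
  have eq: "h \<otimes>\<^bsub>monoid_algebra M \<tau>\<^esub> g = (\<Sum>p\<in>?S. \<Sum>q\<in>?T.
     single (p \<otimes>\<^bsub>M\<^esub> q) (lookup h p * lookup g q))"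
    if "keys h \<subseteq> ?S" for h
    by (rule monoid_algebra_mult_superset) (use that in simp_all)
  show ?thesis
    using eq[of "f + f'"] eq[of f] eq[of f'] Poly_Mapping.keys_add[of f f']
    by (simp add: lookup_add distrib_right single_add sum.distrib)
qed

lemma monoid_algebra_distrib_right:
  "g \<otimes>\<^bsub>monoid_algebra M \<tau>\<^esub> (f + f')
    = g \<otimes>\<^bsub>monoid_algebra M \<tau>\<^esub> f + g \<otimes>\<^bsub>monoid_algebra M \<tau>\<^esub> f'"
proof -
  let ?S = "keys f \<union> keys f'" and ?T = "keys g"
  have eq: "g \<otimes>\<^bsub>monoid_algebra M \<tau>\<^esub> h = (\<Sum>p\<in>?T. \<Sum>q\<in>?S.
     single (p \<otimes>\<^bsub>M\<^esub> q) (lookup g p * lookup h q))"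
    if "keys h \<subseteq> ?S" for h
    by (rule monoid_algebra_mult_superset) (use that in simp_all)
  show ?thesis
    using eq[of "f + f'"] eq[of f] eq[of f'] Poly_Mapping.keys_add[of f f']
    by (simp add: lookup_add distrib_left single_add sum.distrib)
qed

lemma monoid_algebra_mult_0 [simp]:
  "0 \<otimes>\<^bsub>monoid_algebra M \<tau>\<^esub> g = 0" "g \<otimes>\<^bsub>monoid_algebra M \<tau>\<^esub> 0 = 0"
  by (simp_all add: monoid_algebra_def)

lemma pm_scale_sum: "pm_scale c (\<Sum>i\<in>T. F i) = (\<Sum>i\<in>T. pm_scale c (F i))"
  by (rule pm.scale_sum_right)

lemma monoid_algebra_scale_left:
  "pm_scale c f \<otimes>\<^bsub>monoid_algebra M \<tau>\<^esub> g = pm_scale c (f \<otimes>\<^bsub>monoid_algebra M \<tau>\<^esub> g)"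
  using monoid_algebra_mult_superset[OF finite_keys keys_pm_scale[of c f] finite_keys order_refl[of "keys g"], of M \<tau>]
    monoid_algebra_mult_superset[OF finite_keys order_refl[of "keys f"] finite_keys order_refl[of "keys g"], of M \<tau>]
  by (simp add: pm_scale_sum mult.assoc)

lemma monoid_algebra_scale_right:
  "g \<otimes>\<^bsub>monoid_algebra M \<tau>\<^esub> pm_scale c f = pm_scale c (g \<otimes>\<^bsub>monoid_algebra M \<tau>\<^esub> f)"
  using monoid_algebra_mult_superset[OF finite_keys order_refl[of "keys g"] finite_keys keys_pm_scale[of c f], of M \<tau>]
    monoid_algebra_mult_superset[OF finite_keys order_refl[of "keys g"] finite_keys order_refl[of "keys f"], of M \<tau>]
  by (simp add: pm_scale_sum mult.left_commute)

lemma monoid_algebra_mult_sum_left: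
  "(\<Sum>i\<in>T. F i) \<otimes>\<^bsub>monoid_algebra M \<tau>\<^esub> g = (\<Sum>i\<in>T. F i \<otimes>\<^bsub>monoid_algebra M \<tau>\<^esub> g)"
  by (induction T rule: infinite_finite_induct) (auto simp: monoid_algebra_distrib_left)

lemma monoid_algebra_mult_sum_right:
  "g \<otimes>\<^bsub>monoid_algebra M \<tau>\<^esub> (\<Sum>i\<in>T. F i) = (\<Sum>i\<in>T. g \<otimes>\<^bsub>monoid_algebra M \<tau>\<^esub> F i)"
  by (induction T rule: infinite_finite_induct) (auto simp: monoid_algebra_distrib_right)

lemma complex_algebra_monoid_algebra:
  assumes "Group.monoid M"
  shows "complex_algebra (monoid_algebra M \<tau>)" (is "complex_algebra ?A")
proof -
  interpret Group.monoid M by fact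
  have closed: "f \<otimes>\<^bsub>?A\<^esub> g \<in> carrier ?A" if "f \<in> carrier ?A" "g \<in> carrier ?A" for f g
    using that unfolding monoid_algebra_def by (auto intro!: keys_sum_subset m_closed split: if_splits)
  have assoc: "(f \<otimes>\<^bsub>?A\<^esub> g) \<otimes>\<^bsub>?A\<^esub> h = f \<otimes>\<^bsub>?A\<^esub> (g \<otimes>\<^bsub>?A\<^esub> h)"
    if "f \<in> carrier ?A" "g \<in> carrier ?A" "h \<in> carrier ?A" for f g h
  proof -
    have f: "keys f \<subseteq> carrier M" and g: "keys g \<subseteq> carrier M"
      and h: "keys h \<subseteq> carrier M" using that by auto
    show ?thesis using f
    proof (induction rule: poly_mapping_induct_keys)
      case (single p c)
      show ?case using g
      proof (induction rule: poly_mapping_induct_keys)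
        case (single q d)
        show ?case using h
          by (induction rule: poly_mapping_induct_keys)
            (use \<open>p \<in> carrier M\<close> \<open>q \<in> carrier M\<close> in \<open>auto simp: m_assoc mult.assoc monoid_algebra_distrib_right\<close>)
      qed (auto simp: monoid_algebra_distrib_right monoid_algebra_distrib_left)
    qed (auto simp: monoid_algebra_distrib_left)
  qed
  have one: "\<one>\<^bsub>?A\<^esub> \<otimes>\<^bsub>?A\<^esub> f = f \<and> f \<otimes>\<^bsub>?A\<^esub> \<one>\<^bsub>?A\<^esub> = f" if "f \<in> carrier ?A" for f
  proof -
    have "keys f \<subseteq> carrier M" using that by simp
    then show ?thesis
      by (induction rule: poly_mapping_induct_keys)
        (auto simp: monoid_algebra_distrib_left monoid_algebra_distrib_right)
  qed
  have "ring ?A"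
  proof (rule ringI)
    show "abelian_group ?A"
    proof (rule abelian_groupI)
      fix f assume "f \<in> carrier ?A"
      then have "- f \<in> carrier ?A" by simp
      then show "\<exists>g\<in>carrier ?A. g \<oplus>\<^bsub>?A\<^esub> f = \<zero>\<^bsub>?A\<^esub>"
        by (rule bexI[rotated]) simp
    qed (auto simp: ac_simps dest: subsetD[OF Poly_Mapping.keys_add])
    show "Group.monoid ?A"
      by (rule monoidI) (use closed assoc one in \<open>auto\<close>)
  qed (auto simp: monoid_algebra_distrib_left monoid_algebra_distrib_right)
  then show ?thesis
    by (rule complex_algebraI)
      (use pm.scale_left_distrib pm.scale_right_distrib keys_pm_scale in
        \<open>auto simp: monoid_algebra_scale_left monoid_algebra_scale_right dest: subsetD[OF keys_pm_scale]\<close>)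
qed

section \<open>Quotient algebras\<close>

lemma UN_const_image:
  assumes "X \<noteq> {}" "\<And>x. x \<in> X \<Longrightarrow> F x = Y"
  shows "(\<Union>x\<in>X. F x) = Y"
  using assms by blast

context complex_algebra
begin

lemma coset_eq_iff:
  assumes "ideal I A" "x \<in> carrier A" "y \<in> carrier A"
  shows "I +> x = I +> y \<longleftrightarrow> x \<ominus> y \<in> I"
  using quotient_eq_iff_same_a_r_cos[OF assms] by simp

lemma coset_memD:
  assumes "ideal I A" "x \<in> carrier A" "x' \<in> I +> x"
  shows "x' \<in> carrier A" "I +> x' = I +> x"
proof -
  interpret I: ideal I A by fact
  obtain i where i: "i \<in> I" "x' = i \<oplus> x" using assms(3) by (auto simp: a_r_coset_def')
  then show c: "x' \<in> carrier A" using assms(2) I.a_Hcarr by simp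
  have "x' \<ominus> x = i" using i assms(2) I.a_Hcarr by (simp add: a_minus_def a_assoc r_neg)
  then show "I +> x' = I +> x" using coset_eq_iff[OF assms(1) c assms(2)] i by simp
qed

lemma coset_self: "ideal I A \<Longrightarrow> x \<in> carrier A \<Longrightarrow> x \<in> I +> x"
  by (simp add: ideal.axioms(1) additive_subgroup.zero_closed a_r_coset_def' ideal_def)
    (metis additive_subgroup.zero_closed ideal.axioms(1) l_zero)

lemma quot_algebra_simps:
  assumes I: "ideal I A" and x: "x \<in> carrier A" and y: "y \<in> carrier A"
  shows "(I +> x) \<otimes>\<^bsub>quot_algebra A I\<^esub> (I +> y) = I +> (x \<otimes> y)"
    and "(I +> x) \<oplus>\<^bsub>quot_algebra A I\<^esub> (I +> y) = I +> (x \<oplus> y)"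
    and "c \<odot>\<^bsub>quot_algebra A I\<^esub> (I +> x) = I +> (c \<odot> x)"
    and "\<one>\<^bsub>quot_algebra A I\<^esub> = I +> \<one>"
    and "\<zero>\<^bsub>quot_algebra A I\<^esub> = I +> \<zero>"
    and "I +> x \<in> carrier (quot_algebra A I)"
proof -
  interpret I: ideal I A by fact
  show "(I +> x) \<otimes>\<^bsub>quot_algebra A I\<^esub> (I +> y) = I +> (x \<otimes> y)"
    using x y by (simp add: quot_algebra_def FactRing_def I.rcoset_mult_add)
  show "(I +> x) \<oplus>\<^bsub>quot_algebra A I\<^esub> (I +> y) = I +> (x \<oplus> y)"
    using x y by (simp add: quot_algebra_def FactRing_def I.a_rcos_sum)
  show "\<one>\<^bsub>quot_algebra A I\<^esub> = I +> \<one>"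
    by (simp add: quot_algebra_def FactRing_def)
  show "\<zero>\<^bsub>quot_algebra A I\<^esub> = I +> \<zero>"
    by (simp add: quot_algebra_def FactRing_def I.a_subset)
  show "I +> x \<in> carrier (quot_algebra A I)"
    using x by (simp add: quot_algebra_def FactRing_def a_rcosetsI I.a_subset)
  have "c \<odot>\<^bsub>quot_algebra A I\<^esub> (I +> x) = (\<Union>x'\<in>I +> x. I +> (c \<odot> x'))"
    by (simp add: quot_algebra_def)
  also have "\<dots> = I +> (c \<odot> x)"
  proof (rule UN_const_image)
    show "I +> x \<noteq> {}" using coset_self[OF I x] by blast
    fix x' assume x': "x' \<in> I +> x"
    note x'c = coset_memD[OF I x x']
    have "x' \<ominus> x \<in> I" using coset_eq_iff[OF I x'c(1) x] x'c(2) by simp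
    then have "(c \<odot> \<one>) \<otimes> (x' \<ominus> x) \<in> I" by (intro I.I_l_closed) auto
    also have "(c \<odot> \<one>) \<otimes> (x' \<ominus> x) = c \<odot> (x' \<oplus> (-1) \<odot> x)"
      using x x'c by (simp add: smult_mult_left smult_minus_1 a_minus_def)
    also have "\<dots> = c \<odot> x' \<oplus> (-1) \<odot> (c \<odot> x)"
      using x x'c by (simp add: smult_add_right smult_smult[symmetric])
    also have "\<dots> = c \<odot> x' \<ominus> c \<odot> x"
      using x x'c by (simp add: smult_minus_1 a_minus_def)
    finally show "I +> (c \<odot> x') = I +> (c \<odot> x)"
      using coset_eq_iff[OF I] x x'c by simp
  qed
  finally show "c \<odot>\<^bsub>quot_algebra A I\<^esub> (I +> x) = I +> (c \<odot> x)" .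
qed

lemma quot_algebra_carrierE:
  assumes "X \<in> carrier (quot_algebra A I)"
  obtains x where "x \<in> carrier A" "X = I +> x"
  using assms by (auto simp: quot_algebra_def FactRing_def A_RCOSETS_defs a_r_coset_def)

lemma complex_algebra_quot:
  assumes I: "ideal I A"
  shows "complex_algebra (quot_algebra A I)" (is "complex_algebra ?Q")
proof -
  note q = quot_algebra_simps[OF I]
  have z: "\<zero> \<in> carrier A" by simp
  have "ring ?Q"
  proof (rule ringI)
    show "abelian_group ?Q"
    proof (rule abelian_groupI)
      fix X Y Z assume "X \<in> carrier ?Q" "Y \<in> carrier ?Q" "Z \<in> carrier ?Q"
      then obtain x y z where "x \<in> carrier A" "X = I +> x" "y \<in> carrier A" "Y = I +> y"
        "z \<in> carrier A" "Z = I +> z" by (metis quot_algebra_carrierE)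
      then show "X \<oplus>\<^bsub>?Q\<^esub> Y \<oplus>\<^bsub>?Q\<^esub> Z = X \<oplus>\<^bsub>?Q\<^esub> (Y \<oplus>\<^bsub>?Q\<^esub> Z)" by (simp add: q a_assoc)
    next
      fix X Y assume "X \<in> carrier ?Q" "Y \<in> carrier ?Q"
      then obtain x y where "x \<in> carrier A" "X = I +> x" "y \<in> carrier A" "Y = I +> y"
        by (metis quot_algebra_carrierE)
      then show "X \<oplus>\<^bsub>?Q\<^esub> Y = Y \<oplus>\<^bsub>?Q\<^esub> X" "X \<oplus>\<^bsub>?Q\<^esub> Y \<in> carrier ?Q" by (simp_all add: q a_comm)
    next
      fix X assume "X \<in> carrier ?Q"
      then obtain x where x: "x \<in> carrier A" "X = I +> x" by (metis quot_algebra_carrierE)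
      then show "\<zero>\<^bsub>?Q\<^esub> \<oplus>\<^bsub>?Q\<^esub> X = X" using q[OF z z] by (simp add: q)
      have "(I +> (\<ominus> x)) \<oplus>\<^bsub>?Q\<^esub> X = \<zero>\<^bsub>?Q\<^esub>" using x q(5)[OF z z] by (simp add: q l_neg)
      then show "\<exists>Y\<in>carrier ?Q. Y \<oplus>\<^bsub>?Q\<^esub> X = \<zero>\<^bsub>?Q\<^esub>" using q(6)[of "\<ominus> x" "\<ominus> x"] x by auto
    next
      show "\<zero>\<^bsub>?Q\<^esub> \<in> carrier ?Q" using q(5,6)[OF z z] by simp
    qed
    show "Group.monoid ?Q"
    proof (rule monoidI)
      fix X Y Z assume "X \<in> carrier ?Q" "Y \<in> carrier ?Q" "Z \<in> carrier ?Q"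
      then obtain x y z where "x \<in> carrier A" "X = I +> x" "y \<in> carrier A" "Y = I +> y"
        "z \<in> carrier A" "Z = I +> z" by (metis quot_algebra_carrierE)
      then show "X \<otimes>\<^bsub>?Q\<^esub> Y \<otimes>\<^bsub>?Q\<^esub> Z = X \<otimes>\<^bsub>?Q\<^esub> (Y \<otimes>\<^bsub>?Q\<^esub> Z)" by (simp add: q m_assoc)
    next
      fix X Y assume "X \<in> carrier ?Q" "Y \<in> carrier ?Q"
      then obtain x y where "x \<in> carrier A" "X = I +> x" "y \<in> carrier A" "Y = I +> y"
        by (metis quot_algebra_carrierE)
      then show "X \<otimes>\<^bsub>?Q\<^esub> Y \<in> carrier ?Q" by (simp add: q)
    next
      fix X assume "X \<in> carrier ?Q"
      then obtain x where x: "x \<in> carrier A" "X = I +> x" by (metis quot_algebra_carrierE)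
      then show "\<one>\<^bsub>?Q\<^esub> \<otimes>\<^bsub>?Q\<^esub> X = X" "X \<otimes>\<^bsub>?Q\<^esub> \<one>\<^bsub>?Q\<^esub> = X" using q(4)[OF z z] by (simp_all add: q)
    next
      show "\<one>\<^bsub>?Q\<^esub> \<in> carrier ?Q" using q(4,6)[of \<one> \<one>] by simp
    qed
    fix X Y Z assume "X \<in> carrier ?Q" "Y \<in> carrier ?Q" "Z \<in> carrier ?Q"
    then obtain x y z where "x \<in> carrier A" "X = I +> x" "y \<in> carrier A" "Y = I +> y"
      "z \<in> carrier A" "Z = I +> z" by (metis quot_algebra_carrierE)
    then show "(X \<oplus>\<^bsub>?Q\<^esub> Y) \<otimes>\<^bsub>?Q\<^esub> Z = X \<otimes>\<^bsub>?Q\<^esub> Z \<oplus>\<^bsub>?Q\<^esub> Y \<otimes>\<^bsub>?Q\<^esub> Z"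
      "Z \<otimes>\<^bsub>?Q\<^esub> (X \<oplus>\<^bsub>?Q\<^esub> Y) = Z \<otimes>\<^bsub>?Q\<^esub> X \<oplus>\<^bsub>?Q\<^esub> Z \<otimes>\<^bsub>?Q\<^esub> Y"
      by (simp_all add: q l_distr r_distr)
  qed
  then show ?thesis
  proof (rule complex_algebraI)
    fix c d X assume "X \<in> carrier ?Q"
    then obtain x where x: "x \<in> carrier A" "X = I +> x" by (metis quot_algebra_carrierE)
    then show "c \<odot>\<^bsub>?Q\<^esub> X \<in> carrier ?Q" "(c + d) \<odot>\<^bsub>?Q\<^esub> X = c \<odot>\<^bsub>?Q\<^esub> X \<oplus>\<^bsub>?Q\<^esub> d \<odot>\<^bsub>?Q\<^esub> X"
      "(c * d) \<odot>\<^bsub>?Q\<^esub> X = c \<odot>\<^bsub>?Q\<^esub> (d \<odot>\<^bsub>?Q\<^esub> X)" "1 \<odot>\<^bsub>?Q\<^esub> X = X"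
      by (simp_all add: q smult_simps)
  next
    fix c X Y assume "X \<in> carrier ?Q" "Y \<in> carrier ?Q"
    then obtain x y where x: "x \<in> carrier A" "X = I +> x" and y: "y \<in> carrier A" "Y = I +> y"
      by (metis quot_algebra_carrierE)
    then show "c \<odot>\<^bsub>?Q\<^esub> (X \<oplus>\<^bsub>?Q\<^esub> Y) = c \<odot>\<^bsub>?Q\<^esub> X \<oplus>\<^bsub>?Q\<^esub> c \<odot>\<^bsub>?Q\<^esub> Y"
      "(c \<odot>\<^bsub>?Q\<^esub> X) \<otimes>\<^bsub>?Q\<^esub> Y = c \<odot>\<^bsub>?Q\<^esub> (X \<otimes>\<^bsub>?Q\<^esub> Y)" "X \<otimes>\<^bsub>?Q\<^esub> (c \<odot>\<^bsub>?Q\<^esub> Y) = c \<odot>\<^bsub>?Q\<^esub> (X \<otimes>\<^bsub>?Q\<^esub> Y)"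
      by (simp_all add: q smult_simps smult_mult_left smult_mult_right)
  qed
qed

end

section \<open>Presented algebras\<close>

lemma free_monoid: "Group.monoid \<lparr>carrier = UNIV, monoid.mult = (@), one = []\<rparr>"
  by (rule monoidI) auto

lemma complex_algebra_free: "complex_algebra free_star_algebra"
  unfolding free_star_algebra_def by (rule complex_algebra_monoid_algebra[OF free_monoid])

abbreviation free_mult (infixl \<open>\<star>\<close> 70) where
  "f \<star> g \<equiv> f \<otimes>\<^bsub>free_star_algebra\<^esub> g"

lemma free_star_algebra_simps [simp]:
  "carrier free_star_algebra = UNIV"
  "\<one>\<^bsub>free_star_algebra\<^esub> = single [] 1"
  "\<zero>\<^bsub>free_star_algebra\<^esub> = 0"
  "f \<oplus>\<^bsub>free_star_algebra\<^esub> g = f + g"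
  "c \<odot>\<^bsub>free_star_algebra\<^esub> f = pm_scale c f"
  "single u c \<star> single v d = single (u @ v) (c * d)"
  by (simp_all add: free_star_algebra_def)

lemma free_star_algebra_mult_distrib:
  "(f + f') \<star> g = f \<star> g + f' \<star> g"
  "g \<star> (f + f') = g \<star> f + g \<star> f'"
  "(0 :: 's list \<Rightarrow>\<^sub>0 complex) \<star> g = 0"
  "g \<star> (0 :: 's list \<Rightarrow>\<^sub>0 complex) = 0"
  unfolding free_star_algebra_def
  by (simp_all add: monoid_algebra_distrib_left monoid_algebra_distrib_right)

definition word_eval :: "('b, 'y) star_algebra_scheme \<Rightarrow> ('s \<Rightarrow> 'b) \<Rightarrow> 's list \<Rightarrow> 'b" where
  "word_eval B \<phi> w = foldr (\<lambda>s y. \<phi> s \<otimes>\<^bsub>B\<^esub> y) w \<one>\<^bsub>B\<^esub>"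

lemma word_eval_simps [simp]:
  "word_eval B \<phi> [] = \<one>\<^bsub>B\<^esub>" "word_eval B \<phi> (s # w) = \<phi> s \<otimes>\<^bsub>B\<^esub> word_eval B \<phi> w"
  by (simp_all add: word_eval_def)

lemma nc_eval_lin_ext: "nc_eval B \<phi> = lin_ext B (word_eval B \<phi>)"
  by (rule ext) (simp add: nc_eval_def lin_ext_def word_eval_def)

context complex_algebra
begin

lemma word_eval_closed: "\<phi> \<in> UNIV \<rightarrow> carrier A \<Longrightarrow> word_eval A \<phi> w \<in> carrier A"
  by (induction w) auto

lemma word_eval_append:
  "\<phi> \<in> UNIV \<rightarrow> carrier A \<Longrightarrow> word_eval A \<phi> (u @ v) = word_eval A \<phi> u \<otimes> word_eval A \<phi> v"
  by (induction u) (auto simp: word_eval_closed m_assoc Pi_iff)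

lemma nc_eval_simps:
  assumes "\<phi> \<in> UNIV \<rightarrow> carrier A"
  shows "nc_eval A \<phi> f \<in> carrier A"
    and "nc_eval A \<phi> (f + g) = nc_eval A \<phi> f \<oplus> nc_eval A \<phi> g"
    and "nc_eval A \<phi> (f - g) = nc_eval A \<phi> f \<ominus> nc_eval A \<phi> g"
    and "nc_eval A \<phi> (single w c) = c \<odot> word_eval A \<phi> w"
    and "nc_eval A \<phi> 0 = \<zero>"
    and "nc_eval A \<phi> (pm_scale c f) = c \<odot> nc_eval A \<phi> f"
proof -
  have w: "word_eval A \<phi> \<in> S \<rightarrow> carrier A" for S using word_eval_closed[OF assms] by auto
  show "nc_eval A \<phi> f \<in> carrier A" unfolding nc_eval_lin_ext by (rule lin_ext_closed[OF w])
  show "nc_eval A \<phi> (f + g) = nc_eval A \<phi> f \<oplus> nc_eval A \<phi> g"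
    unfolding nc_eval_lin_ext by (rule lin_ext_add[OF subset_UNIV subset_UNIV w])
  show "nc_eval A \<phi> (f - g) = nc_eval A \<phi> f \<ominus> nc_eval A \<phi> g"
    unfolding nc_eval_lin_ext by (rule lin_ext_diff[OF subset_UNIV subset_UNIV w])
  show "nc_eval A \<phi> (single w c) = c \<odot> word_eval A \<phi> w"
    unfolding nc_eval_lin_ext by (rule lin_ext_single) (rule word_eval_closed[OF assms])
  show "nc_eval A \<phi> 0 = \<zero>" unfolding nc_eval_lin_ext by simp
  show "nc_eval A \<phi> (pm_scale c f) = c \<odot> nc_eval A \<phi> f"
    unfolding nc_eval_lin_ext by (rule lin_ext_scale[OF w])
qed

lemma nc_eval_mult:
  assumes \<phi>: "\<phi> \<in> UNIV \<rightarrow> carrier A"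
  shows "nc_eval A \<phi> (f \<star> g) = nc_eval A \<phi> f \<otimes> nc_eval A \<phi> g"
proof -
  note e = nc_eval_simps[OF \<phi>] and w = word_eval_closed[OF \<phi>]
  show ?thesis
    using subset_UNIV[of "keys f"]
  proof (induction rule: poly_mapping_induct_keys)
    case (single u c)
    show ?case using subset_UNIV[of "keys g"]
    proof (induction rule: poly_mapping_induct_keys)
      case (single v d)
      show ?case
        by (simp add: e w word_eval_append[OF \<phi>] smult_mult_left smult_mult_right smult_smult[symmetric] ac_simps)
    qed (simp_all add: e free_star_algebra_mult_distrib r_distr w)
  qed (simp_all add: e free_star_algebra_mult_distrib l_distr)
qed

text \<open>
  The polynomials on which \<open>nc_eval\<close> vanishes form an ideal, since \<open>nc_eval\<close> is multiplicative. So
  \<open>nc_eval\<close> is constant on cosets, and the choice of representative in \<open>presented_hom\<close> is immaterial.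
\<close>

lemma presented_hom_coset:
  assumes \<phi>: "\<phi> \<in> UNIV \<rightarrow> carrier A" and R: "\<And>r. r \<in> R \<Longrightarrow> nc_eval A \<phi> r = \<zero>"
  shows "presented_hom A \<phi> ((Idl\<^bsub>free_star_algebra\<^esub> R) +>\<^bsub>free_star_algebra\<^esub> f) = nc_eval A \<phi> f"
proof -
  interpret F: complex_algebra "free_star_algebra :: ('b list \<Rightarrow>\<^sub>0 complex) star_algebra"
    by (rule complex_algebra_free)
  note e = nc_eval_simps[OF \<phi>]
  let ?I = "Idl\<^bsub>free_star_algebra\<^esub> R"
  have I: "ideal ?I free_star_algebra" by (rule F.genideal_ideal) simp
  have "ideal {f. nc_eval A \<phi> f = \<zero>} free_star_algebra"
    by (rule F.idealI') (auto simp: e nc_eval_mult[OF \<phi>])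
  then have sub: "?I \<subseteq> {f. nc_eval A \<phi> f = \<zero>}"
    using R by (intro F.genideal_minimal) auto
  have "nc_eval A \<phi> ` (?I +>\<^bsub>free_star_algebra\<^esub> f) = {nc_eval A \<phi> f}"
  proof
    show "nc_eval A \<phi> ` (?I +>\<^bsub>free_star_algebra\<^esub> f) \<subseteq> {nc_eval A \<phi> f}"
      using sub by (auto simp: a_r_coset_def' e)
    show "{nc_eval A \<phi> f} \<subseteq> nc_eval A \<phi> ` (?I +>\<^bsub>free_star_algebra\<^esub> f)"
      using F.coset_self[OF I] by simp
  qed
  then show ?thesis by (simp add: presented_hom_def)
qed

end

section \<open>Tensor products\<close>

definition bilinear_on ::
  "('a, 'x) star_algebra_scheme \<Rightarrow> ('b, 'y) star_algebra_scheme \<Rightarrow> ('c, 'z) star_algebra_scheme \<Rightarrow>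
    ('a \<Rightarrow> 'b \<Rightarrow> 'c) \<Rightarrow> bool" where
  "bilinear_on A B C \<beta> \<longleftrightarrow>
     (\<forall>a\<in>carrier A. \<forall>b\<in>carrier B. \<beta> a b \<in> carrier C) \<and>
     (\<forall>a\<in>carrier A. \<forall>a'\<in>carrier A. \<forall>b\<in>carrier B. \<beta> (a \<oplus>\<^bsub>A\<^esub> a') b = \<beta> a b \<oplus>\<^bsub>C\<^esub> \<beta> a' b) \<and>
     (\<forall>a\<in>carrier A. \<forall>b\<in>carrier B. \<forall>b'\<in>carrier B. \<beta> a (b \<oplus>\<^bsub>B\<^esub> b') = \<beta> a b \<oplus>\<^bsub>C\<^esub> \<beta> a b') \<and>
     (\<forall>c. \<forall>a\<in>carrier A. \<forall>b\<in>carrier B. \<beta> (c \<odot>\<^bsub>A\<^esub> a) b = c \<odot>\<^bsub>C\<^esub> \<beta> a b) \<and>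
     (\<forall>c. \<forall>a\<in>carrier A. \<forall>b\<in>carrier B. \<beta> a (c \<odot>\<^bsub>B\<^esub> b) = c \<odot>\<^bsub>C\<^esub> \<beta> a b)"

lemma bilinear_onD:
  assumes "bilinear_on A B C \<beta>"
  shows "a \<in> carrier A \<Longrightarrow> b \<in> carrier B \<Longrightarrow> \<beta> a b \<in> carrier C"
    and "a \<in> carrier A \<Longrightarrow> a' \<in> carrier A \<Longrightarrow> b \<in> carrier B \<Longrightarrow> \<beta> (a \<oplus>\<^bsub>A\<^esub> a') b = \<beta> a b \<oplus>\<^bsub>C\<^esub> \<beta> a' b"
    and "a \<in> carrier A \<Longrightarrow> b \<in> carrier B \<Longrightarrow> b' \<in> carrier B \<Longrightarrow> \<beta> a (b \<oplus>\<^bsub>B\<^esub> b') = \<beta> a b \<oplus>\<^bsub>C\<^esub> \<beta> a b'"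
    and "a \<in> carrier A \<Longrightarrow> b \<in> carrier B \<Longrightarrow> \<beta> (c \<odot>\<^bsub>A\<^esub> a) b = c \<odot>\<^bsub>C\<^esub> \<beta> a b"
    and "a \<in> carrier A \<Longrightarrow> b \<in> carrier B \<Longrightarrow> \<beta> a (c \<odot>\<^bsub>B\<^esub> b) = c \<odot>\<^bsub>C\<^esub> \<beta> a b"
  using assms unfolding bilinear_on_def by blast+

lemma tensor_lift_lin_ext:
  "tensor_lift C \<beta> t = the_elem (lin_ext C (\<lambda>p. \<beta> (fst p) (snd p)) ` t)"
  by (simp add: tensor_lift_def lin_ext_def)

lemma monoid_algebra_minus:
  assumes "Group.monoid M" "f \<in> carrier (monoid_algebra M \<tau>)" "g \<in> carrier (monoid_algebra M \<tau>)"
  shows "f \<ominus>\<^bsub>monoid_algebra M \<tau>\<^esub> g = f - g"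
proof -
  interpret complex_algebra "monoid_algebra M \<tau>" by (rule complex_algebra_monoid_algebra) fact
  have "\<ominus>\<^bsub>monoid_algebra M \<tau>\<^esub> g = - g"
    using assms by (intro minus_equality) auto
  then show ?thesis by (simp add: a_minus_def)
qed

locale tensor_pair = A: complex_algebra A + B: complex_algebra B
  for A :: "('a, 'x) star_algebra_scheme" and B :: "('b, 'y) star_algebra_scheme"
begin

abbreviation "F \<equiv> formal_tensor A B"
abbreviation "I \<equiv> Idl\<^bsub>F\<^esub> (tensor_rels A B)"
abbreviation "T \<equiv> tensor_algebra A B"

abbreviation "cls f \<equiv> I +>\<^bsub>F\<^esub> f"

lemma monoid_prod: "Group.monoid (A \<times>\<times> B)"
  by (rule DirProd_monoid[OF A.is_monoid B.is_monoid])

sublocale F: complex_algebra F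
  unfolding formal_tensor_def by (rule complex_algebra_monoid_algebra[OF monoid_prod])

lemma F_simps [simp]:
  "carrier F = {f. keys f \<subseteq> carrier A \<times> carrier B}"
  "\<one>\<^bsub>F\<^esub> = single (\<one>\<^bsub>A\<^esub>, \<one>\<^bsub>B\<^esub>) 1" "\<zero>\<^bsub>F\<^esub> = 0" "f \<oplus>\<^bsub>F\<^esub> g = f + g" "c \<odot>\<^bsub>F\<^esub> f = pm_scale c f"
  "single (a, b) c \<otimes>\<^bsub>F\<^esub> single (a', b') d
    = single (a \<otimes>\<^bsub>A\<^esub> a', b \<otimes>\<^bsub>B\<^esub> b') (c * d)"
  by (simp_all add: formal_tensor_def)

lemma F_distrib:
  "(f + f') \<otimes>\<^bsub>F\<^esub> g = f \<otimes>\<^bsub>F\<^esub> g + f' \<otimes>\<^bsub>F\<^esub> g" "g \<otimes>\<^bsub>F\<^esub> (f + f') = g \<otimes>\<^bsub>F\<^esub> f + g \<otimes>\<^bsub>F\<^esub> f'"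
  "0 \<otimes>\<^bsub>F\<^esub> g = 0" "g \<otimes>\<^bsub>F\<^esub> 0 = 0"
  "(\<Sum>i\<in>X. h i) \<otimes>\<^bsub>F\<^esub> g = (\<Sum>i\<in>X. h i \<otimes>\<^bsub>F\<^esub> g)" "g \<otimes>\<^bsub>F\<^esub> (\<Sum>i\<in>X. h i) = (\<Sum>i\<in>X. g \<otimes>\<^bsub>F\<^esub> h i)"
  unfolding formal_tensor_def
  by (simp_all add: monoid_algebra_distrib_left monoid_algebra_distrib_right
      monoid_algebra_mult_sum_left monoid_algebra_mult_sum_right)

lemma F_minus: "f \<in> carrier F \<Longrightarrow> g \<in> carrier F \<Longrightarrow> f \<ominus>\<^bsub>F\<^esub> g = f - g"
  using monoid_algebra_minus[OF monoid_prod] unfolding formal_tensor_def by blast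

lemma rels_carrier: "tensor_rels A B \<subseteq> carrier F"
proof
  fix r assume "r \<in> tensor_rels A B"
  then have "keys r \<subseteq> carrier A \<times> carrier B"
    unfolding tensor_rels_def
    by (elim UnE CollectE exE conjE; hypsubst; intro keys_diff_subset) simp_all
  then show "r \<in> carrier F" by simp
qed

lemma ideal_I: "ideal I F"
  by (rule F.genideal_ideal[OF rels_carrier])

sublocale T: complex_algebra T
  unfolding tensor_algebra_def by (rule F.complex_algebra_quot[OF ideal_I])

lemma lin_ext_rel:
  assumes C: "complex_algebra C" and \<beta>: "bilinear_on A B C \<beta>" and r: "r \<in> tensor_rels A B"
  shows "lin_ext C (\<lambda>p. \<beta> (fst p) (snd p)) r = \<zero>\<^bsub>C\<^esub>"
proof -
  interpret C: complex_algebra C by fact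
  let ?b = "\<lambda>p. \<beta> (fst p) (snd p)"
  note b = bilinear_onD[OF \<beta>]
  have cl: "?b \<in> carrier A \<times> carrier B \<rightarrow> carrier C" using b(1) by auto
  note d = C.lin_ext_diff[OF _ _ cl]
  have s: "lin_ext C ?b (single (a, b) c) = c \<odot>\<^bsub>C\<^esub> \<beta> a b"
    if "a \<in> carrier A" "b \<in> carrier B" for a b c
    using C.lin_ext_single[of ?b "(a, b)" c] b(1) that by simp
  have k: "keys (single (a, b) c) \<subseteq> carrier A \<times> carrier B"
    if "a \<in> carrier A" "b \<in> carrier B" for a b and c :: complex
    using that by simp
  have kd: "keys (single (a, b) c - single (a', b') c') \<subseteq> carrier A \<times> carrier B"
    if "a \<in> carrier A" "b \<in> carrier B" "a' \<in> carrier A" "b' \<in> carrier B" for a b a' b' and c c' :: complex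
    using that by (intro keys_diff_subset k)
  have cancel: "x \<oplus>\<^bsub>C\<^esub> y \<ominus>\<^bsub>C\<^esub> x \<ominus>\<^bsub>C\<^esub> y = \<zero>\<^bsub>C\<^esub>" if "x \<in> carrier C" "y \<in> carrier C" for x y
    using that by (simp add: a_minus_def C.a_assoc C.a_comm[of y] C.r_neg C.r_neg1 C.r_neg2)
  consider
    (1) a a' b where "r = single (a \<oplus>\<^bsub>A\<^esub> a', b) 1 - single (a, b) 1 - single (a', b) 1"
      "a \<in> carrier A" "a' \<in> carrier A" "b \<in> carrier B"
  | (2) a b b' where "r = single (a, b \<oplus>\<^bsub>B\<^esub> b') 1 - single (a, b) 1 - single (a, b') 1"
      "a \<in> carrier A" "b \<in> carrier B" "b' \<in> carrier B"
  | (3) c a b where "r = single (c \<odot>\<^bsub>A\<^esub> a, b) 1 - single (a, b) c" "a \<in> carrier A" "b \<in> carrier B"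
  | (4) c a b where "r = single (a, c \<odot>\<^bsub>B\<^esub> b) 1 - single (a, b) c" "a \<in> carrier A" "b \<in> carrier B"
    using r unfolding tensor_rels_def by blast
  then show ?thesis
  proof cases
    case 1
    then show ?thesis
      by (simp only: d[OF kd k] d[OF k k] A.a_closed s b) (simp add: b cancel)
  next
    case 2
    then show ?thesis
      by (simp only: d[OF kd k] d[OF k k] B.a_closed s b) (simp add: b cancel)
  next
    case 3
    then show ?thesis
      by (simp only: d[OF k k] A.smult_closed' s b) (simp add: b C.r_neg a_minus_def)
  next
    case 4
    then show ?thesis
      by (simp only: d[OF k k] B.smult_closed' s b) (simp add: b C.r_neg a_minus_def)
  qed
qed

lemma lin_ext_mult_single:
  assumes C: "complex_algebra C" and \<beta>: "bilinear_on A B C \<beta>"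
    and a: "a \<in> carrier A" "b \<in> carrier B" and f: "f \<in> carrier F"
  shows "lin_ext C (\<lambda>p. \<beta> (fst p) (snd p)) (single (a, b) c \<otimes>\<^bsub>F\<^esub> f)
      = c \<odot>\<^bsub>C\<^esub> lin_ext C (\<lambda>p. \<beta> (a \<otimes>\<^bsub>A\<^esub> fst p) (b \<otimes>\<^bsub>B\<^esub> snd p)) f"
    and "lin_ext C (\<lambda>p. \<beta> (fst p) (snd p)) (f \<otimes>\<^bsub>F\<^esub> single (a, b) c)
      = c \<odot>\<^bsub>C\<^esub> lin_ext C (\<lambda>p. \<beta> (fst p \<otimes>\<^bsub>A\<^esub> a) (snd p \<otimes>\<^bsub>B\<^esub> b)) f"
proof -
  interpret C: complex_algebra C by fact
  note b = bilinear_onD[OF \<beta>]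
  let ?S = "carrier A \<times> carrier B"
  have cl: "(\<lambda>p. \<beta> (fst p) (snd p)) \<in> ?S \<rightarrow> carrier C"
    "(\<lambda>p. \<beta> (a \<otimes>\<^bsub>A\<^esub> fst p) (b \<otimes>\<^bsub>B\<^esub> snd p)) \<in> ?S \<rightarrow> carrier C"
    "(\<lambda>p. \<beta> (fst p \<otimes>\<^bsub>A\<^esub> a) (snd p \<otimes>\<^bsub>B\<^esub> b)) \<in> ?S \<rightarrow> carrier C"
    using b(1) a by auto
  have m: "keys (single (a, b) c \<otimes>\<^bsub>F\<^esub> g) \<subseteq> ?S"
    "keys (g \<otimes>\<^bsub>F\<^esub> single (a, b) c) \<subseteq> ?S"
    if "keys g \<subseteq> ?S" for g
    using F.m_closed[of "single (a, b) c" g] F.m_closed[of g "single (a, b) c"] that a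
    by auto
  have k: "lin_ext C h g \<in> carrier C" if "keys g \<subseteq> ?S" "h \<in> ?S \<rightarrow> carrier C" for g h
    using that by (intro C.lin_ext_closed) auto
  have f': "keys f \<subseteq> ?S" using f by simp
  show "lin_ext C (\<lambda>p. \<beta> (fst p) (snd p)) (single (a, b) c \<otimes>\<^bsub>F\<^esub> f)
      = c \<odot>\<^bsub>C\<^esub> lin_ext C (\<lambda>p. \<beta> (a \<otimes>\<^bsub>A\<^esub> fst p) (b \<otimes>\<^bsub>B\<^esub> snd p)) f"
    using f'
  proof (induction rule: poly_mapping_induct_keys)
    case zero
    show ?case by (simp add: F_distrib)
  next
    case (single p d)
    then show ?case using a b(1)
      by (cases p) (simp add: C.lin_ext_single C.smult_smult)
  next
    case (add f g)
    then show ?case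
      by (simp add: F_distrib C.lin_ext_add[OF m(1) m(1) cl(1)] C.lin_ext_add[OF _ _ cl(2)] C.smult_add_right k cl)
  qed
  show "lin_ext C (\<lambda>p. \<beta> (fst p) (snd p)) (f \<otimes>\<^bsub>F\<^esub> single (a, b) c)
      = c \<odot>\<^bsub>C\<^esub> lin_ext C (\<lambda>p. \<beta> (fst p \<otimes>\<^bsub>A\<^esub> a) (snd p \<otimes>\<^bsub>B\<^esub> b)) f"
    using f'
  proof (induction rule: poly_mapping_induct_keys)
    case zero
    show ?case by (simp add: F_distrib)
  next
    case (single p d)
    then show ?case using a b(1)
      by (cases p) (simp add: C.lin_ext_single C.smult_smult[symmetric] mult.commute)
  next
    case (add f g)
    then show ?case
      by (simp add: F_distrib C.lin_ext_add[OF m(2) m(2) cl(1)] C.lin_ext_add[OF _ _ cl(3)] C.smult_add_right k cl)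
  qed
qed

text \<open>
  The elements annihilated by the linear extensions of all bilinear maps into \<open>C\<close> form an ideal:
  multiplying by a pure tensor replaces \<open>\<beta>\<close> by another bilinear map. All bilinear maps have to be
  treated at once for this argument.
\<close>

lemma lin_ext_ideal:
  assumes C: "complex_algebra (C :: ('c, 'z) star_algebra_scheme)" and \<beta>: "bilinear_on A B C \<beta>" and f: "f \<in> I"
  shows "lin_ext C (\<lambda>p. \<beta> (fst p) (snd p)) f = \<zero>\<^bsub>C\<^esub>"
proof -
  interpret C: complex_algebra C by fact
  let ?S = "carrier A \<times> carrier B"
  define J where "J = {f \<in> carrier F. \<forall>\<beta>. bilinear_on A B C \<beta> \<longrightarrow> lin_ext C (\<lambda>p. \<beta> (fst p) (snd p)) f = \<zero>\<^bsub>C\<^esub>}"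
  have cl: "(\<lambda>p. \<beta> (fst p) (snd p)) \<in> ?S \<rightarrow> carrier C" if "bilinear_on A B C \<beta>" for \<beta>
    using bilinear_onD(1)[OF that] by auto
  have J_add: "x + y \<in> J" if "x \<in> J" "y \<in> J" for x y
    using that C.lin_ext_add[OF _ _ cl] unfolding J_def by (simp add: keys_add_subset)
  have J_zero: "0 \<in> J" unfolding J_def by simp
  have left: "bilinear_on A B C (\<lambda>x y. \<beta> (a \<otimes>\<^bsub>A\<^esub> x) (b \<otimes>\<^bsub>B\<^esub> y))"
    and right: "bilinear_on A B C (\<lambda>x y. \<beta> (x \<otimes>\<^bsub>A\<^esub> a) (y \<otimes>\<^bsub>B\<^esub> b))"
    if "bilinear_on A B C \<beta>" "a \<in> carrier A" "b \<in> carrier B" for \<beta> a b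
    using that(2,3) bilinear_onD[OF that(1)] unfolding bilinear_on_def
    by (simp_all add: A.r_distr B.r_distr A.l_distr B.l_distr A.smult_mult_left A.smult_mult_right
        B.smult_mult_left B.smult_mult_right)
  have "ideal J F"
  proof (rule F.idealI')
    show "J \<subseteq> carrier F" unfolding J_def by blast
    show "\<zero>\<^bsub>F\<^esub> \<in> J" using J_zero by simp
    show "x \<oplus>\<^bsub>F\<^esub> y \<in> J" if "x \<in> J" "y \<in> J" for x y using J_add that by simp
    fix x y assume x: "x \<in> J" and y: "y \<in> carrier F"
    then have xF: "x \<in> carrier F" by (simp add: J_def)
    from y have y': "keys y \<subseteq> ?S" by simp
    show "y \<otimes>\<^bsub>F\<^esub> x \<in> J" using y'
    proof (induction rule: poly_mapping_induct_keys)
      case (single p c)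
      obtain a b where p: "p = (a, b)" "a \<in> carrier A" "b \<in> carrier B" using single by (cases p) auto
      have "single p c \<otimes>\<^bsub>F\<^esub> x \<in> carrier F" using p xF by (intro F.m_closed) auto
      moreover have "lin_ext C (\<lambda>p. \<beta> (fst p) (snd p)) (single p c \<otimes>\<^bsub>F\<^esub> x) = \<zero>\<^bsub>C\<^esub>"
        if \<beta>: "bilinear_on A B C \<beta>" for \<beta>
      proof -
        have "\<forall>\<gamma>. bilinear_on A B C \<gamma> \<longrightarrow> lin_ext C (\<lambda>p. \<gamma> (fst p) (snd p)) x = \<zero>\<^bsub>C\<^esub>"
          using x unfolding J_def by blast
        from spec[OF this, of "\<lambda>x y. \<beta> (a \<otimes>\<^bsub>A\<^esub> x) (b \<otimes>\<^bsub>B\<^esub> y)"] left[OF \<beta> p(2,3)] show ?thesis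
          unfolding p(1) lin_ext_mult_single(1)[OF C \<beta> p(2,3) xF] by simp
      qed
      ultimately show ?case unfolding J_def by blast
    qed (auto simp: F_distrib J_zero intro: J_add)
    show "x \<otimes>\<^bsub>F\<^esub> y \<in> J" using y'
    proof (induction rule: poly_mapping_induct_keys)
      case (single p c)
      obtain a b where p: "p = (a, b)" "a \<in> carrier A" "b \<in> carrier B" using single by (cases p) auto
      have "x \<otimes>\<^bsub>F\<^esub> single p c \<in> carrier F" using p xF by (intro F.m_closed) auto
      moreover have "lin_ext C (\<lambda>p. \<beta> (fst p) (snd p)) (x \<otimes>\<^bsub>F\<^esub> single p c) = \<zero>\<^bsub>C\<^esub>"
        if \<beta>: "bilinear_on A B C \<beta>" for \<beta>
      proof -
        have "\<forall>\<gamma>. bilinear_on A B C \<gamma> \<longrightarrow> lin_ext C (\<lambda>p. \<gamma> (fst p) (snd p)) x = \<zero>\<^bsub>C\<^esub>"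
          using x unfolding J_def by blast
        from spec[OF this, of "\<lambda>x y. \<beta> (x \<otimes>\<^bsub>A\<^esub> a) (y \<otimes>\<^bsub>B\<^esub> b)"] right[OF \<beta> p(2,3)] show ?thesis
          unfolding p(1) lin_ext_mult_single(2)[OF C \<beta> p(2,3) xF] by simp
      qed
      ultimately show ?case unfolding J_def by blast
    qed (auto simp: F_distrib J_zero intro: J_add)
  qed
  moreover have "tensor_rels A B \<subseteq> J"
    using rels_carrier lin_ext_rel[OF C] unfolding J_def by blast
  ultimately have "I \<subseteq> J" by (rule F.genideal_minimal)
  then show ?thesis using f \<beta> unfolding J_def by blast
qed

lemma tensor_lift_coset:
  assumes C: "complex_algebra (C :: ('c, 'z) star_algebra_scheme)" and \<beta>: "bilinear_on A B C \<beta>" and f: "f \<in> carrier F"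
  shows "tensor_lift C \<beta> (cls f) = lin_ext C (\<lambda>p. \<beta> (fst p) (snd p)) f"
proof -
  interpret C: complex_algebra C by fact
  let ?e = "lin_ext C (\<lambda>p. \<beta> (fst p) (snd p))"
  interpret I: ideal I F by (rule ideal_I)
  have cl: "(\<lambda>p. \<beta> (fst p) (snd p)) \<in> carrier A \<times> carrier B \<rightarrow> carrier C"
    using bilinear_onD(1)[OF \<beta>] by auto
  have "?e (i + f) = ?e f" if "i \<in> I" for i
  proof -
    have "i \<in> carrier F" using that I.a_Hcarr by blast
    then have "?e (i + f) = ?e i \<oplus>\<^bsub>C\<^esub> ?e f" using f by (intro C.lin_ext_add[OF _ _ cl]) auto
    moreover have "?e f \<in> carrier C" using f cl by (intro C.lin_ext_closed) auto
    ultimately show ?thesis using lin_ext_ideal[OF C \<beta> that] by simp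
  qed
  then have "?e ` (cls f) = {?e f}"
    using F.coset_self[OF ideal_I f] by (auto simp: a_r_coset_def')
  then show ?thesis by (simp add: tensor_lift_lin_ext)
qed

lemma T_simps:
  assumes "f \<in> carrier F" "g \<in> carrier F"
  shows "cls f \<otimes>\<^bsub>T\<^esub> cls g = cls (f \<otimes>\<^bsub>F\<^esub> g)"
    and "cls f \<oplus>\<^bsub>T\<^esub> cls g = cls (f + g)"
    and "c \<odot>\<^bsub>T\<^esub> cls f = cls (pm_scale c f)"
    and "\<one>\<^bsub>T\<^esub> = cls (single (\<one>\<^bsub>A\<^esub>, \<one>\<^bsub>B\<^esub>) 1)"
    and "\<zero>\<^bsub>T\<^esub> = cls 0"
    and "cls f \<in> carrier T"
  using F.quot_algebra_simps[OF ideal_I assms] by (simp_all add: tensor_algebra_def)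

lemma T_coset_eq:
  "f \<in> carrier F \<Longrightarrow> g \<in> carrier F \<Longrightarrow> cls f = cls g \<longleftrightarrow> f - g \<in> I"
  using F.coset_eq_iff[OF ideal_I] F_minus by metis

lemma pure_bilinear: "bilinear_on A B T (pure_tensor A B)"
proof -
  have r: "r \<in> I" if "r \<in> tensor_rels A B" for r
    using F.genideal_self[OF rels_carrier] that by blast
  have s: "single (a, b) c \<in> carrier F" if "a \<in> carrier A" "b \<in> carrier B" for a b c
    using that by simp
  have add: "single (a, b) 1 + single (a', b') 1 \<in> carrier F"
    if "a \<in> carrier A" "b \<in> carrier B" "a' \<in> carrier A" "b' \<in> carrier B" for a b a' b'
    using F.a_closed[OF s[of a b 1] s[of a' b' 1]] that by simp
  show ?thesis
    unfolding bilinear_on_def pure_tensor_def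
  proof (intro conjI ballI allI)
    fix a a' b assume h: "a \<in> carrier A" "a' \<in> carrier A" "b \<in> carrier B"
    have "single (a \<oplus>\<^bsub>A\<^esub> a', b) 1 - (single (a, b) 1 + single (a', b) 1) \<in> I"
      unfolding diff_diff_eq[symmetric] by (rule r) (use h in \<open>auto simp: tensor_rels_def\<close>)
    then show "cls (single (a \<oplus>\<^bsub>A\<^esub> a', b) 1)
      = cls (single (a, b) 1) \<oplus>\<^bsub>T\<^esub> cls (single (a', b) 1)"
      using h by (simp only: T_simps s T_coset_eq add A.a_closed)
  next
    fix a b b' assume h: "a \<in> carrier A" "b \<in> carrier B" "b' \<in> carrier B"
    have "single (a, b \<oplus>\<^bsub>B\<^esub> b') 1 - (single (a, b) 1 + single (a, b') 1) \<in> I"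
      unfolding diff_diff_eq[symmetric] by (rule r) (use h in \<open>auto simp: tensor_rels_def\<close>)
    then show "cls (single (a, b \<oplus>\<^bsub>B\<^esub> b') 1)
      = cls (single (a, b) 1) \<oplus>\<^bsub>T\<^esub> cls (single (a, b') 1)"
      using h by (simp only: T_simps s T_coset_eq add B.a_closed)
  next
    fix c a b assume h: "a \<in> carrier A" "b \<in> carrier B"
    have "single (c \<odot>\<^bsub>A\<^esub> a, b) 1 - single (a, b) c \<in> I"
      by (rule r) (use h in \<open>auto simp: tensor_rels_def\<close>)
    then show "cls (single (c \<odot>\<^bsub>A\<^esub> a, b) 1) = c \<odot>\<^bsub>T\<^esub> cls (single (a, b) 1)"
      using h by (simp only: T_simps(3)[OF s s] T_coset_eq s A.smult_closed' pm_scale_single mult_1_right)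
    have "single (a, c \<odot>\<^bsub>B\<^esub> b) 1 - single (a, b) c \<in> I"
      by (rule r) (use h in \<open>auto simp: tensor_rels_def\<close>)
    then show "cls (single (a, c \<odot>\<^bsub>B\<^esub> b) 1) = c \<odot>\<^bsub>T\<^esub> cls (single (a, b) 1)"
      using h by (simp only: T_simps(3)[OF s s] T_coset_eq s B.smult_closed' pm_scale_single mult_1_right)
    show "cls (single (a, b) 1) \<in> carrier T"
      using T_simps(6)[OF s s] h by blast
  qed
qed

lemma coset_finsum:
  assumes "finite X" "\<And>i. i \<in> X \<Longrightarrow> h i \<in> carrier F"
  shows "(\<Oplus>\<^bsub>T\<^esub>i\<in>X. cls (h i)) = cls (\<Sum>i\<in>X. h i)"
  using assms
proof (induction X rule: finite_induct)
  case empty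
  show ?case using T_simps(5)[of 0 0] by simp
next
  case (insert i X)
  have "(\<lambda>i. cls (h i)) \<in> insert i X \<rightarrow> carrier T" using insert.prems T_simps(6) by blast
  moreover have "(\<Sum>i\<in>X. h i) \<in> carrier F" using insert.prems by (simp add: keys_sum_subset)
  ultimately show ?case using insert by (simp add: T_simps(2) Pi_iff)
qed

end

section \<open>Homomorphisms out of the free orthogonal algebra\<close>

lemma with_coalgebra_simps [simp]:
  "carrier (with_coalgebra A \<Delta> \<epsilon>) = carrier A"
  "monoid.mult (with_coalgebra A \<Delta> \<epsilon>) = monoid.mult A"
  "\<one>\<^bsub>with_coalgebra A \<Delta> \<epsilon>\<^esub> = \<one>\<^bsub>A\<^esub>"
  "\<zero>\<^bsub>with_coalgebra A \<Delta> \<epsilon>\<^esub> = \<zero>\<^bsub>A\<^esub>"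
  "add (with_coalgebra A \<Delta> \<epsilon>) = add A"
  "smult (with_coalgebra A \<Delta> \<epsilon>) = smult A"
  "star (with_coalgebra A \<Delta> \<epsilon>) = star A"
  "comult (with_coalgebra A \<Delta> \<epsilon>) = \<Delta>"
  "counit (with_coalgebra A \<Delta> \<epsilon>) = \<epsilon>"
  by (simp_all add: with_coalgebra_def star_algebra.defs hopf_star_algebra.defs)

text \<open>
  The extended record has a different type, so the sums over the underlying additive monoids have to be
  unfolded for the comparison.
\<close>

lemma presented_hom_with_coalgebra [simp]:
  "presented_hom (with_coalgebra A \<Delta> \<epsilon>) = presented_hom A"
  by (simp add: fun_eq_iff presented_hom_def nc_eval_def finsum_def finprod_def)

lemma (in complex_algebra) nc_eval_sum:
  assumes \<phi>: "\<phi> \<in> UNIV \<rightarrow> carrier A" and "finite X"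
  shows "nc_eval A \<phi> (\<Sum>i\<in>X. f i) = (\<Oplus>i\<in>X. nc_eval A \<phi> (f i))"
  unfolding nc_eval_lin_ext
  by (rule lin_ext_sum[OF assms(2) subset_UNIV]) (use word_eval_closed[OF \<phi>] in auto)

lemma (in complex_algebra) nc_eval_orth_rels:
  assumes \<phi>: "\<phi> \<in> UNIV \<rightarrow> carrier A"
    and rows: "\<And>i j. (\<Oplus>k\<in>UNIV. \<phi> (i, k) \<otimes> \<phi> (j, k)) = (if i = j then \<one> else \<zero>)"
    and cols: "\<And>i j. (\<Oplus>k\<in>UNIV. \<phi> (k, i) \<otimes> \<phi> (k, j)) = (if i = j then \<one> else \<zero>)"
    and r: "r \<in> orth_rels"
  shows "nc_eval A \<phi> r = \<zero>"
proof -
  have p: "\<phi> x \<in> carrier A" for x using \<phi> by auto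
  have "nc_eval A \<phi> (\<Sum>k\<in>UNIV. single [x k, y k] 1) = (\<Oplus>k\<in>UNIV. \<phi> (x k) \<otimes> \<phi> (y k))" for x y :: "'b \<Rightarrow> _"
    using p by (simp add: nc_eval_sum[OF \<phi>] nc_eval_simps[OF \<phi>])
  then show ?thesis
    using r rows cols unfolding orth_rels_def
    by (auto simp: nc_eval_simps[OF \<phi>] a_minus_def r_neg)
qed

abbreviation orth_ideal :: "(('n::finite \<times> 'n) list \<Rightarrow>\<^sub>0 complex) set" where
  "orth_ideal \<equiv> Idl\<^bsub>free_star_algebra\<^esub> orth_rels"

abbreviation orth_class :: "(('n::finite \<times> 'n) list \<Rightarrow>\<^sub>0 complex) \<Rightarrow> (('n \<times> 'n) list \<Rightarrow>\<^sub>0 complex) set" where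
  "orth_class f \<equiv> orth_ideal +>\<^bsub>free_star_algebra\<^esub> f"

abbreviation orth_word :: "('n::finite \<times> 'n) list \<Rightarrow> (('n \<times> 'n) list \<Rightarrow>\<^sub>0 complex) set" where
  "orth_word w \<equiv> orth_class (single w 1)"

section \<open>Restriction to the orthogonal group\<close>

text \<open>
  The finite set of functions in the definition may be replaced by a finite family with repetitions.
\<close>

lemma representative_functionsI:
  assumes "\<And>x. x \<notin> carrier G \<Longrightarrow> f x = 0" "continuous_on (carrier G) f" "finite X"
    and "\<And>g. g \<in> carrier G \<Longrightarrow> \<exists>c. \<forall>x\<in>carrier G. f (g \<otimes>\<^bsub>G\<^esub> x) = (\<Sum>k\<in>X. c k * H k x)"
  shows "f \<in> representative_functions G"
proof -
  have "\<exists>c. \<forall>x\<in>carrier G. f (g \<otimes>\<^bsub>G\<^esub> x) = (\<Sum>h\<in>H ` X. c h * h x)" if g: "g \<in> carrier G" for g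
  proof -
    obtain c where c: "\<And>x. x \<in> carrier G \<Longrightarrow> f (g \<otimes>\<^bsub>G\<^esub> x) = (\<Sum>k\<in>X. c k * H k x)"
      using assms(4)[OF g] by blast
    have "(\<Sum>k\<in>X. c k * H k x) = (\<Sum>h\<in>H ` X. (\<Sum>k\<in>{k \<in> X. H k = h}. c k) * h x)" for x
      by (simp add: sum.image_gen[OF assms(3), of _ H] sum_distrib_right)
    then show ?thesis using c by (intro exI[of _ "\<lambda>h. \<Sum>k\<in>{k \<in> X. H k = h}. c k"]) simp
  qed
  then show ?thesis
    using assms(1-3) unfolding representative_functions_def by blast
qed

lemma representative_functions_add:
  assumes f: "f \<in> representative_functions G" and f': "f' \<in> representative_functions G"
  shows "(\<lambda>x. f x + f' x) \<in> representative_functions G"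
proof -
  obtain F where F: "finite F" "\<forall>g\<in>carrier G. \<exists>c. \<forall>x\<in>carrier G. f (g \<otimes>\<^bsub>G\<^esub> x) = (\<Sum>h\<in>F. c h * h x)"
    "continuous_on (carrier G) f" "\<forall>x. x \<notin> carrier G \<longrightarrow> f x = 0"
    using f unfolding representative_functions_def by blast
  obtain F' where F': "finite F'" "\<forall>g\<in>carrier G. \<exists>c. \<forall>x\<in>carrier G. f' (g \<otimes>\<^bsub>G\<^esub> x) = (\<Sum>h\<in>F'. c h * h x)"
    "continuous_on (carrier G) f'" "\<forall>x. x \<notin> carrier G \<longrightarrow> f' x = 0"
    using f' unfolding representative_functions_def by blast
  show ?thesis
  proof (rule representative_functionsI[where X = "F <+> F'" and H = "case_sum id id"])
    fix g assume g: "g \<in> carrier G"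
    obtain c c' where "\<forall>x\<in>carrier G. f (g \<otimes>\<^bsub>G\<^esub> x) = (\<Sum>h\<in>F. c h * h x)"
      "\<forall>x\<in>carrier G. f' (g \<otimes>\<^bsub>G\<^esub> x) = (\<Sum>h\<in>F'. c' h * h x)"
      using F(2) F'(2) g by blast
    then show "\<exists>c. \<forall>x\<in>carrier G. f (g \<otimes>\<^bsub>G\<^esub> x) + f' (g \<otimes>\<^bsub>G\<^esub> x) = (\<Sum>k\<in>F <+> F'. c k * case_sum id id k x)"
      using F(1) F'(1) by (intro exI[of _ "case_sum c c'"]) (simp add: sum.Plus)
  qed (use F F' in \<open>auto intro: continuous_intros\<close>)
qed

lemma representative_functions_scale:
  assumes f: "f \<in> representative_functions G"
  shows "(\<lambda>x. c * f x) \<in> representative_functions G"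
proof -
  obtain F where F: "finite F" "\<forall>g\<in>carrier G. \<exists>c. \<forall>x\<in>carrier G. f (g \<otimes>\<^bsub>G\<^esub> x) = (\<Sum>h\<in>F. c h * h x)"
    "continuous_on (carrier G) f" "\<forall>x. x \<notin> carrier G \<longrightarrow> f x = 0"
    using f unfolding representative_functions_def by blast
  show ?thesis
  proof (rule representative_functionsI[where X = F and H = id])
    fix g assume g: "g \<in> carrier G"
    obtain d where "\<forall>x\<in>carrier G. f (g \<otimes>\<^bsub>G\<^esub> x) = (\<Sum>h\<in>F. d h * h x)"
      using F(2) g by blast
    then show "\<exists>d. \<forall>x\<in>carrier G. c * f (g \<otimes>\<^bsub>G\<^esub> x) = (\<Sum>k\<in>F. d k * id k x)"
      by (intro exI[of _ "\<lambda>h. c * d h"]) (simp add: sum_distrib_left mult.assoc)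
  qed (use F in \<open>auto intro: continuous_intros\<close>)
qed

lemma representative_functions_mult:
  assumes f: "f \<in> representative_functions G" and f': "f' \<in> representative_functions G"
  shows "(\<lambda>x. f x * f' x) \<in> representative_functions G"
proof -
  obtain F where F: "finite F" "\<forall>g\<in>carrier G. \<exists>c. \<forall>x\<in>carrier G. f (g \<otimes>\<^bsub>G\<^esub> x) = (\<Sum>h\<in>F. c h * h x)"
    "continuous_on (carrier G) f" "\<forall>x. x \<notin> carrier G \<longrightarrow> f x = 0"
    using f unfolding representative_functions_def by blast
  obtain F' where F': "finite F'" "\<forall>g\<in>carrier G. \<exists>c. \<forall>x\<in>carrier G. f' (g \<otimes>\<^bsub>G\<^esub> x) = (\<Sum>h\<in>F'. c h * h x)"
    "continuous_on (carrier G) f'" "\<forall>x. x \<notin> carrier G \<longrightarrow> f' x = 0"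
    using f' unfolding representative_functions_def by blast
  show ?thesis
  proof (rule representative_functionsI[where X = "F \<times> F'" and H = "\<lambda>(h, h') x. h x * h' x"])
    fix g assume g: "g \<in> carrier G"
    obtain c c' where "\<forall>x\<in>carrier G. f (g \<otimes>\<^bsub>G\<^esub> x) = (\<Sum>h\<in>F. c h * h x)"
      "\<forall>x\<in>carrier G. f' (g \<otimes>\<^bsub>G\<^esub> x) = (\<Sum>h\<in>F'. c' h * h x)"
      using F(2) F'(2) g by blast
    then show "\<exists>c. \<forall>x\<in>carrier G. f (g \<otimes>\<^bsub>G\<^esub> x) * f' (g \<otimes>\<^bsub>G\<^esub> x) = (\<Sum>k\<in>F \<times> F'. c k * (case k of (h, h') \<Rightarrow> \<lambda>x. h x * h' x) x)"
      by (intro exI[of _ "\<lambda>(h, h'). c h * c' h'"])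
        (auto simp: sum_product sum.cartesian_product case_prod_unfold mult.assoc mult.left_commute intro!: sum.cong)
  qed (use F F' in \<open>auto intro: continuous_intros\<close>)
qed

lemma representative_alg_simps [simp]:
  "carrier (representative_alg G) = representative_functions G"
  "f \<otimes>\<^bsub>representative_alg G\<^esub> f' = (\<lambda>x. f x * f' x)"
  "\<one>\<^bsub>representative_alg G\<^esub> = (\<lambda>x. if x \<in> carrier G then 1 else 0)"
  "\<zero>\<^bsub>representative_alg G\<^esub> = (\<lambda>x. 0)"
  "f \<oplus>\<^bsub>representative_alg G\<^esub> f' = (\<lambda>x. f x + f' x)"
  "c \<odot>\<^bsub>representative_alg G\<^esub> f = (\<lambda>x. c * f x)"
  by (simp_all add: representative_alg_def)

lemma complex_algebra_representative_alg:
  assumes "Group.monoid G"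
  shows "complex_algebra (representative_alg G)" (is "complex_algebra ?A")
proof -
  interpret Group.monoid G by fact
  have one: "(\<lambda>x. if x \<in> carrier G then 1 else 0) \<in> representative_functions G"
  proof (rule representative_functionsI[where X = "{()}" and H = "\<lambda>_ _. 1"])
    show "continuous_on (carrier G) (\<lambda>x. if x \<in> carrier G then 1 else 0 :: complex)"
      by (rule continuous_on_eq[of _ "\<lambda>x. 1"]) auto
    show "\<exists>c. \<forall>x\<in>carrier G. (if g \<otimes>\<^bsub>G\<^esub> x \<in> carrier G then 1 else 0) = (\<Sum>k\<in>{()}. c k * (1 :: complex))"
      if "g \<in> carrier G" for g
      using that by (intro exI[of _ "\<lambda>_. 1"]) simp
  qed auto
  have zero: "(\<lambda>x. 0) \<in> representative_functions G"
    using representative_functions_scale[OF one, of 0] by simp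
  have support: "f x = 0" if "f \<in> representative_functions G" "x \<notin> carrier G" for f x
    using that unfolding representative_functions_def by blast
  have "ring ?A"
  proof (rule ringI)
    show "abelian_group ?A"
    proof (rule abelian_groupI)
      fix f assume "f \<in> carrier ?A"
      then have "(\<lambda>x. (-1) * f x) \<in> carrier ?A" by (simp only: representative_alg_simps representative_functions_scale)
      then show "\<exists>g\<in>carrier ?A. g \<oplus>\<^bsub>?A\<^esub> f = \<zero>\<^bsub>?A\<^esub>" by (rule bexI[rotated]) simp
    qed (simp_all add: representative_functions_add zero ac_simps)
    show "Group.monoid ?A"
      by (rule monoidI) (auto simp: representative_functions_mult one ac_simps fun_eq_iff support)
  qed (simp_all add: algebra_simps)
  then show ?thesis
    by (rule complex_algebraI) (simp_all add: representative_functions_scale algebra_simps)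
qed

lemma finsum_representative_alg:
  assumes "complex_algebra (representative_alg G)" "finite X" "\<And>k. k \<in> X \<Longrightarrow> h k \<in> representative_functions G"
  shows "(\<Oplus>\<^bsub>representative_alg G\<^esub>k\<in>X. h k) = (\<lambda>x. \<Sum>k\<in>X. h k x)"
proof -
  interpret complex_algebra "representative_alg G" by fact
  show ?thesis using assms(2,3) by (induction X rule: finite_induct) (auto simp: Pi_iff)
qed

lemma orthogonal_group_simps [simp]:
  "carrier orthogonal_group = {Q. orthogonal_matrix Q}"
  "P \<otimes>\<^bsub>orthogonal_group\<^esub> Q = P ** Q" "\<one>\<^bsub>orthogonal_group\<^esub> = mat 1"
  by (simp_all add: orthogonal_group_def)

lemma monoid_orthogonal_group: "Group.monoid (orthogonal_group :: (real^'n^'n) monoid)"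
  by (rule monoidI) (auto simp: orthogonal_matrix_mul orthogonal_matrix_id matrix_mul_assoc)

definition coordinate_function :: "'n \<times> 'n \<Rightarrow> real^'n^'n \<Rightarrow> complex" where
  "coordinate_function = (\<lambda>(i, j) Q. if orthogonal_matrix Q then of_real (Q $ i $ j) else 0)"

lemma coordinate_function_representative:
  fixes i j :: "'n::finite"
  shows "coordinate_function (i, j) \<in> representative_functions orthogonal_group"
proof (rule representative_functionsI[where X = UNIV and H = "\<lambda>k. coordinate_function (k, j)"])
  have "continuous_on (carrier orthogonal_group) (\<lambda>Q :: real^'n^'n. complex_of_real (Q $ i $ j))"
    by (intro continuous_intros)
  then show "continuous_on (carrier orthogonal_group) (coordinate_function (i, j))"
    by (rule continuous_on_eq) (simp add: coordinate_function_def)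
  show "\<exists>c. \<forall>x\<in>carrier orthogonal_group. coordinate_function (i, j) (g \<otimes>\<^bsub>orthogonal_group\<^esub> x)
      = (\<Sum>k\<in>UNIV. c k * coordinate_function (k, j) x)" if "g \<in> carrier orthogonal_group" for g :: "real^'n^'n"
  proof (intro exI[of _ "\<lambda>k. complex_of_real (g $ i $ k)"] ballI)
    fix x :: "real^'n^'n" assume "x \<in> carrier orthogonal_group"
    then have "coordinate_function (i, j) (g \<otimes>\<^bsub>orthogonal_group\<^esub> x) = of_real ((g ** x) $ i $ j)"
      using that by (simp add: coordinate_function_def orthogonal_matrix_mul)
    also have "(g ** x) $ i $ j = (\<Sum>k\<in>UNIV. g $ i $ k * x $ k $ j)"
      by (simp add: matrix_matrix_mult_def)
    finally show "coordinate_function (i, j) (g \<otimes>\<^bsub>orthogonal_group\<^esub> x)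
      = (\<Sum>k\<in>UNIV. complex_of_real (g $ i $ k) * coordinate_function (k, j) x)"
      using \<open>x \<in> carrier orthogonal_group\<close> by (simp add: coordinate_function_def)
  qed
qed (auto simp: coordinate_function_def)

lemma orthogonal_matrix_rows:
  fixes Q :: "real^'n^'n"
  assumes "orthogonal_matrix Q"
  shows "(\<Sum>k\<in>UNIV. cmatrix Q a k * cmatrix Q b k) = (if a = b then 1 else 0)"
proof -
  have "orthogonal_matrix (transpose Q)" using assms by simp
  from orthogonal_matrix_columns[OF this, of a b] show ?thesis by (simp add: transpose_def)
qed

lemma word_eval_coordinate_function:
  assumes "orthogonal_matrix Q"
  shows "word_eval (representative_alg orthogonal_group) coordinate_function w Q
    = tensor_coeff (cmatrix Q) (map fst w) (map snd w)"
  using assms by (induction w) (auto simp: coordinate_function_def tensor_coeff_def)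

text \<open>
  The value at \<open>Q\<close> of the coordinate monomial with row word \<open>I\<close> and column word \<open>J\<close> is the entry at
  \<open>(I, J)\<close> of \<open>Q \<otimes> \<dots> \<otimes> Q\<close>.
\<close>

lemma orth_quotient_map_word:
  fixes Q :: "real^'n^'n"
  assumes "orthogonal_matrix Q"
  shows "orth_quotient_map (orth_word w) Q
    = tensor_coeff (cmatrix Q) (map fst w) (map snd w)"
proof -
  let ?G = "orthogonal_group :: (real^'n^'n) monoid"
  have C: "complex_algebra (representative_alg ?G)"
    by (rule complex_algebra_representative_alg[OF monoid_orthogonal_group])
  interpret complex_algebra "representative_alg ?G" by (rule C)
  have \<phi>: "coordinate_function \<in> UNIV \<rightarrow> carrier (representative_alg ?G)"
    using coordinate_function_representative by auto
  have rels: "nc_eval (representative_alg ?G) coordinate_function r = \<zero>\<^bsub>representative_alg ?G\<^esub>" if "r \<in> orth_rels" for r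
  proof (rule nc_eval_orth_rels[OF \<phi> _ _ that])
    show "(\<Oplus>\<^bsub>representative_alg ?G\<^esub>k\<in>UNIV. coordinate_function (i, k) \<otimes>\<^bsub>representative_alg ?G\<^esub> coordinate_function (j, k))
      = (if i = j then \<one>\<^bsub>representative_alg ?G\<^esub> else \<zero>\<^bsub>representative_alg ?G\<^esub>)" for i j
    proof -
      have "(\<lambda>Q. \<Sum>k\<in>UNIV. coordinate_function (i, k) Q * coordinate_function (j, k) Q)
        = (if i = j then \<one>\<^bsub>representative_alg ?G\<^esub> else \<zero>\<^bsub>representative_alg ?G\<^esub>)"
      proof (rule ext)
        show "(\<Sum>k\<in>UNIV. coordinate_function (i, k) Q * coordinate_function (j, k) Q)
          = (if i = j then \<one>\<^bsub>representative_alg ?G\<^esub> else \<zero>\<^bsub>representative_alg ?G\<^esub>) Q" for Q :: "real^'n^'n"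
          by (cases "orthogonal_matrix Q"; cases "i = j")
            (simp_all add: coordinate_function_def orthogonal_matrix_rows)
      qed
      then show ?thesis
        by (simp add: finsum_representative_alg[OF C] representative_functions_mult coordinate_function_representative
            del: representative_alg_simps(3,4))
    qed
    show "(\<Oplus>\<^bsub>representative_alg ?G\<^esub>k\<in>UNIV. coordinate_function (k, i) \<otimes>\<^bsub>representative_alg ?G\<^esub> coordinate_function (k, j))
      = (if i = j then \<one>\<^bsub>representative_alg ?G\<^esub> else \<zero>\<^bsub>representative_alg ?G\<^esub>)" for i j
    proof -
      have "(\<lambda>Q. \<Sum>k\<in>UNIV. coordinate_function (k, i) Q * coordinate_function (k, j) Q)
        = (if i = j then \<one>\<^bsub>representative_alg ?G\<^esub> else \<zero>\<^bsub>representative_alg ?G\<^esub>)"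
      proof (rule ext)
        show "(\<Sum>k\<in>UNIV. coordinate_function (k, i) Q * coordinate_function (k, j) Q)
          = (if i = j then \<one>\<^bsub>representative_alg ?G\<^esub> else \<zero>\<^bsub>representative_alg ?G\<^esub>) Q" for Q :: "real^'n^'n"
          by (cases "orthogonal_matrix Q"; cases "i = j")
            (simp_all add: coordinate_function_def orthogonal_matrix_columns)
      qed
      then show ?thesis
        by (simp add: finsum_representative_alg[OF C] representative_functions_mult coordinate_function_representative
            del: representative_alg_simps(3,4))
    qed
  qed
  have "orth_quotient_map = presented_hom (representative_alg ?G) coordinate_function"
    by (simp add: orth_quotient_map_def function_hopf_algebra_def coordinate_function_def)
  then show ?thesis
    using presented_hom_coset[OF \<phi> rels] nc_eval_simps(4)[OF \<phi>, of w 1]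
    by (simp add: word_eval_coordinate_function[OF assms])
qed

section \<open>The group algebra of the free product\<close>

text \<open>
  The only nontrivial element of each free factor is \<open>1\<close>, so reduced words of syllables amount to words
  of indices without equal neighbours.
\<close>

abbreviation generator_word :: "'n list \<Rightarrow> ('n \<times> int) list" where
  "generator_word \<equiv> map (\<lambda>i. (i, 1))"

lemma fp_cons_Z2:
  "fp_cons (\<lambda>_. integer_mod_group 2) (i, 1) (generator_word v) = generator_word (gcons i v)"
  by (cases v) (simp_all add: integer_mod_group_def)

lemma carrier_Z2_free_power: "carrier Z2_free_power = generator_word ` {v. distinct_adj v}"
proof -
  have g: "g \<in> carrier (integer_mod_group 2) \<and> g \<noteq> \<one>\<^bsub>integer_mod_group 2\<^esub> \<longleftrightarrow> g = 1" for g
    by (auto simp: carrier_integer_mod_group)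
  have "w \<in> carrier Z2_free_power \<longleftrightarrow> (\<exists>v. distinct_adj v \<and> w = generator_word v)" for w :: "('n \<times> int) list"
  proof
    assume w: "w \<in> carrier Z2_free_power"
    then have "\<forall>x\<in>set w. snd x = 1"
      unfolding Z2_free_power_def free_product_def partial_object.simps mem_Collect_eq split_beta g by blast
    then have "w = generator_word (map fst w)"
      by (intro nth_equalityI) (auto simp: prod_eq_iff)
    then show "\<exists>v. distinct_adj v \<and> w = generator_word v"
      using w by (auto simp: Z2_free_power_def free_product_def)
  next
    assume "\<exists>v. distinct_adj v \<and> w = generator_word v"
    then show "w \<in> carrier Z2_free_power"
      unfolding Z2_free_power_def free_product_def partial_object.simps mem_Collect_eq split_beta g
      by (auto simp: comp_def)
  qed
  then show ?thesis by blast
qed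

lemma mult_Z2_free_power:
  "generator_word u \<otimes>\<^bsub>Z2_free_power\<^esub> generator_word v = generator_word (foldr gcons u v)"
  by (induction u) (simp_all add: Z2_free_power_def free_product_def fp_cons_Z2)

lemma one_Z2_free_power: "\<one>\<^bsub>Z2_free_power\<^esub> = []"
  by (simp add: Z2_free_power_def free_product_def)

lemma monoid_Z2_free_power: "Group.monoid Z2_free_power"
proof (rule monoidI)
  show "x \<otimes>\<^bsub>Z2_free_power\<^esub> y \<in> carrier Z2_free_power"
    if "x \<in> carrier Z2_free_power" "y \<in> carrier Z2_free_power" for x y :: "('n \<times> int) list"
    using that by (auto simp: carrier_Z2_free_power mult_Z2_free_power distinct_adj_foldr_gcons)
  show "x \<otimes>\<^bsub>Z2_free_power\<^esub> y \<otimes>\<^bsub>Z2_free_power\<^esub> z = x \<otimes>\<^bsub>Z2_free_power\<^esub> (y \<otimes>\<^bsub>Z2_free_power\<^esub> z)"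
    if xyz: "x \<in> carrier Z2_free_power" "y \<in> carrier Z2_free_power" "z \<in> carrier Z2_free_power" for x y z :: "('n \<times> int) list"
  proof -
    obtain a b c where abc: "x = generator_word a" "y = generator_word b" "z = generator_word c"
      "distinct_adj a" "distinct_adj b" "distinct_adj c"
      using xyz by (auto simp: carrier_Z2_free_power)
    have "foldr gcons a b = reduce (a @ b)" using abc by (simp add: reduce_append reduce_distinct_adj)
    then have "foldr gcons (foldr gcons a b) c = foldr gcons (a @ b) c"
      using abc by (simp only: foldr_gcons_reduce)
    then show ?thesis by (simp add: abc mult_Z2_free_power)
  qed
  show "\<one>\<^bsub>Z2_free_power\<^esub> \<in> carrier (Z2_free_power :: ('n \<times> int) list monoid)"
    by (force simp: carrier_Z2_free_power one_Z2_free_power)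
  fix x :: "('n \<times> int) list" assume "x \<in> carrier Z2_free_power"
  then obtain a where a: "x = generator_word a" "distinct_adj a" by (auto simp: carrier_Z2_free_power)
  show "\<one>\<^bsub>Z2_free_power\<^esub> \<otimes>\<^bsub>Z2_free_power\<^esub> x = x"
    using mult_Z2_free_power[of "[]" a] by (simp add: one_Z2_free_power a)
  have "foldr gcons a [] = a" using reduce_distinct_adj[OF a(2)] by (simp add: reduce_def)
  then show "x \<otimes>\<^bsub>Z2_free_power\<^esub> \<one>\<^bsub>Z2_free_power\<^esub> = x"
    using mult_Z2_free_power[of a "[]"] by (simp add: one_Z2_free_power a)
qed

definition diagonal_generator :: "'n \<times> 'n \<Rightarrow> ('n \<times> int) list \<Rightarrow>\<^sub>0 complex" where
  "diagonal_generator = (\<lambda>(i, j). if i = j then single [(i, 1)] 1 else 0)"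

lemma diag_quotient_map_word:
  fixes w :: "('n::finite \<times> 'n) list"
  shows "lookup (diag_quotient_map (orth_word w))
      (generator_word g) = graded_delta g (map fst w) (map snd w)"
proof -
  define A where "A = monoid_algebra (Z2_free_power :: ('n \<times> int) list monoid) (m_inv Z2_free_power)"
  have C: "complex_algebra A" unfolding A_def by (rule complex_algebra_monoid_algebra[OF monoid_Z2_free_power])
  interpret complex_algebra A by (rule C)
  have gen: "generator_word v \<in> carrier Z2_free_power" if "distinct_adj v" for v :: "'n list"
    using that by (auto simp: carrier_Z2_free_power)
  have d: "diagonal_generator x \<in> carrier A" for x
    using gen[of "[fst x]"] by (auto simp: A_def diagonal_generator_def split: prod.split)
  have \<phi>: "diagonal_generator \<in> UNIV \<rightarrow> carrier A" using d by auto
  have sq: "diagonal_generator (i, i) \<otimes>\<^bsub>A\<^esub> diagonal_generator (i, i) = \<one>\<^bsub>A\<^esub>" for i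
    using mult_Z2_free_power[of "[i]" "[i]"] by (simp add: A_def diagonal_generator_def one_Z2_free_power)
  have off: "diagonal_generator (i, k) = \<zero>\<^bsub>A\<^esub>" if "i \<noteq> k" for i k
    using that by (simp add: A_def diagonal_generator_def)
  have delta: "(\<Oplus>\<^bsub>A\<^esub>k\<in>UNIV. h k) = h i" if "\<And>k. k \<noteq> i \<Longrightarrow> h k = \<zero>\<^bsub>A\<^esub>" "\<And>k. h k \<in> carrier A"
    for h :: "'n \<Rightarrow> _" and i
  proof -
    have "(\<Oplus>\<^bsub>A\<^esub>k\<in>UNIV. h k) = (\<Oplus>\<^bsub>A\<^esub>k\<in>{i}. h k)"
      by (rule add.finprod_mono_neutral_cong_right) (use that in auto)
    then show ?thesis using that(2) by simp
  qed
  have rels: "nc_eval A diagonal_generator r = \<zero>\<^bsub>A\<^esub>" if "r \<in> orth_rels" for r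
  proof (rule nc_eval_orth_rels[OF \<phi> _ _ that])
    show "(\<Oplus>\<^bsub>A\<^esub>k\<in>UNIV. diagonal_generator (i, k) \<otimes>\<^bsub>A\<^esub> diagonal_generator (j, k)) = (if i = j then \<one>\<^bsub>A\<^esub> else \<zero>\<^bsub>A\<^esub>)" for i j
      by (subst delta[of i]) (auto simp: off d sq)
    show "(\<Oplus>\<^bsub>A\<^esub>k\<in>UNIV. diagonal_generator (k, i) \<otimes>\<^bsub>A\<^esub> diagonal_generator (k, j)) = (if i = j then \<one>\<^bsub>A\<^esub> else \<zero>\<^bsub>A\<^esub>)" for i j
      by (subst delta[of i]) (auto simp: off d sq)
  qed
  have word: "word_eval A diagonal_generator w
      = (if map fst w = map snd w then single (generator_word (reduce (map fst w))) 1 else 0)"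
    for w :: "('n \<times> 'n) list"
  proof (induction w)
    case Nil
    show ?case by (simp add: A_def one_Z2_free_power)
  next
    case (Cons x w)
    have "single [(i, 1)] 1 \<otimes>\<^bsub>A\<^esub> single (generator_word v) 1
      = single (generator_word (gcons i v)) 1" for i v
      using mult_Z2_free_power[of "[i]" v] by (simp add: A_def)
    then show ?case using Cons by (cases x) (auto simp: diagonal_generator_def reduce_Cons A_def)
  qed
  have inj: "generator_word a = generator_word b \<longleftrightarrow> a = b" for a b :: "'n list"
    by (simp add: inj_map_eq_map inj_def)
  have "diag_quotient_map = presented_hom A diagonal_generator"
    by (simp add: diag_quotient_map_def group_hopf_algebra_def diagonal_generator_def A_def Let_def)
  then have "diag_quotient_map (orth_word w)
     = word_eval A diagonal_generator w"
    using presented_hom_coset[OF \<phi> rels] nc_eval_simps(4)[OF \<phi>, of w 1] word_eval_closed[OF \<phi>] by simp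
  then show ?thesis
    by (auto simp: word graded_delta_def lookup_single when_def inj)
qed

section \<open>Comultiplication of monomials\<close>

global_interpretation free_algebra: complex_algebra "free_star_algebra :: ('s list \<Rightarrow>\<^sub>0 complex) star_algebra"
  by (rule complex_algebra_free)

lemma ideal_orth_rels: "ideal orth_ideal free_star_algebra"
  by (rule free_algebra.genideal_ideal) simp

lemma complex_algebra_free_orth: "complex_algebra free_orth_alg"
  unfolding free_orth_alg_def presented_algebra_def
  by (rule free_algebra.complex_algebra_quot[OF ideal_orth_rels])

lemma free_orth_alg_simps:
  fixes f g :: "('n::finite \<times> 'n) list \<Rightarrow>\<^sub>0 complex"
  shows "orth_class f \<otimes>\<^bsub>free_orth_alg\<^esub> orth_class g = orth_class (f \<star> g)"
  "orth_class f \<oplus>\<^bsub>free_orth_alg\<^esub> orth_class g = orth_class (f + g)"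
  "c \<odot>\<^bsub>free_orth_alg\<^esub> orth_class f = orth_class (pm_scale c f)"
  "\<one>\<^bsub>free_orth_alg\<^esub> = (orth_word [] :: (('n \<times> 'n) list \<Rightarrow>\<^sub>0 complex) set)"
  "\<zero>\<^bsub>free_orth_alg\<^esub> = (orth_class 0 :: (('n \<times> 'n) list \<Rightarrow>\<^sub>0 complex) set)"
  "orth_class f \<in> carrier free_orth_alg"
  using free_algebra.quot_algebra_simps[OF ideal_orth_rels, of f g]
  by (simp_all add: free_orth_alg_def presented_algebra_def)

lemma free_star_algebra_minus: "f \<ominus>\<^bsub>free_star_algebra\<^esub> g = f - g"
  using monoid_algebra_minus[OF free_monoid, of f rev g] by (simp add: free_star_algebra_def)

lemma orth_class_eq_iff: "orth_class f = orth_class g \<longleftrightarrow> f - g \<in> orth_ideal"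
  using free_algebra.coset_eq_iff[OF ideal_orth_rels, of f g] by (simp add: free_star_algebra_minus)

lemma free_orth_alg_carrierE:
  assumes "x \<in> carrier free_orth_alg"
  obtains f where "x = orth_class f"
  using assms free_algebra.quot_algebra_carrierE[of x]
  by (auto simp: free_orth_alg_def presented_algebra_def)

lemma orth_class_rows:
  "orth_class (\<Sum>k\<in>UNIV. single [(i, k), (j, k)] 1)
    = (if i = j then \<one>\<^bsub>free_orth_alg\<^esub> else \<zero>\<^bsub>free_orth_alg\<^esub>)"
proof -
  have "orth_class (\<Sum>k\<in>UNIV. single [(i, k), (j, k)] 1)
    = orth_class (single [] (if i = j then 1 else 0))"
    unfolding orth_class_eq_iff
    by (rule subsetD[OF free_algebra.genideal_self]) (auto simp: orth_rels_def)
  then show ?thesis by (simp add: free_orth_alg_simps split: if_splits)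
qed

lemma orth_class_cols:
  "orth_class (\<Sum>k\<in>UNIV. single [(k, i), (k, j)] 1)
    = (if i = j then \<one>\<^bsub>free_orth_alg\<^esub> else \<zero>\<^bsub>free_orth_alg\<^esub>)"
proof -
  have "orth_class (\<Sum>k\<in>UNIV. single [(k, i), (k, j)] 1)
    = orth_class (single [] (if i = j then 1 else 0))"
    unfolding orth_class_eq_iff
    by (rule subsetD[OF free_algebra.genideal_self]) (auto simp: orth_rels_def)
  then show ?thesis by (simp add: free_orth_alg_simps split: if_splits)
qed

global_interpretation FO: tensor_pair
  "free_orth_alg :: (('n::finite \<times> 'n) list \<Rightarrow>\<^sub>0 complex) set star_algebra"
  "free_orth_alg :: (('n \<times> 'n) list \<Rightarrow>\<^sub>0 complex) set star_algebra"
  by (intro tensor_pair.intro complex_algebra_free_orth)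

text \<open>
  A representative of the comultiplication of the monomial \<open>w\<close>. The identities for comultiplications
  below are first computed on such formal sums, where multiplication is explicit.
\<close>

definition comult_word :: "('n::finite \<times> 'n) list \<Rightarrow>
    (('n \<times> 'n) list \<Rightarrow>\<^sub>0 complex) set \<times> (('n \<times> 'n) list \<Rightarrow>\<^sub>0 complex) set \<Rightarrow>\<^sub>0 complex" where
  "comult_word w = (\<Sum>K\<in>words (length w).
     single (orth_word (zip (map fst w) K), orth_word (zip K (map snd w))) 1)"

lemma comult_word_carrier: "comult_word w \<in> carrier FO.F"
  unfolding comult_word_def by (simp add: free_orth_alg_simps keys_sum_subset)

lemma comult_word_Cons:
  "comult_word [x] \<otimes>\<^bsub>FO.F\<^esub> comult_word w = comult_word (x # w)"
  by (simp add: comult_word_def sum_words_Suc FO.F_distrib free_orth_alg_simps) (rule sum.swap)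

definition comult_gen :: "'n::finite \<times> 'n \<Rightarrow> ((('n \<times> 'n) list \<Rightarrow>\<^sub>0 complex) set, (('n \<times> 'n) list \<Rightarrow>\<^sub>0 complex) set) tensor" where
  "comult_gen = (\<lambda>(i, j). \<Oplus>\<^bsub>tensor_algebra free_orth_alg free_orth_alg\<^esub>k\<in>UNIV.
     pure_tensor free_orth_alg free_orth_alg (free_orth_gen i k) (free_orth_gen k j))"

lemma comult_gen_eq: "comult_gen x = FO.cls (comult_word [x])"
proof (cases x)
  case (Pair i j)
  have "comult_gen x = (\<Oplus>\<^bsub>FO.T\<^esub>k\<in>UNIV. FO.cls (single (orth_word [(i, k)], orth_word [(k, j)]) 1))"
    by (simp add: comult_gen_def Pair pure_tensor_def free_orth_gen_def presented_gen_def)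
  also have "\<dots> = FO.cls (\<Sum>k\<in>UNIV. single (orth_word [(i, k)], orth_word [(k, j)]) 1)"
    by (rule FO.coset_finsum) (simp_all add: free_orth_alg_simps)
  finally show ?thesis by (simp add: comult_word_def sum_words_Suc Pair)
qed

lemma comult_gen_carrier: "comult_gen \<in> UNIV \<rightarrow> carrier FO.T"
  using FO.T_simps(6)[OF comult_word_carrier comult_word_carrier] by (auto simp: comult_gen_eq)

lemma word_eval_comult_gen: "word_eval FO.T comult_gen w = FO.cls (comult_word w)"
proof (induction w)
  case Nil
  show ?case
    using FO.T_simps(4)[OF comult_word_carrier comult_word_carrier]
    by (simp add: comult_word_def free_orth_alg_simps(4))
next
  case (Cons x w)
  then show ?case
    by (simp add: comult_gen_eq FO.T_simps(1)[OF comult_word_carrier comult_word_carrier] comult_word_Cons)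
qed

context tensor_pair
begin

lemma coset_sum_cong:
  assumes "finite X" "\<And>i. i \<in> X \<Longrightarrow> h i \<in> carrier F" "\<And>i. i \<in> X \<Longrightarrow> h' i \<in> carrier F"
    and "\<And>i. i \<in> X \<Longrightarrow> cls (h i) = cls (h' i)"
  shows "cls (\<Sum>i\<in>X. h i) = cls (\<Sum>i\<in>X. h' i)"
proof -
  have "(\<Oplus>\<^bsub>T\<^esub>i\<in>X. cls (h i)) = (\<Oplus>\<^bsub>T\<^esub>i\<in>X. cls (h' i))"
    by (rule T.finsum_cong'[OF refl]) (use assms T_simps(6)[of _ 0] in auto)
  then show ?thesis using coset_finsum assms by metis
qed

text \<open>
  These two lemmas collect a sum over one leg into a single pure tensor, so that the orthogonality
  relations can be applied in that leg.
\<close>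

lemma coset_sum_single_right:
  assumes "finite X" "a \<in> carrier A" "\<And>k. k \<in> X \<Longrightarrow> b k \<in> carrier B"
  shows "cls (\<Sum>k\<in>X. single (a, b k) 1) = pure_tensor A B a (\<Oplus>\<^bsub>B\<^esub>k\<in>X. b k)"
  using assms(1,3)
proof (induction X rule: finite_induct)
  case empty
  have "pure_tensor A B a \<zero>\<^bsub>B\<^esub> = pure_tensor A B a (0 \<odot>\<^bsub>B\<^esub> \<zero>\<^bsub>B\<^esub>)" by simp
  also have "\<dots> = 0 \<odot>\<^bsub>T\<^esub> pure_tensor A B a \<zero>\<^bsub>B\<^esub>"
    by (rule bilinear_onD(5)[OF pure_bilinear assms(2) B.zero_closed])
  also have "\<dots> = \<zero>\<^bsub>T\<^esub>"
    by (rule T.smult_0_left[OF bilinear_onD(1)[OF pure_bilinear assms(2) B.zero_closed]])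
  finally show ?case using T_simps(5)[of 0 0] by simp
next
  case (insert k X)
  have s: "single (a, b i) 1 \<in> carrier F" if "i \<in> insert k X" for i
    using that assms(2) insert.prems by simp
  have s': "(\<Sum>k\<in>X. single (a, b k) 1) \<in> carrier F"
    using assms(2) insert.prems by (simp add: keys_sum_subset)
  have cl: "b k \<in> carrier B" "b \<in> X \<rightarrow> carrier B" using insert.prems by auto
  have "cls (\<Sum>k\<in>insert k X. single (a, b k) 1)
     = cls (single (a, b k) 1) \<oplus>\<^bsub>T\<^esub> cls (\<Sum>k\<in>X. single (a, b k) 1)"
    using insert.hyps T_simps(2)[OF s[of k] s'] by simp
  also have "\<dots> = pure_tensor A B a (b k) \<oplus>\<^bsub>T\<^esub> pure_tensor A B a (\<Oplus>\<^bsub>B\<^esub>k\<in>X. b k)"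
    using insert by (simp add: pure_tensor_def)
  also have "\<dots> = pure_tensor A B a (\<Oplus>\<^bsub>B\<^esub>k\<in>insert k X. b k)"
    using insert.hyps cl bilinear_onD(3)[OF pure_bilinear assms(2) cl(1) B.finsum_closed[OF cl(2)]] by simp
  finally show ?case .
qed

lemma coset_sum_single_left:
  assumes "finite X" "b \<in> carrier B" "\<And>k. k \<in> X \<Longrightarrow> a k \<in> carrier A"
  shows "cls (\<Sum>k\<in>X. single (a k, b) 1) = pure_tensor A B (\<Oplus>\<^bsub>A\<^esub>k\<in>X. a k) b"
  using assms(1,3)
proof (induction X rule: finite_induct)
  case empty
  have "pure_tensor A B \<zero>\<^bsub>A\<^esub> b = pure_tensor A B (0 \<odot>\<^bsub>A\<^esub> \<zero>\<^bsub>A\<^esub>) b" by simp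
  also have "\<dots> = 0 \<odot>\<^bsub>T\<^esub> pure_tensor A B \<zero>\<^bsub>A\<^esub> b"
    by (rule bilinear_onD(4)[OF pure_bilinear A.zero_closed assms(2)])
  also have "\<dots> = \<zero>\<^bsub>T\<^esub>"
    by (rule T.smult_0_left[OF bilinear_onD(1)[OF pure_bilinear A.zero_closed assms(2)]])
  finally show ?case using T_simps(5)[of 0 0] by simp
next
  case (insert k X)
  have s: "single (a i, b) 1 \<in> carrier F" if "i \<in> insert k X" for i
    using that assms(2) insert.prems by simp
  have s': "(\<Sum>k\<in>X. single (a k, b) 1) \<in> carrier F"
    using assms(2) insert.prems by (simp add: keys_sum_subset)
  have cl: "a k \<in> carrier A" "a \<in> X \<rightarrow> carrier A" using insert.prems by auto
  have "cls (\<Sum>k\<in>insert k X. single (a k, b) 1)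
     = cls (single (a k, b) 1) \<oplus>\<^bsub>T\<^esub> cls (\<Sum>k\<in>X. single (a k, b) 1)"
    using insert.hyps T_simps(2)[OF s[of k] s'] by simp
  also have "\<dots> = pure_tensor A B (a k) b \<oplus>\<^bsub>T\<^esub> pure_tensor A B (\<Oplus>\<^bsub>A\<^esub>k\<in>X. a k) b"
    using insert by (simp add: pure_tensor_def)
  also have "\<dots> = pure_tensor A B (\<Oplus>\<^bsub>A\<^esub>k\<in>insert k X. a k) b"
    using insert.hyps cl bilinear_onD(2)[OF pure_bilinear cl(1) A.finsum_closed[OF cl(2)] assms(2)] by simp
  finally show ?case .
qed

lemma pure_zero:
  "a \<in> carrier A \<Longrightarrow> pure_tensor A B a \<zero>\<^bsub>B\<^esub> = \<zero>\<^bsub>T\<^esub>"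
  "b \<in> carrier B \<Longrightarrow> pure_tensor A B \<zero>\<^bsub>A\<^esub> b = \<zero>\<^bsub>T\<^esub>"
  using coset_sum_single_right[of "{}" a "\<lambda>_. \<zero>\<^bsub>B\<^esub>"] coset_sum_single_left[of "{}" b "\<lambda>_. \<zero>\<^bsub>A\<^esub>"] T_simps(5)[of 0 0]
  by simp_all

end

lemma finsum_orth_class:
  assumes "finite X"
  shows "(\<Oplus>\<^bsub>free_orth_alg\<^esub>k\<in>X. orth_class (f k)) = orth_class (\<Sum>k\<in>X. f k)"
  using assms
  by (induction X rule: finite_induct) (simp_all add: free_orth_alg_simps)

text \<open>
  Summing over the column index \<open>k\<close> first, the second leg becomes an entry of \<open>u u\<^sup>T = 1\<close>; this leaves
  the same relation in the first leg.
\<close>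

lemma comult_gen_rows:
  fixes i j :: "'n::finite"
  shows "(\<Oplus>\<^bsub>FO.T\<^esub>k\<in>UNIV. comult_gen (i, k) \<otimes>\<^bsub>FO.T\<^esub> comult_gen (j, k)) = (if i = j then \<one>\<^bsub>FO.T\<^esub> else \<zero>\<^bsub>FO.T\<^esub>)"
proof -
  let ?o = "orth_word [] :: (('n \<times> 'n) list \<Rightarrow>\<^sub>0 complex) set"
  let ?s = "\<lambda>a b k. single (orth_word [(i, a), (j, b)], orth_word [(a, k), (b, k)]) (1 :: complex)"
  let ?h = "\<lambda>a b. if a = b then single (orth_word [(i, a), (j, b)], ?o) (1 :: complex) else 0"
  have s: "?s a b k \<in> carrier FO.F" for a b k by (simp add: free_orth_alg_simps)
  have h: "?h a b \<in> carrier FO.F" for a b by (simp add: free_orth_alg_simps)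
  have pair: "FO.cls (\<Sum>k\<in>UNIV. ?s a b k) = FO.cls (?h a b)" for a b
  proof -
    have "FO.cls (\<Sum>k\<in>UNIV. ?s a b k)
      = pure_tensor free_orth_alg free_orth_alg (orth_word [(i, a), (j, b)]) (if a = b then ?o else \<zero>\<^bsub>free_orth_alg\<^esub>)"
      using FO.coset_sum_single_right[of UNIV "orth_word [(i, a), (j, b)]" "\<lambda>k. orth_word [(a, k), (b, k)]"]
      by (simp add: free_orth_alg_simps(6) finsum_orth_class orth_class_rows)
        (simp add: free_orth_alg_simps(4))
    also have "\<dots> = FO.cls (?h a b)"
      using FO.pure_zero(1)[of "orth_word [(i, a), (j, b)]"] FO.T_simps(5)[of 0 0]
      by (auto simp: pure_tensor_def free_orth_alg_simps(6))
    finally show ?thesis .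
  qed
  have "(\<Oplus>\<^bsub>FO.T\<^esub>k\<in>UNIV. comult_gen (i, k) \<otimes>\<^bsub>FO.T\<^esub> comult_gen (j, k))
     = (\<Oplus>\<^bsub>FO.T\<^esub>k\<in>UNIV. FO.cls (comult_word [(i, k), (j, k)]))"
    by (simp add: comult_gen_eq FO.T_simps(1)[OF comult_word_carrier comult_word_carrier] comult_word_Cons)
  also have "\<dots> = FO.cls (\<Sum>k\<in>UNIV. comult_word [(i, k), (j, k)])"
    by (rule FO.coset_finsum) (simp_all only: finite comult_word_carrier)
  also have "(\<Sum>k\<in>UNIV. comult_word [(i, k), (j, k)]) = (\<Sum>k\<in>UNIV. \<Sum>a\<in>UNIV. \<Sum>b\<in>UNIV. ?s a b k)"
    by (simp add: comult_word_def sum_words_Suc)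
  also have "\<dots> = (\<Sum>a\<in>UNIV. \<Sum>b\<in>UNIV. \<Sum>k\<in>UNIV. ?s a b k)"
    by (subst sum.swap, rule sum.cong[OF refl], rule sum.swap)
  also have "FO.cls \<dots> = FO.cls (\<Sum>a\<in>UNIV. \<Sum>b\<in>UNIV. ?h a b)"
    by (intro FO.coset_sum_cong pair finite) (use s h in \<open>auto intro!: keys_sum_subset simp: free_orth_alg_simps(6)\<close>)
  also have "(\<Sum>a\<in>UNIV. \<Sum>b\<in>UNIV. ?h a b) = (\<Sum>a\<in>UNIV. single (orth_word [(i, a), (j, a)], ?o) 1)"
    by simp
  also have "FO.cls \<dots> = pure_tensor free_orth_alg free_orth_alg (if i = j then ?o else \<zero>\<^bsub>free_orth_alg\<^esub>) ?o"
    using FO.coset_sum_single_left[of UNIV ?o "\<lambda>a. orth_word [(i, a), (j, a)]"]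
    by (simp add: free_orth_alg_simps(6) finsum_orth_class orth_class_rows)
      (simp add: free_orth_alg_simps(4))
  also have "\<dots> = (if i = j then \<one>\<^bsub>FO.T\<^esub> else \<zero>\<^bsub>FO.T\<^esub>)"
    using FO.pure_zero(2)[of ?o] FO.T_simps(4)[OF comult_word_carrier[of "[(i, j)]"] comult_word_carrier[of "[(i, j)]"]]
    by (simp add: free_orth_alg_simps(6)) (simp add: pure_tensor_def free_orth_alg_simps(4))
  finally show ?thesis .
qed

text \<open>
  As for the rows, with the roles of the two legs exchanged.
\<close>

lemma comult_gen_cols:
  fixes i j :: "'n::finite"
  shows "(\<Oplus>\<^bsub>FO.T\<^esub>k\<in>UNIV. comult_gen (k, i) \<otimes>\<^bsub>FO.T\<^esub> comult_gen (k, j)) = (if i = j then \<one>\<^bsub>FO.T\<^esub> else \<zero>\<^bsub>FO.T\<^esub>)"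
proof -
  let ?o = "orth_word [] :: (('n \<times> 'n) list \<Rightarrow>\<^sub>0 complex) set"
  let ?s = "\<lambda>a b k. single (orth_word [(k, a), (k, b)], orth_word [(a, i), (b, j)]) (1 :: complex)"
  let ?h = "\<lambda>a b. if a = b then single (?o, orth_word [(a, i), (b, j)]) (1 :: complex) else 0"
  have s: "?s a b k \<in> carrier FO.F" for a b k by (simp add: free_orth_alg_simps)
  have h: "?h a b \<in> carrier FO.F" for a b by (simp add: free_orth_alg_simps)
  have pair: "FO.cls (\<Sum>k\<in>UNIV. ?s a b k) = FO.cls (?h a b)" for a b
  proof -
    have "FO.cls (\<Sum>k\<in>UNIV. ?s a b k)
      = pure_tensor free_orth_alg free_orth_alg (if a = b then ?o else \<zero>\<^bsub>free_orth_alg\<^esub>) (orth_word [(a, i), (b, j)])"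
      using FO.coset_sum_single_left[of UNIV "orth_word [(a, i), (b, j)]" "\<lambda>k. orth_word [(k, a), (k, b)]"]
      by (simp add: free_orth_alg_simps(6) finsum_orth_class orth_class_cols)
        (simp add: free_orth_alg_simps(4))
    also have "\<dots> = FO.cls (?h a b)"
      using FO.pure_zero(2)[of "orth_word [(a, i), (b, j)]"] FO.T_simps(5)[of 0 0]
      by (auto simp: pure_tensor_def free_orth_alg_simps(6))
    finally show ?thesis .
  qed
  have "(\<Oplus>\<^bsub>FO.T\<^esub>k\<in>UNIV. comult_gen (k, i) \<otimes>\<^bsub>FO.T\<^esub> comult_gen (k, j))
     = (\<Oplus>\<^bsub>FO.T\<^esub>k\<in>UNIV. FO.cls (comult_word [(k, i), (k, j)]))"
    by (simp add: comult_gen_eq FO.T_simps(1)[OF comult_word_carrier comult_word_carrier] comult_word_Cons)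
  also have "\<dots> = FO.cls (\<Sum>k\<in>UNIV. comult_word [(k, i), (k, j)])"
    by (rule FO.coset_finsum) (simp_all only: finite comult_word_carrier)
  also have "(\<Sum>k\<in>UNIV. comult_word [(k, i), (k, j)]) = (\<Sum>k\<in>UNIV. \<Sum>a\<in>UNIV. \<Sum>b\<in>UNIV. ?s a b k)"
    by (simp add: comult_word_def sum_words_Suc)
  also have "\<dots> = (\<Sum>a\<in>UNIV. \<Sum>b\<in>UNIV. \<Sum>k\<in>UNIV. ?s a b k)"
    by (subst sum.swap, rule sum.cong[OF refl], rule sum.swap)
  also have "FO.cls \<dots> = FO.cls (\<Sum>a\<in>UNIV. \<Sum>b\<in>UNIV. ?h a b)"
    by (intro FO.coset_sum_cong pair finite) (use s h in \<open>auto intro!: keys_sum_subset simp: free_orth_alg_simps(6)\<close>)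
  also have "(\<Sum>a\<in>UNIV. \<Sum>b\<in>UNIV. ?h a b) = (\<Sum>a\<in>UNIV. single (?o, orth_word [(a, i), (a, j)]) 1)"
    by simp
  also have "FO.cls \<dots> = pure_tensor free_orth_alg free_orth_alg ?o (if i = j then ?o else \<zero>\<^bsub>free_orth_alg\<^esub>)"
    using FO.coset_sum_single_right[of UNIV ?o "\<lambda>a. orth_word [(a, i), (a, j)]"]
    by (simp add: free_orth_alg_simps(6) finsum_orth_class orth_class_cols)
      (simp add: free_orth_alg_simps(4))
  also have "\<dots> = (if i = j then \<one>\<^bsub>FO.T\<^esub> else \<zero>\<^bsub>FO.T\<^esub>)"
    using FO.pure_zero(1)[of ?o] FO.T_simps(4)[OF comult_word_carrier[of "[(i, j)]"] comult_word_carrier[of "[(i, j)]"]]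
    by (simp add: free_orth_alg_simps(6)) (simp add: pure_tensor_def free_orth_alg_simps(4))
  finally show ?thesis .
qed

lemma comult_orth_word:
  "comult free_orthogonal (orth_word w) = FO.cls (comult_word w)"
proof -
  have rel: "nc_eval FO.T comult_gen r = \<zero>\<^bsub>FO.T\<^esub>" if "r \<in> orth_rels" for r
    by (rule FO.T.nc_eval_orth_rels[OF comult_gen_carrier comult_gen_rows comult_gen_cols that])
  have "comult free_orthogonal (orth_word w) = presented_hom FO.T comult_gen (orth_word w)"
    by (simp add: free_orthogonal_def comult_gen_def)
  also have "\<dots> = nc_eval FO.T comult_gen (single w 1)"
    by (rule FO.T.presented_hom_coset[OF comult_gen_carrier rel])
  also have "\<dots> = FO.cls (comult_word w)"
    using FO.T.word_eval_closed[OF comult_gen_carrier, of w]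
    by (simp add: FO.T.nc_eval_simps(4)[OF comult_gen_carrier] word_eval_comult_gen)
  finally show ?thesis .
qed

section \<open>Kernels of Hopf quotients\<close>

lemma carrier_free_orthogonal [simp]: "carrier free_orthogonal = carrier free_orth_alg"
  by (simp add: free_orthogonal_def)

locale orth_quotient =
  fixes B :: "'b hopf_star_algebra" and q :: "(('n::finite \<times> 'n) list \<Rightarrow>\<^sub>0 complex) set \<Rightarrow> 'b"
  assumes quotient: "hopf_star_quotient free_orthogonal B q"
begin

lemma hom: "q \<in> hopf_star_hom free_orthogonal B"
  using quotient by (simp add: hopf_star_quotient_def)

lemma star_hom: "q \<in> star_alg_hom free_orthogonal B"
  using hom by (simp add: hopf_star_hom_def)

lemma comult_B_hom: "comult B \<in> star_alg_hom B (tensor_algebra B B)"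
  using quotient by (simp add: hopf_star_quotient_def hopf_star_algebra_def hopf_star_algebra_axioms_def)

sublocale B: complex_algebra B
  using quotient by (intro star_algebra_complex_algebra) (simp add: hopf_star_quotient_def hopf_star_algebra_def)

sublocale TB: tensor_pair B B
  by unfold_locales

lemma q_simps:
  fixes f g :: "('n \<times> 'n) list \<Rightarrow>\<^sub>0 complex"
  shows "q (orth_class f) \<in> carrier B"
    and "q (orth_class (f + g)) = q (orth_class f) \<oplus>\<^bsub>B\<^esub> q (orth_class g)"
    and "q (orth_class (pm_scale c f)) = c \<odot>\<^bsub>B\<^esub> q (orth_class f)"
    and "q (orth_class 0) = \<zero>\<^bsub>B\<^esub>"
proof -
  have ring: "q \<in> ring_hom free_orthogonal B" using star_hom by (simp add: star_alg_hom_def)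
  have fo: "f \<oplus>\<^bsub>free_orthogonal\<^esub> g = f \<oplus>\<^bsub>free_orth_alg\<^esub> g" "c \<odot>\<^bsub>free_orthogonal\<^esub> f = c \<odot>\<^bsub>free_orth_alg\<^esub> f"
    for f g :: "(('n \<times> 'n) list \<Rightarrow>\<^sub>0 complex) set" and c
    by (simp_all add: free_orthogonal_def)
  show cl: "q (orth_class f) \<in> carrier B" for f :: "('n \<times> 'n) list \<Rightarrow>\<^sub>0 complex"
    using ring_hom_closed[OF ring, of "orth_class f"] by (simp add: free_orth_alg_simps(6))
  show "q (orth_class (f + g)) = q (orth_class f) \<oplus>\<^bsub>B\<^esub> q (orth_class g)"
    using ring_hom_add[OF ring, of "orth_class f" "orth_class g"] by (simp add: free_orth_alg_simps fo)
  show sc: "q (orth_class (pm_scale c f)) = c \<odot>\<^bsub>B\<^esub> q (orth_class f)" for c and f :: "('n \<times> 'n) list \<Rightarrow>\<^sub>0 complex"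
    using star_hom free_orth_alg_simps(6)[of f]
    unfolding star_alg_hom_def by (auto simp: free_orth_alg_simps(3)[symmetric] fo[symmetric])
  have "pm_scale 0 (0 :: ('n \<times> 'n) list \<Rightarrow>\<^sub>0 complex) = 0" by simp
  then show "q (orth_class 0) = \<zero>\<^bsub>B\<^esub>" using sc[of 0 0] cl[of 0] by simp
qed

definition null :: "(('n \<times> 'n) list \<Rightarrow>\<^sub>0 complex) set" where
  "null = {f. q (orth_class f) = \<zero>\<^bsub>B\<^esub>}"

lemma q_lin_ext: "q (orth_class f) = lin_ext B (\<lambda>w. q (orth_word w)) f"
proof -
  have cl: "(\<lambda>w. q (orth_word w)) \<in> S \<rightarrow> carrier B" for S using q_simps(1) by auto
  show ?thesis
    using subset_UNIV[of "keys f"]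
  proof (induction rule: poly_mapping_induct_keys)
    case (single w c)
    show ?case using q_simps(3)[of c "single w 1"] q_simps(1) by (simp add: B.lin_ext_single)
  next
    case (add f g)
    then show ?case by (simp add: q_simps B.lin_ext_add[OF subset_UNIV subset_UNIV cl])
  qed (simp add: q_simps)
qed

lemma pure_q_bilinear: "bilinear_on free_orth_alg free_orth_alg TB.T (\<lambda>a a'. pure_tensor B B (q a) (q a'))"
proof -
  have ex: "\<exists>f. a = orth_class f" if "a \<in> carrier free_orth_alg" for a :: "(('n \<times> 'n) list \<Rightarrow>\<^sub>0 complex) set"
    using that by (rule free_orth_alg_carrierE) blast
  note b = bilinear_onD[OF TB.pure_bilinear]
  show ?thesis
    unfolding bilinear_on_def
    by (auto dest!: ex simp: free_orth_alg_simps q_simps b)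
qed

definition comult_word_image :: "('n \<times> 'n) list \<Rightarrow> 'b \<times> 'b \<Rightarrow>\<^sub>0 complex" where
  "comult_word_image w = (\<Sum>K\<in>words (length w).
     single (q (orth_word (zip (map fst w) K)), q (orth_word (zip K (map snd w)))) 1)"

lemma comult_word_image_carrier: "comult_word_image w \<in> carrier TB.F"
  unfolding comult_word_image_def by (simp add: q_simps keys_sum_subset)

lemma comult_q_word: "comult B (q (orth_word w)) = TB.cls (comult_word_image w)"
proof -
  let ?p = "\<lambda>p. pure_tensor B B (q (fst p)) (q (snd p))"
  let ?s = "\<lambda>K. (orth_word (zip (map fst w) K), orth_word (zip K (map snd w)))"
  have cl: "?p \<in> carrier free_orth_alg \<times> carrier free_orth_alg \<rightarrow> carrier TB.T"
    using bilinear_onD(1)[OF pure_q_bilinear] by auto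
  have "orth_word w \<in> carrier free_orthogonal" by (simp add: free_orth_alg_simps(6))
  then have "comult B (q (orth_word w)) = tensor_lift TB.T (\<lambda>a a'. pure_tensor B B (q a) (q a')) (comult free_orthogonal (orth_word w))"
    using hom unfolding hopf_star_hom_def by blast
  also have "\<dots> = lin_ext TB.T ?p (comult_word w)"
    unfolding comult_orth_word
    by (rule FO.tensor_lift_coset[OF TB.T.complex_algebra_axioms pure_q_bilinear comult_word_carrier])
  also have "\<dots> = (\<Oplus>\<^bsub>TB.T\<^esub>K\<in>words (length w). lin_ext TB.T ?p (single (?s K) 1))"
    unfolding comult_word_def
    by (rule TB.T.lin_ext_sum[OF finite_words _ cl]) (simp add: free_orth_alg_simps(6))
  also have "\<dots> = (\<Oplus>\<^bsub>TB.T\<^esub>K\<in>words (length w). TB.cls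
      (single (q (orth_word (zip (map fst w) K)), q (orth_word (zip K (map snd w)))) 1))"
  proof (rule TB.T.finsum_cong'[OF refl])
    show "(\<lambda>K. TB.cls (single (q (orth_word (zip (map fst w) K)), q (orth_word (zip K (map snd w)))) 1))
        \<in> words (length w) \<rightarrow> carrier TB.T"
      by (intro funcsetI TB.T_simps(6)[of _ 0]) (simp_all add: q_simps)
    fix K :: "'n list" assume "K \<in> words (length w)"
    have "?p (?s K) \<in> carrier TB.T"
      using bilinear_onD(1)[OF TB.pure_bilinear] q_simps(1) by simp
    then show "lin_ext TB.T ?p (single (?s K) 1) = TB.cls
      (single (q (orth_word (zip (map fst w) K)), q (orth_word (zip K (map snd w)))) 1)"
      by (simp add: TB.T.lin_ext_single pure_tensor_def)
  qed
  also have "\<dots> = TB.cls (comult_word_image w)"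
    unfolding comult_word_image_def by (rule TB.coset_finsum) (simp_all add: q_simps)
  finally show ?thesis .
qed

text \<open>
  Both sides of \<open>tensor_lift B \<beta> (comult B (q x)) = lin_ext B \<dots>\<close> are linear in the polynomial that
  represents \<open>x\<close>, and they agree on monomials. If \<open>q x = 0\<close>, the left hand side vanishes.
\<close>

lemma bilinear_convolution_null:
  assumes \<beta>: "bilinear_on B B B \<beta>" and f: "f \<in> null"
  shows "lin_ext B (\<lambda>w. \<Oplus>\<^bsub>B\<^esub>K\<in>words (length w).
     \<beta> (q (orth_word (zip (map fst w) K))) (q (orth_word (zip K (map snd w))))) f = \<zero>\<^bsub>B\<^esub>"
proof -
  let ?g = "\<lambda>w. \<Oplus>\<^bsub>B\<^esub>K\<in>words (length w).
     \<beta> (q (orth_word (zip (map fst w) K))) (q (orth_word (zip K (map snd w))))"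
  let ?L = "tensor_lift B \<beta>"
  let ?b = "\<lambda>p. \<beta> (fst p) (snd p)"
  have b: "\<beta> (q (orth_class f)) (q (orth_class g)) \<in> carrier B" for f g
    using bilinear_onD(1)[OF \<beta>] q_simps(1) by blast
  have bcl: "?b \<in> carrier B \<times> carrier B \<rightarrow> carrier B" using bilinear_onD(1)[OF \<beta>] by auto
  have gcl: "?g \<in> S \<rightarrow> carrier B" for S by (intro funcsetI B.finsum_closed) (simp add: b)
  note L = TB.tensor_lift_coset[OF B.complex_algebra_axioms \<beta>]
  have ring: "comult B \<in> ring_hom B TB.T" using comult_B_hom by (simp add: star_alg_hom_def)
  have scale: "comult B (c \<odot>\<^bsub>B\<^esub> x) = c \<odot>\<^bsub>TB.T\<^esub> comult B x" if "x \<in> carrier B" for c x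
    using comult_B_hom that by (simp add: star_alg_hom_def)
  have TE: "\<exists>x. x \<in> carrier TB.F \<and> X = TB.cls x" if "X \<in> carrier TB.T" for X
    using that TB.F.quot_algebra_carrierE[of X TB.I] unfolding tensor_algebra_def by blast
  have L_add: "?L (X \<oplus>\<^bsub>TB.T\<^esub> Y) = ?L X \<oplus>\<^bsub>B\<^esub> ?L Y" if XY: "X \<in> carrier TB.T" "Y \<in> carrier TB.T" for X Y
  proof -
    obtain x y where x: "x \<in> carrier TB.F" "X = TB.cls x" and y: "y \<in> carrier TB.F" "Y = TB.cls y"
      using TE XY by blast
    have xy: "x + y \<in> carrier TB.F" using TB.F.a_closed[OF x(1) y(1)] by simp
    have "?L (X \<oplus>\<^bsub>TB.T\<^esub> Y) = lin_ext B ?b (x + y)"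
      unfolding x(2) y(2) TB.T_simps(2)[OF x(1) y(1)] by (rule L[OF xy])
    also have "\<dots> = lin_ext B ?b x \<oplus>\<^bsub>B\<^esub> lin_ext B ?b y"
      using x y by (intro B.lin_ext_add[OF _ _ bcl]) auto
    also have "\<dots> = ?L X \<oplus>\<^bsub>B\<^esub> ?L Y" unfolding x(2) y(2) L[OF x(1)] L[OF y(1)] ..
    finally show ?thesis .
  qed
  have L_scale: "?L (c \<odot>\<^bsub>TB.T\<^esub> X) = c \<odot>\<^bsub>B\<^esub> ?L X" if X: "X \<in> carrier TB.T" for c X
  proof -
    obtain x where x: "x \<in> carrier TB.F" "X = TB.cls x" using TE X by blast
    have cx: "pm_scale c x \<in> carrier TB.F" using TB.F.smult_closed'[OF x(1)] by simp
    have "?L (c \<odot>\<^bsub>TB.T\<^esub> X) = lin_ext B ?b (pm_scale c x)"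
      unfolding x(2) TB.T_simps(3)[OF x(1) x(1)] by (rule L[OF cx])
    also have "\<dots> = c \<odot>\<^bsub>B\<^esub> lin_ext B ?b x"
      using x bcl by (intro B.lin_ext_scale) auto
    also have "\<dots> = c \<odot>\<^bsub>B\<^esub> ?L X" unfolding x(2) L[OF x(1)] ..
    finally show ?thesis .
  qed
  have L_0: "?L \<zero>\<^bsub>TB.T\<^esub> = \<zero>\<^bsub>B\<^esub>"
    using TB.T_simps(5)[of 0 0] L[of 0] by simp
  have comult_0: "comult B \<zero>\<^bsub>B\<^esub> = \<zero>\<^bsub>TB.T\<^esub>"
    using scale[of "\<zero>\<^bsub>B\<^esub>" 0] ring_hom_closed[OF ring, of "\<zero>\<^bsub>B\<^esub>"] by simp
  have cc: "comult B (q (orth_class f)) \<in> carrier TB.T" for f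
    using ring_hom_closed[OF ring q_simps(1)] .
  have word: "?L (comult B (q (orth_word w))) = ?g w" for w
  proof -
    let ?t = "\<lambda>K. (q (orth_word (zip (map fst w) K)), q (orth_word (zip K (map snd w))))"
    have "?L (comult B (q (orth_word w))) = lin_ext B ?b (comult_word_image w)"
      unfolding comult_q_word by (rule L[OF comult_word_image_carrier])
    also have "\<dots> = (\<Oplus>\<^bsub>B\<^esub>K\<in>words (length w). lin_ext B ?b (single (?t K) 1))"
      unfolding comult_word_image_def
      by (rule B.lin_ext_sum[OF finite_words _ bcl]) (simp add: q_simps(1))
    also have "\<dots> = ?g w"
      by (rule B.finsum_cong'[OF refl]) (use b in \<open>auto simp: B.lin_ext_single\<close>)
    finally show ?thesis .
  qed
  have "?L (comult B (q (orth_class f))) = lin_ext B ?g f" for f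
    using subset_UNIV[of "keys f"]
  proof (induction rule: poly_mapping_induct_keys)
    case zero
    show ?case by (simp add: q_simps(4) comult_0 L_0)
  next
    case (single w c)
    have "?L (comult B (q (orth_class (pm_scale c (single w 1))))) = c \<odot>\<^bsub>B\<^esub> ?g w"
      unfolding q_simps(3) scale[OF q_simps(1)] L_scale[OF cc] word ..
    moreover have "?g w \<in> carrier B" using gcl[of UNIV] by auto
    ultimately show ?case by (simp add: B.lin_ext_single)
  next
    case (add f g)
    then show ?case
      unfolding q_simps(2) ring_hom_add[OF ring q_simps(1) q_simps(1)] L_add[OF cc cc]
        B.lin_ext_add[OF subset_UNIV subset_UNIV gcl] by simp
  qed
  from this[of f] show ?thesis using f by (simp add: null_def comult_0 L_0)
qed

definition linear_functional :: "('b \<Rightarrow> complex) \<Rightarrow> bool" where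
  "linear_functional \<phi> \<longleftrightarrow> (\<forall>a\<in>carrier B. \<forall>b\<in>carrier B. \<phi> (a \<oplus>\<^bsub>B\<^esub> b) = \<phi> a + \<phi> b) \<and>
     (\<forall>c. \<forall>a\<in>carrier B. \<phi> (c \<odot>\<^bsub>B\<^esub> a) = c * \<phi> a)"

lemma q_double_sum:
  fixes z :: "('n \<times> 'n) list \<Rightarrow> 'n list \<Rightarrow> ('n \<times> 'n) list" and t :: "('n \<times> 'n) list \<Rightarrow> 'n list \<Rightarrow> complex"
  shows "q (orth_class (\<Sum>w\<in>keys f. \<Sum>K\<in>words (length w). single (z w K) (lookup f w * t w K)))
    = lin_ext B (\<lambda>w. \<Oplus>\<^bsub>B\<^esub>K\<in>words (length w). t w K \<odot>\<^bsub>B\<^esub> q (orth_word (z w K))) f"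
proof -
  let ?w = "\<lambda>w. q (orth_word w)"
  let ?s = "\<lambda>w K. single (z w K) (lookup f w * t w K)"
  have wcl: "?w \<in> S \<rightarrow> carrier B" for S using q_simps(1) by auto
  have "lin_ext B ?w (\<Sum>w\<in>keys f. \<Sum>K\<in>words (length w). ?s w K)
      = (\<Oplus>\<^bsub>B\<^esub>w\<in>keys f. lin_ext B ?w (\<Sum>K\<in>words (length w). ?s w K))"
    by (rule B.lin_ext_sum[OF finite_keys subset_UNIV wcl])
  also have "\<dots> = (\<Oplus>\<^bsub>B\<^esub>w\<in>keys f. lookup f w \<odot>\<^bsub>B\<^esub> (\<Oplus>\<^bsub>B\<^esub>K\<in>words (length w). t w K \<odot>\<^bsub>B\<^esub> ?w (z w K)))"
  proof (rule B.finsum_cong'[OF refl])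
    show "(\<lambda>w. lookup f w \<odot>\<^bsub>B\<^esub> (\<Oplus>\<^bsub>B\<^esub>K\<in>words (length w). t w K \<odot>\<^bsub>B\<^esub> ?w (z w K))) \<in> keys f \<rightarrow> carrier B"
      by (intro funcsetI B.smult_closed' B.finsum_closed) (simp add: q_simps(1))
    fix w
    have "lin_ext B ?w (\<Sum>K\<in>words (length w). ?s w K) = (\<Oplus>\<^bsub>B\<^esub>K\<in>words (length w). lin_ext B ?w (?s w K))"
      by (rule B.lin_ext_sum[OF finite_words subset_UNIV wcl])
    also have "\<dots> = (\<Oplus>\<^bsub>B\<^esub>K\<in>words (length w). lookup f w \<odot>\<^bsub>B\<^esub> (t w K \<odot>\<^bsub>B\<^esub> ?w (z w K)))"
      by (rule B.finsum_cong'[OF refl]) (auto simp: q_simps(1) B.lin_ext_single B.smult_smult)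
    also have "\<dots> = lookup f w \<odot>\<^bsub>B\<^esub> (\<Oplus>\<^bsub>B\<^esub>K\<in>words (length w). t w K \<odot>\<^bsub>B\<^esub> ?w (z w K))"
      by (rule B.finsum_smult[symmetric]) (auto simp: q_simps(1))
    finally show "lin_ext B ?w (\<Sum>K\<in>words (length w). ?s w K)
      = lookup f w \<odot>\<^bsub>B\<^esub> (\<Oplus>\<^bsub>B\<^esub>K\<in>words (length w). t w K \<odot>\<^bsub>B\<^esub> ?w (z w K))" .
  qed
  finally show ?thesis by (simp only: q_lin_ext[symmetric]) (simp only: lin_ext_def)
qed

text \<open>
  Apply \<open>bilinear_convolution_null\<close> to \<open>\<beta> a b = \<phi>(a) b\<close> and to \<open>\<beta> a b = \<phi>(b) a\<close>.
\<close>

lemma translate_null: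
  assumes \<phi>: "linear_functional \<phi>" and f: "f \<in> null"
  shows "translate_left (\<lambda>I K. \<phi> (q (orth_word (zip I K)))) f \<in> null"
    and "translate_right (\<lambda>K J. \<phi> (q (orth_word (zip K J)))) f \<in> null"
proof -
  have "bilinear_on B B B (\<lambda>a b. \<phi> a \<odot>\<^bsub>B\<^esub> b)" "bilinear_on B B B (\<lambda>a b. \<phi> b \<odot>\<^bsub>B\<^esub> a)"
    using \<phi> unfolding bilinear_on_def linear_functional_def
    by (simp_all add: B.smult_add_left B.smult_add_right B.smult_smult[symmetric] mult.commute)
  note null = this[THEN bilinear_convolution_null, OF f]
  show "translate_left (\<lambda>I K. \<phi> (q (orth_word (zip I K)))) f \<in> null"
    using null(1) by (simp add: null_def translate_left_def q_double_sum)
  show "translate_right (\<lambda>K J. \<phi> (q (orth_word (zip K J)))) f \<in> null"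
    using null(2) by (simp add: null_def translate_right_def q_double_sum)
qed

lemma functional_null:
  assumes \<phi>: "linear_functional \<phi>" and f: "f \<in> null"
  shows "(\<Sum>w\<in>keys f. lookup f w * \<phi> (q (orth_word w))) = 0"
proof -
  have z: "\<phi> \<zero>\<^bsub>B\<^esub> = 0"
    using \<phi> B.smult_0_right[of 0] unfolding linear_functional_def by (metis B.zero_closed mult_zero_left)
  have "\<phi> (\<Oplus>\<^bsub>B\<^esub>w\<in>X. lookup f w \<odot>\<^bsub>B\<^esub> q (orth_word w)) = (\<Sum>w\<in>X. lookup f w * \<phi> (q (orth_word w)))"
    if "finite X" for X
    using that
  proof (induction X rule: finite_induct)
    case (insert w X)
    have cl: "lookup f w \<odot>\<^bsub>B\<^esub> q (orth_word w) \<in> carrier B" for w by (simp add: q_simps(1))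
    then have "(\<lambda>w. lookup f w \<odot>\<^bsub>B\<^esub> q (orth_word w)) \<in> X \<rightarrow> carrier B" by simp
    from B.finsum_closed[OF this] show ?case
      using insert cl \<phi> q_simps(1) unfolding linear_functional_def by simp
  qed (simp add: z)
  from this[OF finite_keys, of f] show ?thesis
    using f z q_lin_ext[of f] by (simp add: null_def lin_ext_def)
qed

lemma null_subspace: "pm.subspace null"
  unfolding pm.subspace_def null_def by (simp add: q_simps)

lemma relations_subset_null: "orth_ideal \<subseteq> null"
proof
  fix f :: "('n \<times> 'n) list \<Rightarrow>\<^sub>0 complex" assume "f \<in> orth_ideal"
  then have "orth_class f = orth_class 0" unfolding orth_class_eq_iff by simp
  then show "f \<in> null" by (simp add: null_def q_simps)
qed

end

section \<open>Topological generation\<close>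

lemma relations_subspace: "pm.subspace orth_ideal"
proof -
  interpret I: ideal "orth_ideal" free_star_algebra by (rule ideal_orth_rels)
  have "pm_scale c x \<in> orth_ideal" if "x \<in> orth_ideal" for c x
  proof -
    have "(single [] c) \<star> x \<in> orth_ideal"
      by (rule I.I_l_closed[OF that]) simp
    also have "single [] c = pm_scale c \<one>\<^bsub>free_star_algebra\<^esub>" by simp
    also have "pm_scale c \<one>\<^bsub>free_star_algebra\<^esub> \<star> x = pm_scale c x"
      using free_algebra.smult_mult_left[of "\<one>\<^bsub>free_star_algebra\<^esub>" x c] free_algebra.l_one[of x] by simp
    finally show ?thesis .
  qed
  then show ?thesis
    unfolding pm.subspace_def using I.zero_closed I.a_closed by auto
qed

lemma relations_in_context:
  assumes "r \<in> orth_rels"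
  shows "single u 1 \<star> r \<star> single v 1
    \<in> orth_ideal"
proof -
  interpret I: ideal "orth_ideal" free_star_algebra by (rule ideal_orth_rels)
  have "r \<in> orth_ideal"
    using free_algebra.genideal_self[of orth_rels] assms by auto
  then show ?thesis by (intro I.I_l_closed I.I_r_closed) auto
qed

text \<open>
  Relations in context in the expanded form used by \<open>subset_relations\<close>.
\<close>

lemma free_star_algebra_context:
  fixes u v :: "'s list" and h :: "'k \<Rightarrow> 's list"
  shows "single u 1 \<star> ((\<Sum>k\<in>X. single (h k) 1) - single [] c)
     \<star> single v 1
   = (\<Sum>k\<in>X. single (u @ h k @ v) 1) - single (u @ v) c"
proof -
  let ?S = "\<Sum>k\<in>X. single (h k) 1 :: 's list \<Rightarrow>\<^sub>0 complex"
  have left: "single u 1 \<star> ?S = (\<Sum>k\<in>X. single (u @ h k) 1)"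
    by (simp add: free_star_algebra_def monoid_algebra_mult_sum_right)
  have right: "(\<Sum>k\<in>X. single (u @ h k) 1) \<star> single v 1
      = (\<Sum>k\<in>X. single (u @ h k @ v) 1)"
    by (simp add: free_star_algebra_def monoid_algebra_mult_sum_left)
  have "?S - single [] c = ?S + single [] (- c)"
    by (simp add: single_uminus)
  then have "single u 1 \<star> (?S - single [] c)
      = (\<Sum>k\<in>X. single (u @ h k) 1) + single u (- c)"
    by (simp only: free_star_algebra_mult_distrib left free_star_algebra_simps append_Nil2 mult_1)
  then show ?thesis
    by (simp only: free_star_algebra_mult_distrib right free_star_algebra_simps mult_1_right)
      (simp add: single_uminus)
qed

theorem theorem3p3:
  assumes "CARD('n::finite) \<ge> 2"
  shows "topologically_generated_by TYPE('b)
    (free_orthogonal :: (('n \<times> 'n) list \<Rightarrow>\<^sub>0 complex) set hopf_star_algebra)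
    (function_hopf_algebra orthogonal_group) orth_quotient_map
    (group_hopf_algebra Z2_free_power) diag_quotient_map"
  unfolding topologically_generated_by_def
proof (rule notI, elim exE conjE)
  fix B :: "'b hopf_star_algebra" and q :: "(('n \<times> 'n) list \<Rightarrow>\<^sub>0 complex) set \<Rightarrow> 'b"
  assume quot: "hopf_star_quotient free_orthogonal B q" and not_inj: "\<not> inj_on q (carrier free_orthogonal)"
    and fac1: "factors_through free_orthogonal (function_hopf_algebra orthogonal_group) orth_quotient_map B q"
    and fac2: "factors_through free_orthogonal (group_hopf_algebra Z2_free_power) diag_quotient_map B q"
  interpret orth_quotient B q by unfold_locales (rule quot)
  have carr: "orth_class f \<in> carrier free_orthogonal" for f by (simp add: free_orth_alg_simps(6))
  obtain p1 where p1: "p1 \<in> hopf_star_hom B (function_hopf_algebra orthogonal_group)"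
    and p1q: "\<And>f. p1 (q (orth_class f)) = orth_quotient_map (orth_class f)"
    using fac1 carr unfolding factors_through_def by metis
  obtain p2 where p2: "p2 \<in> hopf_star_hom B (group_hopf_algebra Z2_free_power)"
    and p2q: "\<And>f. p2 (q (orth_class f)) = diag_quotient_map (orth_class f)"
    using fac2 carr unfolding factors_through_def by metis
  have lin1: "linear_functional (\<lambda>b. p1 b Q)" for Q
    using p1 unfolding linear_functional_def hopf_star_hom_def star_alg_hom_def ring_hom_def
    by (simp add: function_hopf_algebra_def)
  have lin2: "linear_functional (\<lambda>b. lookup (p2 b) (generator_word g))" for g
    using p2 unfolding linear_functional_def hopf_star_hom_def star_alg_hom_def ring_hom_def
    by (simp add: group_hopf_algebra_def Let_def lookup_add)
  have val1: "p1 (q (orth_word w)) Q = tensor_coeff (cmatrix Q) (map fst w) (map snd w)"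
    if "orthogonal_matrix Q" for Q w
    unfolding p1q by (rule orth_quotient_map_word[OF that])
  have val2: "lookup (p2 (q (orth_word w))) (generator_word g) = graded_delta g (map fst w) (map snd w)" for g w
    unfolding p2q by (rule diag_quotient_map_word)
  have cong_left: "translate_left \<phi> f = translate_left \<psi> f" if "\<And>I K. length I = length K \<Longrightarrow> \<phi> I K = \<psi> I K"
    for \<phi> \<psi> and f :: "('n \<times> 'n) list \<Rightarrow>\<^sub>0 complex"
    unfolding translate_left_def by (intro sum.cong refl) (simp add: that)
  have cong_right: "translate_right \<phi> f = translate_right \<psi> f" if "\<And>I K. length I = length K \<Longrightarrow> \<phi> I K = \<psi> I K"
    for \<phi> \<psi> and f :: "('n \<times> 'n) list \<Rightarrow>\<^sub>0 complex"
    unfolding translate_right_def by (intro sum.cong refl) (simp add: that)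
  interpret translation_invariant null
  proof
    show "CARD('n) \<ge> 2" by (rule assms)
    show "pm.subspace null" by (rule null_subspace)
    show "translate_left (tensor_coeff (cmatrix Q)) f \<in> null" if Q: "orthogonal_matrix Q" and f: "f \<in> null" for Q f
    proof -
      have "translate_left (tensor_coeff (cmatrix Q)) f = translate_left (\<lambda>I K. p1 (q (orth_word (zip I K))) Q) f"
        by (rule cong_left) (simp add: val1[OF Q])
      then show ?thesis using translate_null(1)[OF lin1 f] by simp
    qed
    show "translate_right (tensor_coeff (cmatrix Q)) f \<in> null" if Q: "orthogonal_matrix Q" and f: "f \<in> null" for Q f
    proof -
      have "translate_right (tensor_coeff (cmatrix Q)) f = translate_right (\<lambda>I K. p1 (q (orth_word (zip I K))) Q) f"
        by (rule cong_right) (simp add: val1[OF Q])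
      then show ?thesis using translate_null(2)[OF lin1 f] by simp
    qed
    show "translate_left (graded_delta g) f \<in> null" if f: "f \<in> null" for g f
    proof -
      have "translate_left (graded_delta g) f
        = translate_left (\<lambda>I K. lookup (p2 (q (orth_word (zip I K)))) (generator_word g)) f"
        by (rule cong_left) (simp add: val2)
      then show ?thesis using translate_null(1)[OF lin2 f] by simp
    qed
    show "translate_right (graded_delta g) f \<in> null" if f: "f \<in> null" for g f
    proof -
      have "translate_right (graded_delta g) f
        = translate_right (\<lambda>I K. lookup (p2 (q (orth_word (zip I K)))) (generator_word g)) f"
        by (rule cong_right) (simp add: val2)
      then show ?thesis using translate_null(2)[OF lin2 f] by simp
    qed
    show "(\<Sum>w\<in>keys f. lookup f w * tensor_coeff (cmatrix Q) (map fst w) (map snd w)) = 0"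
      if Q: "orthogonal_matrix Q" and f: "f \<in> null" for Q f
      using functional_null[OF lin1 f, of Q] by (simp add: val1[OF Q])
  qed
  have sub: "null \<subseteq> orth_ideal"
  proof (rule subset_relations[OF relations_subspace relations_subset_null])
    fix u v :: "('n \<times> 'n) list" and i j :: 'n
    show "(\<Sum>k\<in>UNIV. single (u @ [(i, k), (j, k)] @ v) 1)
       - single (u @ v) (if i = j then 1 else 0) \<in> orth_ideal"
      unfolding free_star_algebra_context[symmetric]
      by (rule relations_in_context) (unfold orth_rels_def, blast)
    show "(\<Sum>k\<in>UNIV. single (u @ [(k, i), (k, j)] @ v) 1)
       - single (u @ v) (if i = j then 1 else 0) \<in> orth_ideal"
      unfolding free_star_algebra_context[symmetric]
      by (rule relations_in_context) (unfold orth_rels_def, blast)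
  qed
  have "inj_on q (carrier free_orthogonal)"
  proof (rule inj_onI)
    fix x y assume "x \<in> carrier free_orthogonal" "y \<in> carrier free_orthogonal" and eq: "q x = q y"
    then obtain f g where f: "x = orth_class f" and g: "y = orth_class g"
      by (metis carrier_free_orthogonal free_orth_alg_carrierE)
    have "f = (f - g) + g" by simp
    then have "q x = q (orth_class (f - g)) \<oplus>\<^bsub>B\<^esub> q (orth_class g)" using q_simps(2)[of "f - g" g] f by simp
    then have "q (orth_class (f - g)) = \<zero>\<^bsub>B\<^esub>"
      using eq g B.add.r_cancel_one'[OF q_simps(1)[of g] q_simps(1)[of "f - g"]] by simp
    then have "f - g \<in> null" by (simp add: null_def)
    then show "x = y" using sub unfolding f g orth_class_eq_iff by blast
  qed
  then show False using not_inj by contradiction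
qed

end
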